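(* Let $N_4=\{1,2,3,4\}$. For every nonnegative monotone submodular function $f:2^{N_4}\to\mathbb{R}_+$ and every $\mathbf{x}\in[0,1]^4$, $$\frac{f^+(\mathbf{x})}{f^{++}(\mathbf{x})}\le\frac43,$$ and the bound is tight, i.e. equality is attained for some nonnegative monotone submodular $f:2^{N_4}\to\mathbb{R}_+$ and some $\mathbf{x}\in[0,1]^4$.
   Context: A set function $f:2^N\to\mathbb{R}_+$ on a finite set $N$ is monotone if $f(S)\le f(T)$ for all $S\subseteq T\subseteq N$, and submodular if $f(S)+f(T)\ge f(S\cap T)+f(S\cup T)$ for all $S,T\subseteq N$. For $N=\{1,\dots,n\}$ and $\mathbf{x}\in[0,1]^n$, the concave closure $f^+(\mathbf{x})$ is the maximum of $\sum_{S\subseteq N}u_Sf(S)$ over all $(u_S)_{S\subseteq N}$ with $u_S\ge0$, $\sum_{S\subseteq N}u_S=1$ and $\sum_{S\ni i}u_S=x_i$ for all $i\in N$. The pairwise independent extension $f^{++}(\mathbf{x})$ is the maximum of $\sum_{S\subseteq N}p_Sf(S)$ over all $(p_S)_{S\subseteq N}$ with $p_S\ge0$, $\sum_{S\subseteq N}p_S=1$, $\sum_{S\ni i}p_S=x_i$ for all $i\in N$, and $\sum_{S\supseteq\{i,j\}}p_S=x_ix_j$ for all $i<j$ in $N$. The ratio is considered whenever $f^{++}(\mathbf{x})>0$. *)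

theory Defs
  imports "HOL-Analysis.Analysis"
begin

abbreviation N4 :: "nat set" where
  "N4 \<equiv> {1, 2, 3, 4}"

text \<open>
  A set function \<open>f : 2^N \<rightarrow> \<real>\<^sub>+\<close> is rendered as a total function on sets, of which only the values
  on \<open>Pow N\<close> are ever used; likewise for the points \<open>x\<close> and the weights \<open>(p\<^sub>S)\<close>.
\<close>

definition nonneg_on :: "nat set \<Rightarrow> (nat set \<Rightarrow> real) \<Rightarrow> bool" where
  "nonneg_on N f \<longleftrightarrow> (\<forall>S. S \<subseteq> N \<longrightarrow> 0 \<le> f S)"

definition submodular :: "nat set \<Rightarrow> (nat set \<Rightarrow> real) \<Rightarrow> bool" where
  "submodular N f \<longleftrightarrow>
     (\<forall>S T. S \<subseteq> N \<and> T \<subseteq> N \<longrightarrow> f S + f T \<ge> f (S \<inter> T) + f (S \<union> T))"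

definition feasible_weights :: "nat set \<Rightarrow> (nat \<Rightarrow> real) \<Rightarrow> (nat set \<Rightarrow> real) set" where
  "feasible_weights N x =
     {u. (\<forall>S\<in>Pow N. u S \<ge> 0) \<and> (\<Sum>S\<in>Pow N. u S) = 1 \<and>
         (\<forall>i\<in>N. (\<Sum>S | S \<subseteq> N \<and> i \<in> S. u S) = x i)}"

definition pairwise_feasible_weights :: "nat set \<Rightarrow> (nat \<Rightarrow> real) \<Rightarrow> (nat set \<Rightarrow> real) set" where
  "pairwise_feasible_weights N x =
     {p. (\<forall>S\<in>Pow N. p S \<ge> 0) \<and> (\<Sum>S\<in>Pow N. p S) = 1 \<and>
         (\<forall>i\<in>N. (\<Sum>S | S \<subseteq> N \<and> i \<in> S. p S) = x i) \<and>
         (\<forall>i\<in>N. \<forall>j\<in>N. i < j \<longrightarrow> (\<Sum>S | S \<subseteq> N \<and> {i, j} \<subseteq> S. p S) = x i * x j)}"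

text \<open>
  Both extensions are maxima, hence \<open>GREATEST\<close>. That these maxima exist for finite \<open>N\<close> and
  \<open>x \<in> [0,1]^N\<close> is proved below.
\<close>

definition concave_closure :: "nat set \<Rightarrow> (nat set \<Rightarrow> real) \<Rightarrow> (nat \<Rightarrow> real) \<Rightarrow> real" where
  "concave_closure N f x =
     (GREATEST v. v \<in> {\<Sum>S\<in>Pow N. u S * f S | u. u \<in> feasible_weights N x})"

definition pairwise_indep_extension :: "nat set \<Rightarrow> (nat set \<Rightarrow> real) \<Rightarrow> (nat \<Rightarrow> real) \<Rightarrow> real" where
  "pairwise_indep_extension N f x =
     (GREATEST v. v \<in> {\<Sum>S\<in>Pow N. p S * f S | p. p \<in> pairwise_feasible_weights N x})"

lemma linear_max_attained:
  fixes D :: "'b set" and c :: "'b \<Rightarrow> real" and C :: "'k \<Rightarrow> 'b set"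
  assumes fin: "finite D" and CD: "\<And>k. k \<in> K \<Longrightarrow> C k \<subseteq> D"
    and W: "W = {u. (\<forall>S\<in>D. u S \<ge> 0) \<and> (\<Sum>S\<in>D. u S) = 1 \<and> (\<forall>k\<in>K. (\<Sum>S\<in>C k. u S) = y k)}"
    and ne: "W \<noteq> {}"
  shows "\<exists>p\<in>W. \<forall>q\<in>W. (\<Sum>S\<in>D. q S * c S) \<le> (\<Sum>S\<in>D. p S * c S)"
proof -
  define B where "B = PiE UNIV (\<lambda>S. if S \<in> D then {0..1::real} else {0})"
  define r where "r u = (\<lambda>S. if S \<in> D then u S else (0::real))" for u
  have B: "compact B"
    unfolding B_def compactin_euclidean_iff[symmetric] euclidean_product_topology[symmetric]
    by (subst compactin_PiE) auto
  have cont: "continuous_on UNIV (\<lambda>u. \<Sum>S\<in>A. u S * d S)" for A :: "'b set" and d :: "'b \<Rightarrow> real"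
    by (intro continuous_intros) auto
  have cont1: "continuous_on UNIV (\<lambda>u. \<Sum>S\<in>A. u S :: real)" for A :: "'b set"
    using cont[of "\<lambda>_. 1" A] by simp
  have W': "W = (\<Inter>S\<in>D. {u. u S \<ge> 0}) \<inter> {u. (\<Sum>S\<in>D. u S) = 1}
             \<inter> (\<Inter>k\<in>K. {u. (\<Sum>S\<in>C k. u S) = y k})"
    unfolding W by auto
  have "closed W"
    unfolding W'
    by (intro closed_Int closed_INT ballI closed_Collect_le closed_Collect_eq cont1
        continuous_on_const continuous_on_product_coordinates)
  then have comp: "compact (B \<inter> W)"
    using B by (rule compact_Int_closed[rotated])
  have rW: "r u \<in> B \<inter> W" and rv: "(\<Sum>S\<in>D. r u S * c S) = (\<Sum>S\<in>D. u S * c S)" if u: "u \<in> W" for u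
  proof -
    have le: "u S \<le> 1" if "S \<in> D" for S
      using member_le_sum[of S D u] fin u that unfolding W by auto
    have "(\<Sum>S\<in>C k. r u S) = (\<Sum>S\<in>C k. u S)" if "k \<in> K" for k
      using CD[OF that] by (intro sum.cong) (auto simp: r_def)
    then show "r u \<in> B \<inter> W"
      using u le unfolding W B_def by (auto simp: r_def)
    show "(\<Sum>S\<in>D. r u S * c S) = (\<Sum>S\<in>D. u S * c S)"
      by (intro sum.cong) (auto simp: r_def)
  qed
  have "B \<inter> W \<noteq> {}" using ne rW by blast
  from continuous_attains_sup[OF comp this continuous_on_subset[OF cont[of c D] subset_UNIV]]
  obtain p where p: "p \<in> B \<inter> W"
    "\<And>q. q \<in> B \<inter> W \<Longrightarrow> (\<Sum>S\<in>D. q S * c S) \<le> (\<Sum>S\<in>D. p S * c S)"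
    by blast
  show ?thesis
  proof (intro bexI[of _ p] ballI)
    fix q assume "q \<in> W"
    then show "(\<Sum>S\<in>D. q S * c S) \<le> (\<Sum>S\<in>D. p S * c S)"
      using p(2)[OF rW] rv by simp
  qed (use p(1) in blast)
qed

lemma pairwise_feasible_subset: "pairwise_feasible_weights N x \<subseteq> feasible_weights N x"
  unfolding pairwise_feasible_weights_def feasible_weights_def by auto

lemma independent_weights_feasible:
  assumes fin: "finite N" and x: "\<forall>i\<in>N. x i \<in> {0..1}"
  shows "(\<lambda>S. (\<Prod>i\<in>S. x i) * (\<Prod>i\<in>N - S. 1 - x i)) \<in> pairwise_feasible_weights N x"
    (is "?p \<in> _")
proof -
  have super: "(\<Sum>S | S \<subseteq> N \<and> T \<subseteq> S. ?p S) = (\<Prod>i\<in>T. x i)" if T: "T \<subseteq> N" for T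
  proof -
    have finT: "finite T" using T fin finite_subset by blast
    have "(\<Sum>S | S \<subseteq> N \<and> T \<subseteq> S. ?p S)
        = (\<Sum>S\<in>Pow N. (\<Prod>i\<in>S. x i) * (\<Prod>i\<in>N - S. if i \<in> T then 0 else 1 - x i))"
    proof (rule sum.mono_neutral_cong_left)
      show "\<forall>S\<in>Pow N - {S. S \<subseteq> N \<and> T \<subseteq> S}.
              (\<Prod>i\<in>S. x i) * (\<Prod>i\<in>N - S. if i \<in> T then 0 else 1 - x i) = 0"
      proof
        fix S assume "S \<in> Pow N - {S. S \<subseteq> N \<and> T \<subseteq> S}"
        then obtain i where "i \<in> N - S" "i \<in> T" using T by blast
        then have "(\<Prod>i\<in>N - S. if i \<in> T then 0 else 1 - x i) = 0"
          using fin by (intro prod_zero) auto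
        then show "(\<Prod>i\<in>S. x i) * (\<Prod>i\<in>N - S. if i \<in> T then 0 else 1 - x i) = 0" by simp
      qed
      fix S assume "S \<in> {S. S \<subseteq> N \<and> T \<subseteq> S}"
      then have "(\<Prod>i\<in>N - S. 1 - x i) = (\<Prod>i\<in>N - S. if i \<in> T then 0 else 1 - x i)"
        by (intro prod.cong) auto
      then show "?p S = (\<Prod>i\<in>S. x i) * (\<Prod>i\<in>N - S. if i \<in> T then 0 else 1 - x i)" by simp
    qed (use fin in auto)
    also have "\<dots> = (\<Prod>i\<in>N. x i + (if i \<in> T then 0 else 1 - x i))"
      by (rule prod_add[OF fin, symmetric])
    also have "\<dots> = (\<Prod>i\<in>T. x i)"
      by (rule prod.mono_neutral_cong_right) (use fin T in auto)
    finally show ?thesis .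
  qed
  have "\<forall>S\<in>Pow N. ?p S \<ge> 0"
    using x by (intro ballI mult_nonneg_nonneg prod_nonneg) auto
  moreover have "(\<Sum>S\<in>Pow N. ?p S) = 1"
    using super[of "{}"] by (simp add: Pow_def)
  moreover have "(\<Sum>S | S \<subseteq> N \<and> i \<in> S. ?p S) = x i" if "i \<in> N" for i
    using super[of "{i}"] that by simp
  moreover have "(\<Sum>S | S \<subseteq> N \<and> {i, j} \<subseteq> S. ?p S) = x i * x j" if "i \<in> N" "j \<in> N" "i < j" for i j
    using super[of "{i, j}"] that by simp
  ultimately show ?thesis
    unfolding pairwise_feasible_weights_def by blast
qed

lemma Greatest_attained:
  fixes g :: "'b \<Rightarrow> real"
  assumes "\<exists>p\<in>W. \<forall>q\<in>W. g q \<le> g p"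
  shows "\<exists>p\<in>W. (GREATEST v. v \<in> {g q | q. q \<in> W}) = g p \<and> (\<forall>q\<in>W. g q \<le> g p)"
proof -
  obtain p where p: "p \<in> W" "\<forall>q\<in>W. g q \<le> g p" using assms by blast
  then have "(GREATEST v. v \<in> {g q | q. q \<in> W}) = g p"
    by (intro Greatest_equality) auto
  with p show ?thesis by blast
qed

lemma concave_closure_attained:
  assumes fin: "finite N" and x: "\<forall>i\<in>N. x i \<in> {0..1}"
  shows "\<exists>u\<in>feasible_weights N x. concave_closure N f x = (\<Sum>S\<in>Pow N. u S * f S) \<and>
    (\<forall>v\<in>feasible_weights N x. (\<Sum>S\<in>Pow N. v S * f S) \<le> (\<Sum>S\<in>Pow N. u S * f S))"
  unfolding concave_closure_def
proof (rule Greatest_attained, rule linear_max_attained)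
  show "feasible_weights N x = {u. (\<forall>S\<in>Pow N. u S \<ge> 0) \<and> (\<Sum>S\<in>Pow N. u S) = 1 \<and>
      (\<forall>i\<in>N. (\<Sum>S\<in>{S. S \<subseteq> N \<and> i \<in> S}. u S) = x i)}"
    by (simp add: feasible_weights_def)
  show "feasible_weights N x \<noteq> {}"
    using independent_weights_feasible[OF assms] pairwise_feasible_subset by blast
qed (use fin in auto)

lemma pairwise_indep_extension_attained:
  assumes fin: "finite N" and x: "\<forall>i\<in>N. x i \<in> {0..1}"
  shows "\<exists>p\<in>pairwise_feasible_weights N x.
    pairwise_indep_extension N f x = (\<Sum>S\<in>Pow N. p S * f S) \<and>
    (\<forall>q\<in>pairwise_feasible_weights N x. (\<Sum>S\<in>Pow N. q S * f S) \<le> (\<Sum>S\<in>Pow N. p S * f S))"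
  unfolding pairwise_indep_extension_def
proof (rule Greatest_attained, rule linear_max_attained)
  let ?K = "{(i, j). i \<in> N \<and> j \<in> N \<and> i \<le> j}"
  let ?C = "\<lambda>(i, j). {S. S \<subseteq> N \<and> {i, j} \<subseteq> S}"
  let ?y = "\<lambda>(i, j). if i = j then x i else x i * x j"
  show "pairwise_feasible_weights N x = {u. (\<forall>S\<in>Pow N. u S \<ge> 0) \<and> (\<Sum>S\<in>Pow N. u S) = 1 \<and>
      (\<forall>k\<in>?K. (\<Sum>S\<in>?C k. u S) = ?y k)}"
  proof -
    have "(\<forall>k\<in>?K. (\<Sum>S\<in>?C k. u S) = ?y k) \<longleftrightarrow>
        (\<forall>i\<in>N. (\<Sum>S | S \<subseteq> N \<and> i \<in> S. u S) = x i) \<and>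
        (\<forall>i\<in>N. \<forall>j\<in>N. i < j \<longrightarrow> (\<Sum>S | S \<subseteq> N \<and> {i, j} \<subseteq> S. u S) = x i * x j)"
      (is "?L \<longleftrightarrow> ?R1 \<and> ?R2") for u :: "nat set \<Rightarrow> real"
    proof (intro iffI conjI ballI impI)
      assume L: ?L
      show "(\<Sum>S | S \<subseteq> N \<and> i \<in> S. u S) = x i" if "i \<in> N" for i
        using bspec[OF L, of "(i, i)"] that by simp
      show "(\<Sum>S | S \<subseteq> N \<and> {i, j} \<subseteq> S. u S) = x i * x j" if "i \<in> N" "j \<in> N" "i < j" for i j
        using bspec[OF L, of "(i, j)"] that by simp
    next
      fix k assume R: "?R1 \<and> ?R2" and "k \<in> ?K"
      then obtain i j where "k = (i, j)" "i \<in> N" "j \<in> N" "i = j \<or> i < j"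
        by (auto simp: order.order_iff_strict)
      then show "(\<Sum>S\<in>?C k. u S) = ?y k" using R by auto
    qed
    then show ?thesis unfolding pairwise_feasible_weights_def by blast
  qed
  show "pairwise_feasible_weights N x \<noteq> {}"
    using independent_weights_feasible[OF assms] by blast
qed (use fin in auto)

end

(*
  For every x there are pairwise independent weights p, depending on x only, with
  E_p f >= 3/4 E_u f for all polymatroids f and all weights u with marginals x. This is linear in f,
  so it has to be checked only for the 41 extreme polymatroids on four elements (and for constants).
  For most of these it holds for all pairwise independent weights: E_u f is at most min W K, where W is
  linear in x and K is the rank, and second moments give E_p f >= W - Q with Q <= W^2 / (4 K), which is
  enough; the Ingleton polymatroid needs several W. The remaining ones (the indicators of meeting a set
  with at least three elements, the rank function of U(2,3) with one element doubled, and
  min(2, |S| + [i in S])) restrict the third and fourth moments of p. Sort x1 <= x2 <= x3 <= x4. If x1 + x2 + x3 <= 1, take the star: two of the elements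
  1, 2, 3 occur together only in the presence of all larger ones. If x1 + x2 + x3 >= 1, perturb the star
  so that the empty set gets weight 0 as long as (1 - x1)(1 - x2)(1 - x3) > 1/4, and perturb the product
  weights otherwise.
  The bound is attained by f S = [S meets {1, 2}] and x = (1/2, 1/2, 0, 0).
*)

theory Submission
  imports Defs
begin

section \<open>Expectations over the subsets of a four-element set\<close>

text \<open>Why one p for all f: if p depended on f, the linear functional E_p - 3/4 E_u would
  change with f, and its sign on generators of the polymatroid cone would say nothing about f.
  Pairwise independence on four elements leaves five degrees of freedom, the weights of the four
  triples and of the whole set, and the rays pull them apart: meeting a set gains from higher
  moments, the doubled and parallel rays lose with them. Product weights have too little of them: at
  x = (1/4, 1/4, 1/4, 1/4) they meet the whole set with probability 175/256 < 3/4, while a uniformly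
  random singleton always does. In the star the correction to a union bound W becomes a single
  product v * w with v + w = W, hence at most W^2 / 4. Its empty set has weight (1 - x4) * (1 - x1 -
  x2 - x3), which gives the first border. The second border has 1/4 because a set of marginal sum at
  least 1 must be met with probability 3/4, and (1 - x1) * (1 - x2) * (1 - x3) is the probability
  that product weights miss the three least likely elements.\<close>

lemma distinct4_neq:
  assumes "distinct [a, b, c, d]"
  shows "a \<noteq> b" "a \<noteq> c" "a \<noteq> d" "b \<noteq> c" "b \<noteq> d" "c \<noteq> d"
    "b \<noteq> a" "c \<noteq> a" "d \<noteq> a" "c \<noteq> b" "d \<noteq> b" "d \<noteq> c"
  using assms by auto

definition ev :: "nat set \<Rightarrow> (nat set \<Rightarrow> real) \<Rightarrow> (nat set \<Rightarrow> real) \<Rightarrow> real" where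
  "ev N p f = (\<Sum>S\<in>Pow N. p S * f S)"

lemma sum_Pow4:
  fixes g :: "nat set \<Rightarrow> real"
  assumes "distinct [a, b, c, d]"
  shows "(\<Sum>S\<in>Pow {a, b, c, d}. g S) = g {} + g {a} + g {b} + g {c} + g {d}
    + g {a, b} + g {a, c} + g {a, d} + g {b, c} + g {b, d} + g {c, d}
    + g {a, b, c} + g {a, b, d} + g {a, c, d} + g {b, c, d} + g {a, b, c, d}"
proof -
  have split: "(\<Sum>S\<in>Pow (insert i A). h S) = (\<Sum>S\<in>Pow A. h S) + (\<Sum>S\<in>Pow A. h (insert i S))"
    if "finite A" "i \<notin> A" for i A and h :: "nat set \<Rightarrow> real"
  proof -
    have "inj_on (insert i) (Pow A)" using that(2) by (auto simp: inj_on_def)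
    moreover have "Pow A \<inter> insert i ` Pow A = {}" using that(2) by auto
    ultimately show ?thesis
      using that(1) by (simp add: Pow_insert sum.union_disjoint sum.reindex)
  qed
  show ?thesis using assms by (simp add: split insert_commute)
qed

lemma sum_superset:
  fixes P :: "nat set \<Rightarrow> bool" and p :: "nat set \<Rightarrow> real"
  assumes "finite N"
  shows "(\<Sum>S | S \<subseteq> N \<and> P S. p S) = (\<Sum>S\<in>Pow N. if P S then p S else 0)"
  using sum.inter_filter[of "Pow N" p P] assms by (simp add: Pow_def)

text \<open>The constraints written out in the sixteen weights, so that linear arithmetic can use
  them.\<close>

lemma feasible4:
  assumes D: "distinct [a, b, c, d]" and u: "u \<in> feasible_weights {a, b, c, d} x"
  shows "0 \<le> u {}" "0 \<le> u {a}" "0 \<le> u {b}" "0 \<le> u {c}" "0 \<le> u {d}"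
    "0 \<le> u {a, b}" "0 \<le> u {a, c}" "0 \<le> u {a, d}" "0 \<le> u {b, c}" "0 \<le> u {b, d}" "0 \<le> u {c, d}"
    "0 \<le> u {a, b, c}" "0 \<le> u {a, b, d}" "0 \<le> u {a, c, d}" "0 \<le> u {b, c, d}" "0 \<le> u {a, b, c, d}"
    "u {} + u {a} + u {b} + u {c} + u {d}
    + u {a, b} + u {a, c} + u {a, d} + u {b, c} + u {b, d} + u {c, d}
    + u {a, b, c} + u {a, b, d} + u {a, c, d} + u {b, c, d} + u {a, b, c, d} = 1"
    "x a = u {a} + u {a, b} + u {a, c} + u {a, d} + u {a, b, c} + u {a, b, d} + u {a, c, d} + u {a, b, c, d}"
    "x b = u {b} + u {a, b} + u {b, c} + u {b, d} + u {a, b, c} + u {a, b, d} + u {b, c, d} + u {a, b, c, d}"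
    "x c = u {c} + u {a, c} + u {b, c} + u {c, d} + u {a, b, c} + u {a, c, d} + u {b, c, d} + u {a, b, c, d}"
    "x d = u {d} + u {a, d} + u {b, d} + u {c, d} + u {a, b, d} + u {a, c, d} + u {b, c, d} + u {a, b, c, d}"
proof -
  let ?N = "{a, b, c, d}"
  note neq = distinct4_neq[OF D]
  have nn: "0 \<le> u S" if "S \<subseteq> ?N" for S using u that by (auto simp: feasible_weights_def)
  show "0 \<le> u {}" "0 \<le> u {a}" "0 \<le> u {b}" "0 \<le> u {c}" "0 \<le> u {d}"
    "0 \<le> u {a, b}" "0 \<le> u {a, c}" "0 \<le> u {a, d}" "0 \<le> u {b, c}" "0 \<le> u {b, d}" "0 \<le> u {c, d}"
    "0 \<le> u {a, b, c}" "0 \<le> u {a, b, d}" "0 \<le> u {a, c, d}" "0 \<le> u {b, c, d}" "0 \<le> u ?N"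
    by (rule nn; simp)+
  show "u {} + u {a} + u {b} + u {c} + u {d}
    + u {a, b} + u {a, c} + u {a, d} + u {b, c} + u {b, d} + u {c, d}
    + u {a, b, c} + u {a, b, d} + u {a, c, d} + u {b, c, d} + u {a, b, c, d} = 1"
    using u sum_Pow4[OF D, of u] by (simp add: feasible_weights_def)
  have m: "x i = (\<Sum>S\<in>Pow ?N. if i \<in> S then u S else 0)" if "i \<in> ?N" for i
  proof -
    have "(\<Sum>S | S \<subseteq> ?N \<and> i \<in> S. u S) = x i"
      using u that unfolding feasible_weights_def by blast
    then show ?thesis by (simp only: sum_superset finite.intros)
  qed
  show "x a = u {a} + u {a, b} + u {a, c} + u {a, d} + u {a, b, c} + u {a, b, d} + u {a, c, d} + u {a, b, c, d}"
    "x b = u {b} + u {a, b} + u {b, c} + u {b, d} + u {a, b, c} + u {a, b, d} + u {b, c, d} + u {a, b, c, d}"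
    "x c = u {c} + u {a, c} + u {b, c} + u {c, d} + u {a, b, c} + u {a, c, d} + u {b, c, d} + u {a, b, c, d}"
    "x d = u {d} + u {a, d} + u {b, d} + u {c, d} + u {a, b, d} + u {a, c, d} + u {b, c, d} + u {a, b, c, d}"
    by (simp_all add: neq m sum_Pow4[OF D])
qed

lemma pairwise_feasible4:
  assumes D: "distinct [a, b, c, d]" and p: "p \<in> pairwise_feasible_weights {a, b, c, d} x"
  shows "x a * x b = p {a, b} + p {a, b, c} + p {a, b, d} + p {a, b, c, d}"
    "x a * x c = p {a, c} + p {a, b, c} + p {a, c, d} + p {a, b, c, d}"
    "x a * x d = p {a, d} + p {a, b, d} + p {a, c, d} + p {a, b, c, d}"
    "x b * x c = p {b, c} + p {a, b, c} + p {b, c, d} + p {a, b, c, d}"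
    "x b * x d = p {b, d} + p {a, b, d} + p {b, c, d} + p {a, b, c, d}"
    "x c * x d = p {c, d} + p {a, c, d} + p {b, c, d} + p {a, b, c, d}"
proof -
  let ?N = "{a, b, c, d}"
  note neq = distinct4_neq[OF D]
  have m: "x i * x j = (\<Sum>S\<in>Pow ?N. if {i, j} \<subseteq> S then p S else 0)"
    if "i \<in> ?N" "j \<in> ?N" "i \<noteq> j" for i j
  proof -
    have ordered: "x k * x l = (\<Sum>S\<in>Pow ?N. if {k, l} \<subseteq> S then p S else 0)"
      if "k \<in> ?N" "l \<in> ?N" "k < l" for k l
    proof -
      have "(\<Sum>S | S \<subseteq> ?N \<and> {k, l} \<subseteq> S. p S) = x k * x l"
        using p that unfolding pairwise_feasible_weights_def by blast
      then show ?thesis by (simp only: sum_superset finite.intros)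
    qed
    show ?thesis
    proof (cases "i < j")
      case True
      with ordered that show ?thesis by blast
    next
      case False
      with that have "j < i" by simp
      with ordered[of j i] that show ?thesis
        by (simp only: mult.commute[of "x i"] insert_commute[of i])
    qed
  qed
  show "x a * x b = p {a, b} + p {a, b, c} + p {a, b, d} + p {a, b, c, d}"
    "x a * x c = p {a, c} + p {a, b, c} + p {a, c, d} + p {a, b, c, d}"
    "x a * x d = p {a, d} + p {a, b, d} + p {a, c, d} + p {a, b, c, d}"
    "x b * x c = p {b, c} + p {a, b, c} + p {b, c, d} + p {a, b, c, d}"
    "x b * x d = p {b, d} + p {a, b, d} + p {b, c, d} + p {a, b, c, d}"
    "x c * x d = p {c, d} + p {a, c, d} + p {b, c, d} + p {a, b, c, d}"
    by (simp_all add: neq m sum_Pow4[OF D])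
qed

section \<open>The families of extreme polymatroids and the truncation inequality\<close>

definition hit :: "nat set \<Rightarrow> nat set \<Rightarrow> real" where
  "hit A S = of_bool (S \<inter> A \<noteq> {})"

text \<open>Truncations of modular functions; with unit weights on four elements,
  \<open>cap 2\<close> and \<open>cap 3\<close> are the rank functions of the uniform matroids
  U(2,4) and U(3,4).\<close>

definition cap :: "real \<Rightarrow> (nat \<Rightarrow> real) \<Rightarrow> nat set \<Rightarrow> real" where
  "cap k w S = min k (\<Sum>i\<in>S. w i)"

definition parallel :: "nat \<Rightarrow> nat \<Rightarrow> nat set \<Rightarrow> real" where
  "parallel i j S = min 2 (hit {i, j} S + real (card (S - {i, j})))"

text \<open>The polymatroid of rank 4 that violates Ingleton's inequality: the Vamos matroid with
  its eight points grouped into four pairs, where {i, j} are the two groups whose union is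
  independent.\<close>

definition ingleton :: "nat \<Rightarrow> nat \<Rightarrow> nat set \<Rightarrow> real" where
  "ingleton i j S = (if card S = 2 \<and> S \<noteq> {i, j} then 3 else min 4 (2 * real (card S)))"

lemma ev4:
  assumes "distinct [a, b, c, d]"
  shows "ev {a, b, c, d} p f = p {} * f {} + p {a} * f {a} + p {b} * f {b} + p {c} * f {c} + p {d} * f {d}
    + p {a, b} * f {a, b} + p {a, c} * f {a, c} + p {a, d} * f {a, d}
    + p {b, c} * f {b, c} + p {b, d} * f {b, d} + p {c, d} * f {c, d}
    + p {a, b, c} * f {a, b, c} + p {a, b, d} * f {a, b, d} + p {a, c, d} * f {a, c, d}
    + p {b, c, d} * f {b, c, d} + p {a, b, c, d} * f {a, b, c, d}"
  unfolding ev_def by (rule sum_Pow4[OF assms])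

text \<open>
  The source of the constant: \<open>W - W\<^sup>2 / (4 K)\<close> is at least \<open>3/4 min W K\<close> between \<open>0\<close> and \<open>3 K\<close>.
\<close>

lemma truncation_bound:
  fixes W K Q v e :: real
  assumes "v \<le> W" "v \<le> K" "0 \<le> W" "W \<le> 3 * K" "0 < K" "4 * K * Q \<le> W\<^sup>2" "W - Q \<le> e"
  shows "3 / 4 * v \<le> e"
proof (cases "W \<le> K")
  case True
  have "W * W \<le> K * W" using True assms by (intro mult_right_mono) auto
  then have "K * (4 * Q) \<le> K * W" using assms(6) by (simp add: power2_eq_square algebra_simps)
  then have "4 * Q \<le> W" using assms by simp
  then show ?thesis using assms by linarith
next
  case False
  have "0 \<le> (W - K) * (3 * K - W)" using False assms by (intro mult_nonneg_nonneg) auto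
  then have "K * (4 * Q) \<le> K * (4 * W - 3 * K)"
    using assms(6) by (simp add: power2_eq_square algebra_simps)
  then have "4 * Q \<le> 4 * W - 3 * K" using assms by simp
  then show ?thesis using assms by linarith
qed

lemma scaled_bound:
  fixes v w e e' :: real
  assumes "v \<le> w" "e' \<le> e" "3 / 4 * w \<le> e'"
  shows "3 / 4 * v \<le> e"
  using assms by linarith

lemma affine_nonneg:
  fixes l s h m n :: real
  assumes "l \<le> s" "s \<le> h" "0 \<le> m * l + n" "0 \<le> m * h + n"
  shows "0 \<le> m * s + n"
proof (cases "0 \<le> m")
  case True
  then have "m * l \<le> m * s" using assms by (intro mult_left_mono)
  then show ?thesis using assms by linarith
next
  case False
  then have "m * h \<le> m * s" using assms by (intro mult_left_mono_neg) auto
  then show ?thesis using assms by linarith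
qed

text \<open>The four left sides are 3/4 of the linear majorants of the Ingleton polymatroid.
  Consecutive majorants agree at s = 2 - 2 * t, 2 - t and 2 - t / 2, so the cases say which one is
  least. With t fixed, the difference of the two sides is affine in s, and it suffices to check the
  ends of each strip; \<open>A\<close>, \<open>B\<close> and \<open>C\<close> are the quadratics in
  t left over at the three breakpoints.\<close>

lemma ingleton_quadratic:
  fixes s t :: real
  assumes "0 \<le> s" "s \<le> 2" "0 \<le> t" "t \<le> 2"
  shows "3 / 4 * (2 * (s + t)) \<le> 2 * (s + t) - s * t - t\<^sup>2 / 4 \<or>
    3 / 4 * (1 + 3 / 2 * s + t) \<le> 2 * (s + t) - s * t - t\<^sup>2 / 4 \<or>
    3 / 4 * (2 + s + t / 2) \<le> 2 * (s + t) - s * t - t\<^sup>2 / 4 \<or>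
    3 / 4 * 4 \<le> 2 * (s + t) - s * t - t\<^sup>2 / 4"
proof -
  have A: "0 \<le> 1 - 5 / 2 * t + 7 / 4 * t\<^sup>2"
    using zero_le_power2[of "t - 5 / 7"] by (simp add: power2_eq_square algebra_simps)
  have B: "0 \<le> 1 - 13 / 8 * t + 3 / 4 * t\<^sup>2"
    using zero_le_power2[of "t - 13 / 12"] by (simp add: power2_eq_square algebra_simps)
  have C: "0 \<le> 1 - t + t\<^sup>2 / 4"
    using zero_le_power2[of "1 - t / 2"] by (simp add: power2_eq_square algebra_simps)
  have D: "t\<^sup>2 \<le> 2 * t" using assms by (simp add: power2_eq_square mult_right_mono)
  consider "s \<le> 2 - 2 * t" | "2 - 2 * t \<le> s" "s \<le> 2 - t" | "2 - t \<le> s" "s \<le> 2 - t / 2" | "2 - t / 2 \<le> s"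
    by linarith
  then show ?thesis
  proof cases
    case 1
    have "0 \<le> (1 / 2 - t) * s + (t / 2 - t\<^sup>2 / 4)"
      by (rule affine_nonneg[OF assms(1) 1]) (use A D in \<open>simp_all add: power2_eq_square algebra_simps\<close>)
    then show ?thesis by (simp add: algebra_simps)
  next
    case 2
    have "0 \<le> (7 / 8 - t) * s + (5 / 4 * t - t\<^sup>2 / 4 - 3 / 4)"
      by (rule affine_nonneg[OF 2]) (use A B in \<open>simp_all add: power2_eq_square field_simps\<close>)
    then show ?thesis by (simp add: algebra_simps)
  next
    case 3
    have "0 \<le> (5 / 4 - t) * s + (13 / 8 * t - t\<^sup>2 / 4 - 3 / 2)"
      by (rule affine_nonneg[OF 3]) (use B C in \<open>simp add: power2_eq_square field_simps; linarith\<close>)+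
    then show ?thesis by (simp add: algebra_simps)
  next
    case 4
    have "0 \<le> (2 - t) * s + (2 * t - t\<^sup>2 / 4 - 3)"
      by (rule affine_nonneg[OF 4 assms(2)]) (use C D in \<open>simp_all add: power2_eq_square field_simps\<close>)
    then show ?thesis by (simp add: algebra_simps)
  qed
qed

section \<open>Bounds and exact values under arbitrary pairwise independent weights\<close>

context
  fixes a b c d :: nat and x :: "nat \<Rightarrow> real" and p u :: "nat set \<Rightarrow> real"
  assumes D: "distinct [a, b, c, d]" and x: "\<forall>i\<in>{a, b, c, d}. x i \<in> {0..1}"
    and p: "p \<in> pairwise_feasible_weights {a, b, c, d} x"
    and u: "u \<in> feasible_weights {a, b, c, d} x"
begin

private lemmas neq = distinct4_neq[OF D]
private lemmas p_marginal = subsetD[OF pairwise_feasible_subset p]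
private lemmas p_nonneg = feasible4(1-16)[OF D p_marginal]
private lemmas p_single = feasible4(18-21)[OF D p_marginal]
private lemmas p_pair = pairwise_feasible4[OF D p]
private lemmas uf = feasible4[OF D u]

private lemma x01: "0 \<le> x a" "0 \<le> x b" "0 \<le> x c" "0 \<le> x d" "x a \<le> 1" "x b \<le> 1" "x c \<le> 1" "x d \<le> 1"
  using x by auto

text \<open>Pointwise, min 2 n >= n - (n choose 2) / 3 for n <= 4. The factor 1/3 is forced by
  equality at n = 3 and n = 4. Taking expectations turns n choose 2 into the sum of the pair
  products, since pairs are independent; the next three lemmas work in the same way.\<close>

lemma dominates_uniform2: "3 / 4 * ev {a, b, c, d} u (cap 2 (\<lambda>_. 1)) \<le> ev {a, b, c, d} p (cap 2 (\<lambda>_. 1))"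
proof (rule truncation_bound[where K = 2 and W = "x a + x b + x c + x d"])
  let ?Q = "(x a * x b + x a * x c + x a * x d + x b * x c + x b * x d + x c * x d) / 3"
  show "ev {a, b, c, d} u (cap 2 (\<lambda>_. 1)) \<le> x a + x b + x c + x d"
    "ev {a, b, c, d} u (cap 2 (\<lambda>_. 1)) \<le> 2"
    by (simp_all add: neq ev4[OF D] cap_def) (use uf in linarith | use uf in \<open>simp add: field_simps\<close>)+
  show "x a + x b + x c + x d - ?Q \<le> ev {a, b, c, d} p (cap 2 (\<lambda>_. 1))"
    by (simp add: neq ev4[OF D] cap_def) (unfold p_pair, unfold p_single, insert p_nonneg, (linarith | simp add: field_simps))
  have "3 * (x a + x b + x c + x d)\<^sup>2 - 24 * ?Q = (x a - x b)\<^sup>2 + (x a - x c)\<^sup>2 + (x a - x d)\<^sup>2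
     + (x b - x c)\<^sup>2 + (x b - x d)\<^sup>2 + (x c - x d)\<^sup>2"
    by (simp add: power2_eq_square algebra_simps)
  moreover have "0 \<le> (x a - x b)\<^sup>2 + (x a - x c)\<^sup>2 + (x a - x d)\<^sup>2
     + (x b - x c)\<^sup>2 + (x b - x d)\<^sup>2 + (x c - x d)\<^sup>2"
    by (intro add_nonneg_nonneg zero_le_power2)
  ultimately show "4 * 2 * ?Q \<le> (x a + x b + x c + x d)\<^sup>2"
    by linarith
qed (use x01 in auto)

text \<open>Here the factor 1/6 is forced by n = 4, where the excess 1 is spread over six
  pairs.\<close>

lemma dominates_uniform3: "3 / 4 * ev {a, b, c, d} u (cap 3 (\<lambda>_. 1)) \<le> ev {a, b, c, d} p (cap 3 (\<lambda>_. 1))"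
proof (rule truncation_bound[where K = 3 and W = "x a + x b + x c + x d"])
  let ?Q = "(x a * x b + x a * x c + x a * x d + x b * x c + x b * x d + x c * x d) / 6"
  show "ev {a, b, c, d} u (cap 3 (\<lambda>_. 1)) \<le> x a + x b + x c + x d"
    "ev {a, b, c, d} u (cap 3 (\<lambda>_. 1)) \<le> 3"
    by (simp_all add: neq ev4[OF D] cap_def) (use uf in linarith | use uf in \<open>simp add: field_simps\<close>)+
  show "x a + x b + x c + x d - ?Q \<le> ev {a, b, c, d} p (cap 3 (\<lambda>_. 1))"
    by (simp add: neq ev4[OF D] cap_def) (unfold p_pair, unfold p_single, insert p_nonneg, (linarith | simp add: field_simps))
  have "(x a + x b + x c + x d)\<^sup>2 - 12 * ?Q = x a ^ 2 + x b ^ 2 + x c ^ 2 + x d ^ 2"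
    by (simp add: power2_eq_square algebra_simps)
  moreover have "0 \<le> x a ^ 2 + x b ^ 2 + x c ^ 2 + x d ^ 2"
    by (intro add_nonneg_nonneg zero_le_power2)
  ultimately show "4 * 3 * ?Q \<le> (x a + x b + x c + x d)\<^sup>2"
    by linarith
qed (use x01 in auto)

lemma dominates_loop: "3 / 4 * ev {a, b, c, d} u (cap 2 ((\<lambda>_. 1)(d := 0))) \<le> ev {a, b, c, d} p (cap 2 ((\<lambda>_. 1)(d := 0)))"
proof (rule truncation_bound[where K = 2 and W = "x a + x b + x c"])
  let ?Q = "(x a * x b + x a * x c + x b * x c) / 3"
  show "ev {a, b, c, d} u (cap 2 ((\<lambda>_. 1)(d := 0))) \<le> x a + x b + x c"
    "ev {a, b, c, d} u (cap 2 ((\<lambda>_. 1)(d := 0))) \<le> 2"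
    by (simp_all add: neq ev4[OF D] cap_def) (use uf in linarith | use uf in \<open>simp add: field_simps\<close>)+
  show "x a + x b + x c - ?Q \<le> ev {a, b, c, d} p (cap 2 ((\<lambda>_. 1)(d := 0)))"
    by (simp add: neq ev4[OF D] cap_def) (unfold p_pair, unfold p_single, insert p_nonneg, (linarith | simp add: field_simps))
  have "3 * (x a + x b + x c)\<^sup>2 - 24 * ?Q = (x a - x b)\<^sup>2 + (x a - x c)\<^sup>2
     + (x b - x c)\<^sup>2 + x a ^ 2 + x b ^ 2 + x c ^ 2"
    by (simp add: power2_eq_square algebra_simps)
  moreover have "0 \<le> (x a - x b)\<^sup>2 + (x a - x c)\<^sup>2
     + (x b - x c)\<^sup>2 + x a ^ 2 + x b ^ 2 + x c ^ 2"
    by (intro add_nonneg_nonneg zero_le_power2)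
  ultimately show "4 * 2 * ?Q \<le> (x a + x b + x c)\<^sup>2"
    by linarith
qed (use x01 in auto)

text \<open>Pairs that contain the doubled element get 1/2 and the others 1/6, which is tight on the
  whole set: 5 - 3/2 - 1/2 = 3.\<close>

lemma dominates_double3: "3 / 4 * ev {a, b, c, d} u (cap 3 ((\<lambda>_. 1)(d := 2))) \<le> ev {a, b, c, d} p (cap 3 ((\<lambda>_. 1)(d := 2)))"
proof (rule truncation_bound[where K = 3 and W = "x a + x b + x c + 2 * x d"])
  let ?Q = "(x a * x d + x b * x d + x c * x d) / 2 + (x a * x b + x a * x c + x b * x c) / 6"
  show "ev {a, b, c, d} u (cap 3 ((\<lambda>_. 1)(d := 2))) \<le> x a + x b + x c + 2 * x d"
    "ev {a, b, c, d} u (cap 3 ((\<lambda>_. 1)(d := 2))) \<le> 3"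
    by (simp_all add: neq ev4[OF D] cap_def) (use uf in linarith | use uf in \<open>simp add: field_simps\<close>)+
  show "x a + x b + x c + 2 * x d - ?Q \<le> ev {a, b, c, d} p (cap 3 ((\<lambda>_. 1)(d := 2)))"
    by (simp add: neq ev4[OF D] cap_def) (unfold p_pair, unfold p_single, insert p_nonneg, (linarith | simp add: field_simps))
  have "4 * (x a + x b + x c + 2 * x d)\<^sup>2 - 48 * ?Q = (4 * x d - (x a + x b + x c))\<^sup>2 + ((x a - x b)\<^sup>2 + (x a - x c)\<^sup>2
     + (x b - x c)\<^sup>2) + x a ^ 2 + x b ^ 2 + x c ^ 2"
    by (simp add: power2_eq_square field_simps)
  moreover have "0 \<le> (4 * x d - (x a + x b + x c))\<^sup>2 + ((x a - x b)\<^sup>2 + (x a - x c)\<^sup>2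
     + (x b - x c)\<^sup>2) + x a ^ 2 + x b ^ 2 + x c ^ 2"
    by (intro add_nonneg_nonneg zero_le_power2)
  ultimately show "4 * 3 * ?Q \<le> (x a + x b + x c + 2 * x d)\<^sup>2"
    by linarith
qed (use x01 in auto)

lemma dominates_hit1: "3 / 4 * ev {a, b, c, d} u (hit {a}) \<le> ev {a, b, c, d} p (hit {a})"
proof -
  have "ev {a, b, c, d} q (hit {a}) = x a" if "q \<in> feasible_weights {a, b, c, d} x" for q
    using feasible4(18)[OF D that] by (simp add: neq ev4[OF D] hit_def)
  then show ?thesis using u p_marginal x01 by simp
qed

lemma dominates_hit2: "3 / 4 * ev {a, b, c, d} u (hit {a, b}) \<le> ev {a, b, c, d} p (hit {a, b})"
proof (rule truncation_bound[where K = 1 and W = "x a + x b"])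
  show "ev {a, b, c, d} u (hit {a, b}) \<le> x a + x b" "ev {a, b, c, d} u (hit {a, b}) \<le> 1"
    by (simp_all add: neq ev4[OF D] hit_def) (use uf in linarith | use uf in \<open>simp add: field_simps\<close>)+
  show "x a + x b - x a * x b \<le> ev {a, b, c, d} p (hit {a, b})"
    by (simp add: neq ev4[OF D] hit_def) (unfold p_pair, unfold p_single, insert p_nonneg, (linarith | simp add: field_simps))
  show "4 * 1 * (x a * x b) \<le> (x a + x b)\<^sup>2"
    using zero_le_power2[of "x a - x b"] by (simp add: power2_eq_square algebra_simps)
qed (use x01 in auto)

text \<open>No single pair W, K suffices here, so a lower bound that is quadratic in the two
  marginal sums is compared with the minimum of four linear majorants.\<close>

lemma dominates_ingleton: "3 / 4 * ev {a, b, c, d} u (ingleton a b) \<le> ev {a, b, c, d} p (ingleton a b)"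
proof -
  define s t where "s = x a + x b" and "t = x c + x d"
  have st: "0 \<le> s" "s \<le> 2" "0 \<le> t" "t \<le> 2" using x01 by (auto simp: s_def t_def)
  have "4 * (x c * x d) \<le> t\<^sup>2"
    using zero_le_power2[of "x c - x d"] by (simp add: t_def power2_eq_square algebra_simps)
  \<comment> \<open>Pointwise, the polymatroid is at least 2 |S| minus the number of pairs in S
    other than {a, b}; each of these five pairs has rank 3, one less than modular.\<close>
  moreover have "2 * (s + t) - s * t - x c * x d \<le> ev {a, b, c, d} p (ingleton a b)"
    by (simp add: neq ev4[OF D] ingleton_def doubleton_eq_iff s_def t_def distrib_left distrib_right) (unfold p_pair, unfold p_single, insert p_nonneg, (linarith | simp add: field_simps))
  ultimately have E: "2 * (s + t) - s * t - t\<^sup>2 / 4 \<le> ev {a, b, c, d} p (ingleton a b)"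
    by linarith
  have U: "ev {a, b, c, d} u (ingleton a b) \<le> 2 * (s + t)"
    "ev {a, b, c, d} u (ingleton a b) \<le> 1 + 3 / 2 * s + t"
    "ev {a, b, c, d} u (ingleton a b) \<le> 2 + s + t / 2"
    "ev {a, b, c, d} u (ingleton a b) \<le> 4"
    by (simp_all add: neq ev4[OF D] ingleton_def doubleton_eq_iff s_def t_def) (use uf in linarith | use uf in \<open>simp add: field_simps\<close>)+
  from ingleton_quadratic[OF st] show ?thesis
    by (elim disjE) (rule scaled_bound; (rule U E | assumption))+
qed

text \<open>Inclusion-exclusion. The last bracket is the third moment, the only term that the
  marginals do not fix.\<close>

lemma ev_hit3: "ev {a, b, c, d} p (hit {a, b, c}) =
    x a + x b + x c - (x a * x b + x a * x c + x b * x c) + (p {a, b, c} + p {a, b, c, d})"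
  by (simp add: neq ev4[OF D] hit_def) (unfold p_pair, unfold p_single, simp add: algebra_simps)

lemma ev_hit4: "ev {a, b, c, d} p (hit {a, b, c, d}) =
    x a + x b + x c + x d - (x a * x b + x a * x c + x a * x d + x b * x c + x b * x d + x c * x d)
    + (p {a, b, c} + p {a, b, d} + p {a, c, d} + p {b, c, d} + 3 * p {a, b, c, d})"
  by (simp add: neq ev4[OF D] hit_def) (unfold p_pair, unfold p_single, simp add: algebra_simps)

text \<open>The excess of the modular function over its truncation is k on a set consisting of d and
  k other elements, 1 on {a, b, c}, and 0 elsewhere. Hence the pairs with d and one triple weight
  are all that enters.\<close>

lemma ev_double2: "ev {a, b, c, d} p (cap 2 ((\<lambda>_. 1)(d := 2))) =
    (x a + x b + x c + 2 * x d) - (x d * (x a + x b + x c) + p {a, b, c})"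
  unfolding distrib_left mult.commute[of "x d"]
  by (simp add: neq ev4[OF D] cap_def) (unfold p_pair, unfold p_single, simp add: algebra_simps)

text \<open>The excess of |S| over the rank is 1 if S contains both a and b, plus 1 if S contains c
  and d and meets {a, b}.\<close>

lemma ev_parallel: "ev {a, b, c, d} p (parallel a b) =
    (x a + x b + x c + x d) - (x a * x b + (p {a, c, d} + p {b, c, d} + p {a, b, c, d}))"
  by (simp add: neq ev4[OF D] parallel_def hit_def) (unfold p_pair, unfold p_single, simp add: algebra_simps)

lemma hit_le: "ev {a, b, c, d} u (hit {a, b, c}) \<le> x a + x b + x c"
  "ev {a, b, c, d} u (hit {a, b, c, d}) \<le> x a + x b + x c + x d"
  by (simp_all add: neq ev4[OF D] hit_def) (use uf in linarith)+

lemma double2_le: "ev {a, b, c, d} u (cap 2 ((\<lambda>_. 1)(d := 2))) \<le> x a + x b + x c + 2 * x d"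
  "ev {a, b, c, d} u (cap 2 ((\<lambda>_. 1)(d := 2))) \<le> 2"
  by (simp_all add: neq ev4[OF D] cap_def) (use uf in linarith)+

lemma parallel_le: "ev {a, b, c, d} u (parallel a b) \<le> x a + x b + x c + x d"
  "ev {a, b, c, d} u (parallel a b) \<le> 1 + x c + x d"
  "ev {a, b, c, d} u (parallel a b) \<le> 2"
  by (simp_all add: neq ev4[OF D] parallel_def hit_def) (use uf in linarith)+

lemma ev_hit_le_1: "ev {a, b, c, d} u (hit A) \<le> 1"
proof -
  have "ev {a, b, c, d} u (hit A) \<le> (\<Sum>S\<in>Pow {a, b, c, d}. u S)"
    unfolding ev_def using u
    by (intro sum_mono mult_left_le) (auto simp: hit_def feasible_weights_def)
  then show ?thesis using u by (simp add: feasible_weights_def)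
qed

end

section \<open>Weights dominating the extreme polymatroids\<close>

definition dominates :: "nat set \<Rightarrow> (nat \<Rightarrow> real) \<Rightarrow> (nat set \<Rightarrow> real) \<Rightarrow> (nat set \<Rightarrow> real) \<Rightarrow> bool" where
  "dominates N x p f \<longleftrightarrow> (\<forall>u\<in>feasible_weights N x. 3 / 4 * ev N u f \<le> ev N p f)"

text \<open>
  Sufficient conditions for an extreme polymatroid to be dominated: either the premise of
  \<open>truncation_bound\<close>, or a direct comparison with one of the linear upper bounds.
\<close>

definition hit_ok :: "real \<Rightarrow> real \<Rightarrow> bool" where
  "hit_ok s Q \<longleftrightarrow> s \<le> 3 \<and> 4 * Q \<le> s\<^sup>2 \<or> 3 / 4 \<le> s - Q"

text \<open>i, j are the marginals of the parallel elements, k, l those of the other two, and P is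
  the probability that both of the latter occur together with at least one of the former. The second
  disjunct bounds P by its value under product weights.\<close>

definition parallel_ok :: "real \<Rightarrow> real \<Rightarrow> real \<Rightarrow> real \<Rightarrow> real \<Rightarrow> bool" where
  "parallel_ok i j k l P \<longleftrightarrow> 8 * (i * j + P) \<le> (i + j + k + l)\<^sup>2 \<or>
    P \<le> (i + j - i * j) * (k * l) \<or> P \<le> k * l \<and> k + l \<le> 1"

text \<open>z is the marginal of the doubled element, s the sum of the other marginals, and r the
  weight of the triple without the doubled element. The disjuncts compare with W^2 / 8, with 3/4 of
  the modular bound and with 3/4 of the rank 2.\<close>

definition double_ok :: "real \<Rightarrow> real \<Rightarrow> real \<Rightarrow> bool" where
  "double_ok z s r \<longleftrightarrow> 8 * (z * s + r) \<le> (s + 2 * z)\<^sup>2 \<or> 4 * (z * s + r) \<le> s + 2 * z \<or>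
    3 / 2 \<le> s + 2 * z - (z * s + r)"

text \<open>This is the parallel ray under product weights. With y the probability of meeting the
  parallel pair, the expectation is y * (1 - k * l) + k + l, which increases with y and decreases
  with k * l; so y may be replaced by a smaller m and k * l by t^2 / 4.\<close>

lemma independent_parallel_bound:
  fixes i j k l v e :: real
  assumes i: "0 \<le> i" "i \<le> 1" "0 \<le> j" "j \<le> 1" and k: "0 \<le> k" "k \<le> 1" "0 \<le> l" "l \<le> 1"
    and v: "v \<le> i + j + k + l" "v \<le> 1 + k + l" "v \<le> 2"
    and e: "(i + j - i * j) + (k + l) - (i + j - i * j) * (k * l) \<le> e"
  shows "3 / 4 * v \<le> e"
proof -
  define s t y where "s = i + j" and "t = k + l" and "y = i + j - i * j"
  have st: "0 \<le> s" "s \<le> 2" "0 \<le> t" "t \<le> 2" using i k by (auto simp: s_def t_def)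
  have vt: "v \<le> s + t" "v \<le> 1 + t" using v by (simp_all add: s_def t_def)
  have t2: "t\<^sup>2 \<le> 2 * t" using st by (simp add: power2_eq_square mult_right_mono)
  have kl: "4 * (k * l) \<le> t\<^sup>2" using zero_le_power2[of "k - l"] by (simp add: t_def power2_eq_square algebra_simps)
  have kl1: "0 \<le> 1 - k * l" using mult_le_one[of k l] k by simp
  \<comment> \<open>Used with m = 3/4 when s >= 1 and with m = 3/4 * s otherwise; both are lower
    bounds of y because y >= s - s^2 / 4.\<close>
  have key: "m + t - m * (t\<^sup>2 / 4) \<le> e" if "0 \<le> m" "m \<le> y" for m
  proof -
    have "m * (1 - k * l) \<le> y * (1 - k * l)" using that kl1 by (intro mult_right_mono)
    moreover have "m * (k * l) \<le> m * (t\<^sup>2 / 4)" using that kl by (intro mult_left_mono) auto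
    ultimately show ?thesis using e by (simp add: y_def t_def algebra_simps)
  qed
  have ij: "4 * (i * j) \<le> s\<^sup>2" using zero_le_power2[of "i - j"] by (simp add: s_def power2_eq_square algebra_simps)
  show ?thesis
  proof (cases "1 \<le> s")
    case True
    have "0 \<le> (s - 1) * (3 - s)" using True st by (intro mult_nonneg_nonneg) auto
    then have "3 / 4 \<le> y" using ij by (simp add: y_def s_def power2_eq_square algebra_simps)
    from key[OF _ this] have E: "3 / 4 + t - 3 / 16 * t\<^sup>2 \<le> e" by simp
    show ?thesis
    proof (cases "t \<le> 1")
      case True
      then have "t\<^sup>2 \<le> 1 * t" unfolding power2_eq_square using st by (intro mult_right_mono)
      then show ?thesis using E vt st by linarith
    next
      case False
      have "0 \<le> (t - 1) * (2 - t)" using False st by (intro mult_nonneg_nonneg) auto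
      then have "t\<^sup>2 \<le> 3 * t - 2" by (simp add: power2_eq_square algebra_simps)
      then show ?thesis using E v False by linarith
    qed
  next
    case False
    then have "s\<^sup>2 \<le> 1 * s" unfolding power2_eq_square using st by (intro mult_right_mono) auto
    then have "3 / 4 * s \<le> y" using ij by (simp add: y_def flip: s_def)
    with key[of "3 / 4 * s"] st have E: "3 / 4 * s + t - 3 / 16 * (s * t\<^sup>2) \<le> e" by (simp add: algebra_simps)
    \<comment> \<open>At s * t = 4/3 the correction 3/16 * s * t^2 is exactly t / 4, which leaves
      3/4 * (s + t). In the last case s and t are so close to 1 and 3/2 that the bound 3/2 can be
      reached directly.\<close>
    consider "s * t \<le> 4 / 3" | "3 / 2 \<le> t" | "4 / 3 < s * t" "t < 3 / 2" by linarith
    then show ?thesis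
    proof cases
      case 1
      then have "(s * t) * t \<le> 4 / 3 * t" using st by (intro mult_right_mono)
      then have "s * t\<^sup>2 \<le> 4 / 3 * t" by (simp add: power2_eq_square algebra_simps)
      then show ?thesis using E vt st by linarith
    next
      case 2
      have "s * t\<^sup>2 \<le> s * 4" using st t2 by (intro mult_left_mono) auto
      then show ?thesis using E v(3) 2 by linarith
    next
      case 3
      have "s * t \<le> s * (3 / 2)" using 3 st by (intro mult_left_mono) auto
      then have s: "8 / 9 \<le> s" using 3 by linarith
      have "s * t \<le> 1 * t" using False st by (intro mult_right_mono) auto
      then have t: "4 / 3 \<le> t" using 3 by linarith
      have "(s - 8 / 9) * t\<^sup>2 \<le> (s - 8 / 9) * 4" using s st t2 by (intro mult_left_mono) auto
      then have "s * t\<^sup>2 \<le> 8 / 9 * t\<^sup>2 + 4 * s - 32 / 9" by (simp add: algebra_simps)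
      then show ?thesis using E v(3) t2 t by linarith
    qed
  qed
qed

section \<open>Pairwise independent weights from five parameters, and transfer to the rays\<close>

lemma pairwise_weights_exist:
  fixes x :: "nat \<Rightarrow> real" and ra rb rc rd q :: real
  assumes D: "distinct [a, b, c, d]"
    and nn: "0 \<le> ra" "0 \<le> rb" "0 \<le> rc" "0 \<le> rd" "0 \<le> q"
      "rc + rd + q \<le> x a * x b" "rb + rd + q \<le> x a * x c" "rb + rc + q \<le> x a * x d"
      "ra + rd + q \<le> x b * x c" "ra + rc + q \<le> x b * x d" "ra + rb + q \<le> x c * x d"
      "x a * (x b + x c + x d) \<le> x a + (rb + rc + rd + 2 * q)"
      "x b * (x a + x c + x d) \<le> x b + (ra + rc + rd + 2 * q)"
      "x c * (x a + x b + x d) \<le> x c + (ra + rb + rd + 2 * q)"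
      "x d * (x a + x b + x c) \<le> x d + (ra + rb + rc + 2 * q)"
      "x a + x b + x c + x d + (ra + rb + rc + rd + 3 * q)
        \<le> 1 + (x a * x b + x a * x c + x a * x d + x b * x c + x b * x d + x c * x d)"
  shows "\<exists>p\<in>pairwise_feasible_weights {a, b, c, d} x.
    p {b, c, d} = ra \<and> p {a, c, d} = rb \<and> p {a, b, d} = rc \<and> p {a, b, c} = rd \<and> p {a, b, c, d} = q"
proof -
  let ?N = "{a, b, c, d}"
  \<comment> \<open>The remaining eleven weights come from Moebius inversion: pairs from the second
    moments, singletons from the marginals, the empty set from total mass 1. The hypotheses
    \<open>nn\<close> are precisely the nonnegativity of all sixteen entries.\<close>
  define w where "w = (\<lambda>i j k l. if i then if j then if k then if l then q else rd
          else if l then rc else x a * x b - (rc + rd + q)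
        else if k then if l then rb else x a * x c - (rb + rd + q)
          else if l then x a * x d - (rb + rc + q) else x a + (rb + rc + rd + 2 * q) - x a * (x b + x c + x d)
      else if j then if k then if l then ra else x b * x c - (ra + rd + q)
          else if l then x b * x d - (ra + rc + q) else x b + (ra + rc + rd + 2 * q) - x b * (x a + x c + x d)
        else if k then if l then x c * x d - (ra + rb + q) else x c + (ra + rb + rd + 2 * q) - x c * (x a + x b + x d)
          else if l then x d + (ra + rb + rc + 2 * q) - x d * (x a + x b + x c)
            else 1 + (x a * x b + x a * x c + x a * x d + x b * x c + x b * x d + x c * x d)
              - (x a + x b + x c + x d + (ra + rb + rc + rd + 3 * q)))"
  define p where "p S = w (a \<in> S) (b \<in> S) (c \<in> S) (d \<in> S)" for S
  note neq = distinct4_neq[OF D]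
  have "0 \<le> w i j k l" for i j k l
    by (cases i; cases j; cases k; cases l; simp only: w_def if_True if_False diff_ge_0_iff_ge nn)
  then have nonneg: "\<forall>S\<in>Pow ?N. 0 \<le> p S" unfolding p_def by blast
  have total: "(\<Sum>S\<in>Pow ?N. p S) = 1"
    by (simp add: sum_Pow4[OF D] p_def neq, simp add: w_def algebra_simps)
  have single: "(\<Sum>S | S \<subseteq> ?N \<and> i \<in> S. p S) = x i" if "i \<in> ?N" for i
  proof -
    have "i = a \<or> i = b \<or> i = c \<or> i = d" using that by simp
    then show ?thesis
      by (elim disjE; simp add: sum_superset sum_Pow4[OF D] p_def neq; simp add: w_def algebra_simps)
  qed
  have pair: "(\<Sum>S | S \<subseteq> ?N \<and> {i, j} \<subseteq> S. p S) = x i * x j" if "i \<in> ?N" "j \<in> ?N" "i \<noteq> j" for i j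
  proof -
    have ordered: "(\<Sum>S | S \<subseteq> ?N \<and> {i, j} \<subseteq> S. p S) = x i * x j"
      if "i = a \<and> (j = b \<or> j = c \<or> j = d) \<or> i = b \<and> (j = c \<or> j = d) \<or> i = c \<and> j = d" for i j
      using that
      by (elim disjE conjE; simp add: sum_superset sum_Pow4[OF D] p_def neq; simp add: w_def algebra_simps)
    have "(i = a \<and> (j = b \<or> j = c \<or> j = d) \<or> i = b \<and> (j = c \<or> j = d) \<or> i = c \<and> j = d) \<or>
      (j = a \<and> (i = b \<or> i = c \<or> i = d) \<or> j = b \<and> (i = c \<or> i = d) \<or> j = c \<and> i = d)"
      using that by blast
    then show ?thesis
      using ordered[of i j] ordered[of j i] by (auto simp only: mult.commute insert_commute)
  qed
  have "p \<in> pairwise_feasible_weights ?N x"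
    unfolding pairwise_feasible_weights_def using nonneg total single pair by auto
  moreover have "p {b, c, d} = ra \<and> p {a, c, d} = rb \<and> p {a, b, d} = rc \<and> p {a, b, c} = rd \<and> p ?N = q"
    by (simp add: p_def neq w_def)
  ultimately show ?thesis by blast
qed

context
  fixes a b c d :: nat and x :: "nat \<Rightarrow> real" and p :: "nat set \<Rightarrow> real" and N :: "nat set"
  assumes D: "distinct [a, b, c, d]" and N: "N = {a, b, c, d}" and x: "\<forall>i\<in>N. x i \<in> {0..1}"
    and p: "p \<in> pairwise_feasible_weights N x"
begin

private lemmas x' = x[unfolded N]
private lemmas p' = p[unfolded N]

lemma dominates_hit3:
  assumes "hit_ok (x a + x b + x c) (x a * x b + x a * x c + x b * x c - (p {a, b, c} + p N))"
  shows "dominates N x p (hit {a, b, c})"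
  unfolding dominates_def
proof
  fix u assume "u \<in> feasible_weights N x"
  then have u: "u \<in> feasible_weights {a, b, c, d} x" by (simp add: N)
  note E = ev_hit3[OF D x' p' u]
  show "3 / 4 * ev N u (hit {a, b, c}) \<le> ev N p (hit {a, b, c})"
    using assms unfolding hit_ok_def
  proof (elim disjE conjE)
    assume "x a + x b + x c \<le> 3"
      "4 * (x a * x b + x a * x c + x b * x c - (p {a, b, c} + p N)) \<le> (x a + x b + x c)\<^sup>2"
    then show ?thesis
      using truncation_bound[OF hit_le(1)[OF D x' p' u] ev_hit_le_1[OF D x' p' u],
          of "x a * x b + x a * x c + x b * x c - (p {a, b, c} + p N)" "ev N p (hit {a, b, c})"] E x' by (simp add: N)
  next
    assume "3 / 4 \<le> x a + x b + x c - (x a * x b + x a * x c + x b * x c - (p {a, b, c} + p N))"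
    then show ?thesis using E ev_hit_le_1[OF D x' p' u, of "{a, b, c}"] by (simp add: N)
  qed
qed

lemma dominates_hit4:
  assumes "hit_ok (x a + x b + x c + x d) (x a * x b + x a * x c + x a * x d + x b * x c + x b * x d + x c * x d
    - (p {a, b, c} + p {a, b, d} + p {a, c, d} + p {b, c, d} + 3 * p N))"
  shows "dominates N x p (hit N)"
  unfolding dominates_def
proof
  fix u assume "u \<in> feasible_weights N x"
  then have u: "u \<in> feasible_weights {a, b, c, d} x" by (simp add: N)
  note E = ev_hit4[OF D x' p' u]
  show "3 / 4 * ev N u (hit N) \<le> ev N p (hit N)"
    using assms unfolding hit_ok_def
  proof (elim disjE conjE)
    assume "x a + x b + x c + x d \<le> 3"
      "4 * (x a * x b + x a * x c + x a * x d + x b * x c + x b * x d + x c * x d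
    - (p {a, b, c} + p {a, b, d} + p {a, c, d} + p {b, c, d} + 3 * p N)) \<le> (x a + x b + x c + x d)\<^sup>2"
    then show ?thesis
      using truncation_bound[OF hit_le(2)[OF D x' p' u] ev_hit_le_1[OF D x' p' u],
          of "x a * x b + x a * x c + x a * x d + x b * x c + x b * x d + x c * x d
    - (p {a, b, c} + p {a, b, d} + p {a, c, d} + p {b, c, d} + 3 * p N)" "ev N p (hit N)"] E x' by (simp add: N)
  next
    assume "3 / 4 \<le> x a + x b + x c + x d - (x a * x b + x a * x c + x a * x d + x b * x c + x b * x d + x c * x d
    - (p {a, b, c} + p {a, b, d} + p {a, c, d} + p {b, c, d} + 3 * p N))"
    then show ?thesis using E ev_hit_le_1[OF D x' p' u, of N] by (simp add: N)
  qed
qed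

lemma dominates_double2:
  assumes "double_ok (x d) (x a + x b + x c) (p {a, b, c})"
  shows "dominates N x p (cap 2 ((\<lambda>_. 1)(d := 2)))"
  unfolding dominates_def
proof
  fix u assume "u \<in> feasible_weights N x"
  then have u: "u \<in> feasible_weights {a, b, c, d} x" by (simp add: N)
  let ?f = "cap 2 ((\<lambda>_. 1)(d := 2))"
  note E = ev_double2[OF D x' p' u] and U = double2_le[OF D x' p' u]
  show "3 / 4 * ev N u ?f \<le> ev N p ?f"
    using assms unfolding double_ok_def
  proof (elim disjE)
    assume "8 * (x d * (x a + x b + x c) + p {a, b, c}) \<le> (x a + x b + x c + 2 * x d)\<^sup>2"
    then show ?thesis
      using truncation_bound[OF U, of "x d * (x a + x b + x c) + p {a, b, c}" "ev N p ?f"] E x' by (simp add: N)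
  next
    assume "4 * (x d * (x a + x b + x c) + p {a, b, c}) \<le> x a + x b + x c + 2 * x d"
    then show ?thesis using E U(1) by (simp add: N)
  next
    assume "3 / 2 \<le> x a + x b + x c + 2 * x d - (x d * (x a + x b + x c) + p {a, b, c})"
    then show ?thesis using E U(2) by (simp add: N)
  qed
qed

lemma dominates_parallel:
  assumes "parallel_ok (x a) (x b) (x c) (x d) (p {a, c, d} + p {b, c, d} + p N)"
  shows "dominates N x p (parallel a b)"
  unfolding dominates_def
proof
  fix u assume "u \<in> feasible_weights N x"
  then have u: "u \<in> feasible_weights {a, b, c, d} x" by (simp add: N)
  let ?P = "p {a, c, d} + p {b, c, d} + p N"
  have E: "ev N p (parallel a b) = (x a + x b + x c + x d) - (x a * x b + ?P)"
    using ev_parallel[OF D x' p' u] by (simp add: N)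
  have U: "ev N u (parallel a b) \<le> x a + x b + x c + x d" "ev N u (parallel a b) \<le> 1 + x c + x d"
    "ev N u (parallel a b) \<le> 2"
    using parallel_le[OF D x' p' u] by (simp_all add: N)
  have x01: "0 \<le> x a" "x a \<le> 1" "0 \<le> x b" "x b \<le> 1" "0 \<le> x c" "x c \<le> 1" "0 \<le> x d" "x d \<le> 1"
    using x' by auto
  show "3 / 4 * ev N u (parallel a b) \<le> ev N p (parallel a b)"
    using assms unfolding parallel_ok_def
  proof (elim disjE conjE)
    assume "8 * (x a * x b + ?P) \<le> (x a + x b + x c + x d)\<^sup>2"
    then show ?thesis
      using truncation_bound[OF U(1,3), of "x a * x b + ?P" "ev N p (parallel a b)"] E x01 by simp
  next
    assume "?P \<le> (x a + x b - x a * x b) * (x c * x d)"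
    then show ?thesis
      by (intro independent_parallel_bound[OF x01 U]) (simp add: E)
  next
    \<comment> \<open>Both P and the product of the last two marginals are at most their sum divided
      by 4 here. The other product is bounded according to whether the parallel marginals add up to
      at most 1, which decides between the majorants \<open>U(1)\<close> and
      \<open>U(2)\<close>.\<close>
    assume P: "?P \<le> x c * x d" and "x c + x d \<le> 1"
    then have "(x c + x d) * (x c + x d) \<le> 1 * (x c + x d)" using x01 by (intro mult_right_mono) auto
    then have cd: "4 * (x c * x d) \<le> x c + x d"
      using zero_le_power2[of "x c - x d"] by (simp add: power2_eq_square algebra_simps)
    show ?thesis
    proof (cases "x a + x b \<le> 1")
      case True
      then have "(x a + x b) * (x a + x b) \<le> 1 * (x a + x b)" using x01 by (intro mult_right_mono) auto
      then have "4 * (x a * x b) \<le> x a + x b"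
        using zero_le_power2[of "x a - x b"] by (simp add: power2_eq_square algebra_simps)
      then show ?thesis using E P cd U by linarith
    next
      case False
      then have "0 \<le> (x a + x b - 1) * (3 - x a - x b)" using x01 by (intro mult_nonneg_nonneg) auto
      then have "4 * (x a * x b) \<le> 4 * (x a + x b) - 3"
        using zero_le_power2[of "x a - x b"] by (simp add: power2_eq_square algebra_simps)
      then have "3 / 4 * (1 + x c + x d) \<le> ev N p (parallel a b)" unfolding E using P cd by (simp add: field_simps)
      then show ?thesis by (rule scaled_bound[OF U(2) order_refl])
    qed
  qed
qed

end

text \<open>
  The marginals are \<open>x1 \<le> x2 \<le> x3 \<le> x4\<close>; \<open>ra\<close>, \<open>rb\<close>, \<open>rc\<close>, \<open>rd\<close> are the weights of the triples that omit the
  first, second, third and fourth element, and \<open>q\<close> is the weight of the whole set. They determine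
  pairwise independent weights, which must be nonnegative.
\<close>

definition admissible :: "real \<Rightarrow> real \<Rightarrow> real \<Rightarrow> real \<Rightarrow> real \<Rightarrow> real \<Rightarrow> real \<Rightarrow> real \<Rightarrow> real \<Rightarrow> bool" where
  "admissible x1 x2 x3 x4 ra rb rc rd q \<longleftrightarrow>
    0 \<le> ra \<and> 0 \<le> rb \<and> 0 \<le> rc \<and> 0 \<le> rd \<and> 0 \<le> q \<and>
    rc + rd + q \<le> x1 * x2 \<and> rb + rd + q \<le> x1 * x3 \<and> rb + rc + q \<le> x1 * x4 \<and>
    ra + rd + q \<le> x2 * x3 \<and> ra + rc + q \<le> x2 * x4 \<and> ra + rb + q \<le> x3 * x4 \<and>
    x1 * (x2 + x3 + x4) \<le> x1 + (rb + rc + rd + 2 * q) \<and>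
    x2 * (x1 + x3 + x4) \<le> x2 + (ra + rc + rd + 2 * q) \<and>
    x3 * (x1 + x2 + x4) \<le> x3 + (ra + rb + rd + 2 * q) \<and>
    x4 * (x1 + x2 + x3) \<le> x4 + (ra + rb + rc + 2 * q) \<and>
    x1 + x2 + x3 + x4 + (ra + rb + rc + rd + 3 * q)
      \<le> 1 + (x1 * x2 + x1 * x3 + x1 * x4 + x2 * x3 + x2 * x4 + x3 * x4) \<and>
    hit_ok (x1 + x2 + x3) (x1 * x2 + x1 * x3 + x2 * x3 - (rd + q)) \<and>
    hit_ok (x1 + x2 + x4) (x1 * x2 + x1 * x4 + x2 * x4 - (rc + q)) \<and>
    hit_ok (x1 + x3 + x4) (x1 * x3 + x1 * x4 + x3 * x4 - (rb + q)) \<and>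
    hit_ok (x2 + x3 + x4) (x2 * x3 + x2 * x4 + x3 * x4 - (ra + q)) \<and>
    hit_ok (x1 + x2 + x3 + x4) (x1 * x2 + x1 * x3 + x1 * x4 + x2 * x3 + x2 * x4 + x3 * x4
      - (rd + rc + rb + ra + 3 * q)) \<and>
    parallel_ok x1 x2 x3 x4 (rb + ra + q) \<and> parallel_ok x1 x3 x2 x4 (rc + ra + q) \<and>
    parallel_ok x1 x4 x2 x3 (rd + ra + q) \<and> parallel_ok x2 x3 x1 x4 (rc + rb + q) \<and>
    parallel_ok x2 x4 x1 x3 (rd + rb + q) \<and> parallel_ok x3 x4 x1 x2 (rd + rc + q) \<and>
    double_ok x4 (x1 + x2 + x3) rd \<and> double_ok x3 (x1 + x2 + x4) rc \<and>
    double_ok x2 (x1 + x3 + x4) rb \<and> double_ok x1 (x2 + x3 + x4) ra"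

text \<open>
  For \<open>i < j < 4\<close>, \<open>eij\<close> is the weight of \<open>{i, j}\<close>, which vanishes in the unperturbed star.
\<close>

lemma star_admissible:
  fixes x1 x2 x3 x4 e12 e13 e23 :: real
  assumes ord: "0 \<le> x1" "x1 \<le> x2" "x2 \<le> x3" "x3 \<le> x4" "x4 \<le> 1"
    and e: "0 \<le> e12" "e12 \<le> e13" "e12 \<le> e23" "e12 \<le> x1 * x2"
    and r: "e13 - e12 \<le> x1 * (x3 - x2)" "e23 - e12 \<le> x2 * (x3 - x1)"
    and single: "e12 + e13 \<le> (1 - x4) * x1" "e12 + e23 \<le> (1 - x4) * x2" "e13 + e23 \<le> (1 - x4) * x3"
      "e13 + e23 \<le> x4 * (1 - x1 - x2 - x3) + x3 * (x1 + x2)"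
    and le1: "x1 + x2 \<le> 1"
    and alt: "x1 + x2 + x3 \<le> 1 \<and> e12 = 0 \<and> e13 = 0 \<and> e23 = 0 \<or>
      e12 + e13 + e23 = (1 - x4) * (x1 + x2 + x3 - 1) \<and> (1 - x3) * (1 - x1 - x2) + e12 \<le> 1 / 4"
  shows "admissible x1 x2 x3 x4 (x2 * (x3 - x1) - (e23 - e12)) (x1 * (x3 - x2) - (e13 - e12)) 0 0 (x1 * x2 - e12)"
proof -
  have pos: "0 \<le> x2" "0 \<le> x3" "0 \<le> x4" using ord by auto
  have m: "x1 * x3 \<le> x1 * x4" "x2 * x3 \<le> x2 * x4" "x3 * x3 \<le> x3 * x4"
    using ord pos by (auto intro: mult_left_mono)
  have f: "0 \<le> (x3 - x1) * (x3 - x2)" "0 \<le> (x4 - x3) * (x2 - x1)" "0 \<le> x1 * (x4 - x3)" "0 \<le> x2 * (x4 - x3)"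
    "0 \<le> (x2 - x1) * (x3 - x2)"
    using ord pos by (auto intro!: mult_nonneg_nonneg)
  \<comment> \<open>This is the weight of the empty set. The second alternative distributes over the
    pairs exactly the mass that makes it 0.\<close>
  have empty: "0 \<le> (1 - x4) * (1 - x1 - x2 - x3) + (e12 + e13 + e23)"
    using alt
  proof
    assume "x1 + x2 + x3 \<le> 1 \<and> e12 = 0 \<and> e13 = 0 \<and> e23 = 0"
    then show ?thesis using ord by simp
  next
    assume "e12 + e13 + e23 = (1 - x4) * (x1 + x2 + x3 - 1) \<and> (1 - x3) * (1 - x1 - x2) + e12 \<le> 1 / 4"
    then show ?thesis by (simp add: algebra_simps)
  qed
  have q4: "(1 - x4) * x4 \<le> 1 / 4" using zero_le_power2[of "x4 - 1 / 2"] by (simp add: power2_eq_square algebra_simps)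
  have k4: "(1 - x4) * x1 \<le> (1 - x4) * x4" "(1 - x4) * x2 \<le> (1 - x4) * x4"
     using ord by (auto intro: mult_left_mono)
  have k3: "(1 - x4) * (1 - x1 - x2) \<le> (1 - x3) * (1 - x1 - x2)" using ord le1 by (intro mult_right_mono) auto
  \<comment> \<open>For x1 + x2 + x3 <= 1 the corrections are x3 * (x1 + x2), x4 * (x1 + x2), x4 *
    (x1 + x3), x4 * (x2 + x3) and x4 * (x1 + x2 + x3), each of the form v * w with v + w the full
    sum. In the other alternative the probabilities of missing a set are bounded by 1/4: for {1, 2,
    3} it is (1 - x3) * (1 - x1 - x2) + e12; for {1, 3, 4} and {2, 3, 4} it is the weight of {2} or
    {1}, at most (1 - x4) * x4, because the empty set has weight 0.\<close>
  have hits: "hit_ok (x1 + x2 + x3) (x1 * x2 + x1 * x3 + x2 * x3 - (0 + (x1 * x2 - e12))) \<and>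
    hit_ok (x1 + x2 + x4) (x1 * x2 + x1 * x4 + x2 * x4 - (0 + (x1 * x2 - e12))) \<and>
    hit_ok (x1 + x3 + x4) (x1 * x3 + x1 * x4 + x3 * x4 - (x1 * (x3 - x2) - (e13 - e12) + (x1 * x2 - e12))) \<and>
    hit_ok (x2 + x3 + x4) (x2 * x3 + x2 * x4 + x3 * x4 - (x2 * (x3 - x1) - (e23 - e12) + (x1 * x2 - e12))) \<and>
    hit_ok (x1 + x2 + x3 + x4) (x1 * x2 + x1 * x3 + x1 * x4 + x2 * x3 + x2 * x4 + x3 * x4
      - (0 + 0 + (x1 * (x3 - x2) - (e13 - e12)) + (x2 * (x3 - x1) - (e23 - e12)) + 3 * (x1 * x2 - e12)))" (is ?H)
    using alt
  proof (elim disjE conjE)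
    assume A: "x1 + x2 + x3 \<le> 1" "e12 = 0" "e13 = 0" "e23 = 0"
    have sq: "4 * (v * w) \<le> (v + w)\<^sup>2" for v w :: real
      using zero_le_power2[of "v - w"] by (simp add: power2_eq_square algebra_simps)
    show ?H
      unfolding hit_ok_def
      using A ord sq[of "x1 + x2" x3] sq[of "x1 + x2" x4] sq[of "x1 + x3" x4] sq[of "x2 + x3" x4] sq[of "x1 + x2 + x3" x4]
      by (intro conjI disjI1) (simp_all add: algebra_simps)
  next
    assume B: "e12 + e13 + e23 = (1 - x4) * (x1 + x2 + x3 - 1)" "(1 - x3) * (1 - x1 - x2) + e12 \<le> 1 / 4"
    show ?H
      unfolding hit_ok_def
      using B e q4 k4 k3 by (intro conjI disjI2) (simp_all add: algebra_simps)
  qed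
  have sq: "8 * (v * w) \<le> (v + 2 * w)\<^sup>2" for v w :: real
    using zero_le_power2[of "v - 2 * w"] by (simp add: power2_eq_square algebra_simps)
  have total: "(x1 + x2 + 2 * x3)\<^sup>2 \<le> (x1 + x2 + x3 + x4)\<^sup>2" using ord pos by (intro power_mono) auto
  \<comment> \<open>Without perturbation the five parallel corrections settled by the first disjunct
    are x3 * (x1 + x2), three times, and x1 * x4 + x2 * x3 <= x2 * x4 + x1 * x3, by rearrangement.
    Perturbing only lowers them.\<close>
  have "(x1 + x2 + x3 + x4)\<^sup>2 - 8 * (x2 * x4 + x1 * x3) = (x4 + x1 + x3 - 3 * x2)\<^sup>2 + 8 * ((x2 - x1) * (x3 - x2))"
    by (simp add: power2_eq_square algebra_simps)
  then have cross: "8 * (x2 * x4 + x1 * x3) \<le> (x1 + x2 + x3 + x4)\<^sup>2"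
    using f(5) zero_le_power2[of "x4 + x1 + x3 - 3 * x2"] by linarith
  have "(x1 + x3 + x4 + 2 * x2)\<^sup>2 - 8 * (x2 * (x1 + x3 + x4) + x1 * (x3 - x2)) = (2 * x2 + x1 - x3 - x4)\<^sup>2 + 4 * (x1 * (x4 - x3))"
    by (simp add: power2_eq_square algebra_simps)
  then have d2: "8 * (x2 * (x1 + x3 + x4) + x1 * (x3 - x2)) \<le> (x1 + x3 + x4 + 2 * x2)\<^sup>2"
    using f(3) zero_le_power2[of "2 * x2 + x1 - x3 - x4"] by linarith
  have "(x2 + x3 + x4 + 2 * x1)\<^sup>2 - 8 * (x1 * (x2 + x3 + x4) + x2 * (x3 - x1)) = (2 * x1 + x2 - x3 - x4)\<^sup>2 + 4 * (x2 * (x4 - x3))"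
    by (simp add: power2_eq_square algebra_simps)
  then have d1: "8 * (x1 * (x2 + x3 + x4) + x2 * (x3 - x1)) \<le> (x2 + x3 + x4 + 2 * x1)\<^sup>2"
    using f(4) zero_le_power2[of "2 * x1 + x2 - x3 - x4"] by linarith
  have pars: "parallel_ok x1 x2 x3 x4 (x1 * (x3 - x2) - (e13 - e12) + (x2 * (x3 - x1) - (e23 - e12)) + (x1 * x2 - e12))"
    "parallel_ok x1 x3 x2 x4 (0 + (x2 * (x3 - x1) - (e23 - e12)) + (x1 * x2 - e12))"
    "parallel_ok x1 x4 x2 x3 (0 + (x2 * (x3 - x1) - (e23 - e12)) + (x1 * x2 - e12))"
    "parallel_ok x2 x3 x1 x4 (0 + (x1 * (x3 - x2) - (e13 - e12)) + (x1 * x2 - e12))"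
    "parallel_ok x2 x4 x1 x3 (0 + (x1 * (x3 - x2) - (e13 - e12)) + (x1 * x2 - e12))"
    unfolding parallel_ok_def
    by (intro disjI1, use sq[of "x1 + x2" x3] total cross f(2) e in \<open>simp add: algebra_simps\<close>)+
  have par34: "parallel_ok x3 x4 x1 x2 (0 + 0 + (x1 * x2 - e12))"
    unfolding parallel_ok_def using e le1 by simp
  have doubles: "double_ok x4 (x1 + x2 + x3) 0" "double_ok x3 (x1 + x2 + x4) 0"
    "double_ok x2 (x1 + x3 + x4) (x1 * (x3 - x2) - (e13 - e12))"
    "double_ok x1 (x2 + x3 + x4) (x2 * (x3 - x1) - (e23 - e12))"
    unfolding double_ok_def
    by (intro disjI1, use sq[of "x1 + x2 + x3" x4] sq[of "x1 + x2 + x4" x3] d1 d2 e in \<open>simp add: algebra_simps\<close>)+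
  show ?thesis
    unfolding admissible_def
    by (intro conjI pars par34 doubles; ((insert hits, elim conjE, assumption) | use e r single m f empty in \<open>simp add: algebra_simps\<close>))
qed

text \<open>
  Product weights, with \<open>e\<close> moved from the sets of odd to those of even size; this keeps all pair moments.
\<close>

lemma perturbed_independent_admissible:
  fixes x1 x2 x3 x4 e :: real
  assumes ord: "0 \<le> x1" "x1 \<le> x2" "x2 \<le> x3" "x3 \<le> x4" "x4 \<le> 1"
    and e: "0 \<le> e" "e \<le> x1 * x2 * x3 * (1 - x4)" "e \<le> x1 * (1 - x2) * (1 - x3) * (1 - x4)"
    and miss: "(1 - x1) * (1 - x2) * (1 - x3) \<le> 1 / 4"
    and d4: "double_ok x4 (x1 + x2 + x3) (x1 * x2 * x3 * (1 - x4) - e)"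
    and d3: "double_ok x3 (x1 + x2 + x4) (x1 * x2 * x4 * (1 - x3) - e)"
    and d2: "double_ok x2 (x1 + x3 + x4) (x1 * x3 * x4 * (1 - x2) - e)"
    and d1: "double_ok x1 (x2 + x3 + x4) (x2 * x3 * x4 * (1 - x1) - e)"
  shows "admissible x1 x2 x3 x4 (x2 * x3 * x4 * (1 - x1) - e) (x1 * x3 * x4 * (1 - x2) - e)
    (x1 * x2 * x4 * (1 - x3) - e) (x1 * x2 * x3 * (1 - x4) - e) (x1 * x2 * x3 * x4 + e)"
proof -
  have pos: "0 \<le> x2" "0 \<le> x3" "0 \<le> x4" "0 \<le> 1 - x1" "0 \<le> 1 - x2" "0 \<le> 1 - x3" "0 \<le> 1 - x4" using ord by auto
  \<comment> \<open>The odds v / (1 - v) increase with v. So among the product weights of the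
    triples {1, 2, 3} has the least, and {1} among those of the singletons; the two hypotheses on e
    therefore control all odd sets.\<close>
  have odds: "v * (1 - w) \<le> w * (1 - v)" if "v \<le> w" for v w :: real
    using that by (simp add: algebra_simps)
  have t3: "x1 * x2 * (x3 * (1 - x4)) \<le> x1 * x2 * (x4 * (1 - x3))"
    using ord pos odds by (intro mult_left_mono mult_nonneg_nonneg)
  have t2: "x1 * x3 * (x2 * (1 - x4)) \<le> x1 * x3 * (x4 * (1 - x2))"
    using ord pos odds by (intro mult_left_mono mult_nonneg_nonneg) auto
  have t1: "x2 * x3 * (x1 * (1 - x4)) \<le> x2 * x3 * (x4 * (1 - x1))"
    using ord pos odds by (intro mult_left_mono mult_nonneg_nonneg) auto
  have triples: "e \<le> x1 * x2 * x4 * (1 - x3)" "e \<le> x1 * x3 * x4 * (1 - x2)" "e \<le> x2 * x3 * x4 * (1 - x1)"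
    using e(2) t1 t2 t3 by (simp_all add: mult_ac)
  have s2: "(1 - x3) * (1 - x4) * (x1 * (1 - x2)) \<le> (1 - x3) * (1 - x4) * (x2 * (1 - x1))"
    using ord pos odds by (intro mult_left_mono mult_nonneg_nonneg)
  have s3: "(1 - x2) * (1 - x4) * (x1 * (1 - x3)) \<le> (1 - x2) * (1 - x4) * (x3 * (1 - x1))"
    using ord pos odds by (intro mult_left_mono mult_nonneg_nonneg) auto
  have s4: "(1 - x2) * (1 - x3) * (x1 * (1 - x4)) \<le> (1 - x2) * (1 - x3) * (x4 * (1 - x1))"
    using ord pos odds by (intro mult_left_mono mult_nonneg_nonneg) auto
  have singles: "e \<le> x2 * (1 - x1) * (1 - x3) * (1 - x4)" "e \<le> x3 * (1 - x1) * (1 - x2) * (1 - x4)"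
    "e \<le> x4 * (1 - x1) * (1 - x2) * (1 - x3)"
    using e(3) s2 s3 s4 by (simp_all add: mult_ac)
  have pairs: "0 \<le> v * w * ((1 - y) * (1 - z))" if "0 \<le> v" "0 \<le> w" "0 \<le> 1 - y" "0 \<le> 1 - z" for v w y z :: real
    using that by (intro mult_nonneg_nonneg)
  have none: "0 \<le> (1 - x1) * (1 - x2) * (1 - x3) * (1 - x4)" using pos ord by (intro mult_nonneg_nonneg)
  have full: "0 \<le> x1 * x2 * x3 * x4" using pos ord by (intro mult_nonneg_nonneg)
  have miss4: "(1 - x1) * (1 - x2) * (1 - x4) \<le> 1 / 4"
  proof -
    have "(1 - x1) * (1 - x2) * (1 - x4) \<le> (1 - x1) * (1 - x2) * (1 - x3)"
      using pos ord by (intro mult_left_mono mult_nonneg_nonneg) auto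
    then show ?thesis using miss by linarith
  qed
  have miss34: "(1 - x1) * (1 - x3) * (1 - x4) \<le> 1 / 4"
  proof -
    have "(1 - x1) * (1 - x3) * (1 - x4) \<le> (1 - x1) * (1 - x2) * (1 - x4)"
      using pos ord by (intro mult_left_mono mult_right_mono mult_nonneg_nonneg) auto
    then show ?thesis using miss4 by linarith
  qed
  have miss234: "(1 - x2) * (1 - x3) * (1 - x4) \<le> 1 / 4"
  proof -
    have "(1 - x2) * (1 - x3) * (1 - x4) \<le> (1 - x1) * (1 - x3) * (1 - x4)"
      using pos ord by (intro mult_left_mono mult_right_mono mult_nonneg_nonneg) auto
    then show ?thesis using miss34 by linarith
  qed
  have "(1 - x1) * (1 - x2) * (1 - x3) * (1 - x4) + e \<le> (1 - x2) * (1 - x3) * (1 - x4)"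
    using e(3) by (simp add: algebra_simps)
  then have miss1234: "(1 - x1) * (1 - x2) * (1 - x3) * (1 - x4) + e \<le> 1 / 4"
    using miss234 by linarith
  \<comment> \<open>In the weight of a triple plus that of the whole set e cancels: any three
    elements stay mutually independent, and q is the product of their marginals.\<close>
  have hit3: "hit_ok (v + w + y) (v * w + v * y + w * y - q)"
    if "(1 - v) * (1 - w) * (1 - y) \<le> 1 / 4" "q = v * w * y" for v w y q :: real
    using that unfolding hit_ok_def by (simp add: algebra_simps)
  \<comment> \<open>The parallel correction is its value under product weights minus e.\<close>
  have par: "parallel_ok i j k l P" if "P \<le> (i + j - i * j) * (k * l)" for i j k l P :: real
    using that unfolding parallel_ok_def by simp
  show ?thesis
    unfolding admissible_def
    apply (intro conjI d1 d2 d3 d4)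
    subgoal using triples by simp
    subgoal using triples by simp
    subgoal using triples by simp
    subgoal using e by simp
    subgoal using full e by simp
    subgoal using pairs[of x1 x2 x3 x4] ord pos e by (simp add: algebra_simps)
    subgoal using pairs[of x1 x3 x2 x4] ord pos e by (simp add: algebra_simps)
    subgoal using pairs[of x1 x4 x2 x3] ord pos e by (simp add: algebra_simps)
    subgoal using pairs[of x2 x3 x1 x4] ord pos e by (simp add: algebra_simps)
    subgoal using pairs[of x2 x4 x1 x3] ord pos e by (simp add: algebra_simps)
    subgoal using pairs[of x3 x4 x1 x2] ord pos e by (simp add: algebra_simps)
    subgoal using e(3) by (simp add: algebra_simps)
    subgoal using singles(1) by (simp add: algebra_simps)
    subgoal using singles(2) by (simp add: algebra_simps)
    subgoal using singles(3) by (simp add: algebra_simps)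
    subgoal using none e by (simp add: algebra_simps)
    subgoal by (rule hit3[OF miss]) (simp add: algebra_simps)
    subgoal by (rule hit3[OF miss4]) (simp add: algebra_simps)
    subgoal by (rule hit3[OF miss34]) (simp add: algebra_simps)
    subgoal by (rule hit3[OF miss234]) (simp add: algebra_simps)
    subgoal unfolding hit_ok_def using miss1234 by (simp add: algebra_simps)
    subgoal by (rule par) (use e in \<open>simp add: algebra_simps\<close>)
    subgoal by (rule par) (use e in \<open>simp add: algebra_simps\<close>)
    subgoal by (rule par) (use e in \<open>simp add: algebra_simps\<close>)
    subgoal by (rule par) (use e in \<open>simp add: algebra_simps\<close>)
    subgoal by (rule par) (use e in \<open>simp add: algebra_simps\<close>)
    subgoal by (rule par) (use e in \<open>simp add: algebra_simps\<close>)
    done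
qed

section \<open>Choice of the weights for sorted marginals\<close>

text \<open>(s + 2 * z)^2 exceeds 8 * z * s by the square of s - 2 * z = u + v, which is at least 4
  * u * v. That square is the room left for the triple weight r.\<close>

lemma double_ok_of_gap:
  fixes z s r u v :: real
  assumes "s - 2 * z = u + v" "2 * r \<le> u * v"
  shows "double_ok z s r"
proof -
  have "4 * (u * v) \<le> (u + v)\<^sup>2"
    using zero_le_power2[of "u - v"] by (simp add: power2_eq_square algebra_simps)
  moreover have "(s + 2 * z)\<^sup>2 = (s - 2 * z)\<^sup>2 + 8 * (z * s)" by (simp add: power2_eq_square algebra_simps)
  ultimately show ?thesis using assms unfolding double_ok_def by simp
qed

text \<open>Since x2 + x3 <= 1, the largest e that keeps all weights nonnegative is the product
  weight of {1, 2, 3}. It empties this triple, and the triple without k, for k < 4, keeps the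
  product of the other two marginals below 4 times x4 - xk. The factor x4 - xk also splits off from
  s - 2 * z in \<open>double_ok_of_gap\<close>.\<close>

lemma admissible_low_middle:
  fixes x1 x2 x3 x4 :: real
  assumes ord: "0 \<le> x1" "x1 \<le> x2" "x2 \<le> x3" "x3 \<le> x4" "x4 \<le> 1"
    and sum: "1 \<le> x1 + x2 + x3" and mid: "x2 + x3 \<le> 1"
    and miss: "(1 - x1) * (1 - x2) * (1 - x3) \<le> 1 / 4"
  shows "\<exists>ra rb rc rd q. admissible x1 x2 x3 x4 ra rb rc rd q"
proof -
  have pos: "0 \<le> x2" "0 \<le> x3" "0 \<le> x4" "0 \<le> 1 - x1" "0 \<le> 1 - x2" "0 \<le> 1 - x3" "0 \<le> 1 - x4" using ord by auto
  define e where "e = x1 * x2 * x3 * (1 - x4)"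
  have e0: "0 \<le> e" using pos ord by (auto simp: e_def)
  have "x1 * (1 - x4) * (x2 * x3) \<le> x1 * (1 - x4) * ((1 - x2) * (1 - x3))"
    using pos ord mid by (intro mult_left_mono mult_nonneg_nonneg) (simp_all add: algebra_simps)
  then have e2: "e \<le> x1 * (1 - x2) * (1 - x3) * (1 - x4)" by (simp add: e_def mult_ac)
  have d4: "double_ok x4 (x1 + x2 + x3) 0"
    by (rule double_ok_of_gap[of _ _ 0 "x1 + x2 + x3 - 2 * x4"]) auto
  have d1: "double_ok x1 (x2 + x3 + x4) (x2 * x3 * (x4 - x1))"
  proof (rule double_ok_of_gap[of _ _ "x2 + x3 - x1" "x4 - x1"])
    have "x3 * (2 * x2) \<le> x3 * 1" using pos ord mid by (intro mult_left_mono) auto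
    then have "2 * (x2 * x3) \<le> x2 + x3 - x1" using ord by (simp add: mult_ac)
    then have "2 * (x2 * x3) * (x4 - x1) \<le> (x2 + x3 - x1) * (x4 - x1)" using ord by (intro mult_right_mono) auto
    then show "2 * (x2 * x3 * (x4 - x1)) \<le> (x2 + x3 - x1) * (x4 - x1)" by (simp add: mult_ac)
  qed auto
  have d2: "double_ok x2 (x1 + x3 + x4) (x1 * x3 * (x4 - x2))"
  proof (rule double_ok_of_gap[of _ _ "x1 + x3 - x2" "x4 - x2"])
    have "2 * (x1 * x3) \<le> x1 + x3 - x2"
    proof (cases "x3 \<le> 1 / 2")
      case True
      then have "x1 * (2 * x3) \<le> x1 * 1" using ord by (intro mult_left_mono) auto
      then show ?thesis using ord by (simp add: mult_ac)
    next
      case False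
      then have "x1 * (2 * x3 - 1) \<le> x2 * (2 * x3 - 1)" using ord by (intro mult_right_mono) auto
      moreover have "0 \<le> x3 * (1 - 2 * x2)" using False mid pos by (intro mult_nonneg_nonneg) auto
      ultimately show ?thesis by (simp add: algebra_simps)
    qed
    then have "2 * (x1 * x3) * (x4 - x2) \<le> (x1 + x3 - x2) * (x4 - x2)" using ord by (intro mult_right_mono) auto
    then show "2 * (x1 * x3 * (x4 - x2)) \<le> (x1 + x3 - x2) * (x4 - x2)" by (simp add: mult_ac)
  qed auto
  have d3: "double_ok x3 (x1 + x2 + x4) (x1 * x2 * (x4 - x3))"
  proof (cases "1 / 2 \<le> x3")
    case True
    have "x1 * x2 \<le> 1 * x2" using ord pos by (intro mult_right_mono) auto
    then have "0 \<le> (1 - x3 - x1 * x2) * (x4 - x3)" using ord mid by (intro mult_nonneg_nonneg) auto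
    moreover have "0 \<le> (1 - x3) * (x1 + x2 + x3 - 1)" using sum pos by (intro mult_nonneg_nonneg) auto
    ultimately have "1 + x3 \<le> x1 + x2 + x4 + 2 * x3 - (x3 * (x1 + x2 + x4) + x1 * x2 * (x4 - x3))"
      by (simp add: algebra_simps)
    then show ?thesis using True unfolding double_ok_def by linarith
  next
    case False
    \<comment> \<open>On x1 + x2 + x4 + 2 * x3 = 2 both linear tests in \<open>double_ok\<close> say
      z * s + r <= 1/2, that is 2 * m * n <= h^2, where n is the value of x4 - x3 there. Off this
      hyperplane the relevant test is affine in x4: below it the first one has slope 1 - 4 * x3 - 4
      * m <= 0, above it the second one has slope 1 - x3 - m >= 0. So \<open>bound\<close> is all
      that is needed.\<close>
    define m g h n where "m = x1 * x2" and "g = 1 - x3" and "h = 1 - 2 * x3" and "n = 2 - 3 * x3 - (x1 + x2)"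
    have gh: "h = 2 * g - 1" "1 / 2 \<le> g" "g \<le> 1" "0 \<le> h" using False pos by (auto simp: g_def h_def)
    have m0: "0 \<le> m" "m \<le> 1 - x3" using pos ord mid mult_right_mono[of x1 1 x2] by (auto simp: m_def)
    have bound: "2 * (m * n) \<le> h\<^sup>2"
    proof (cases "n \<le> 0")
      case True
      then have "m * n \<le> 0" using m0 by (intro mult_nonneg_nonpos)
      then show ?thesis using zero_le_power2[of h] by linarith
    next
      case False
      \<comment> \<open>The hypothesis \<open>miss\<close>, solved for the product m = x1 * x2; it
        turns \<open>bound\<close> into an inequality that is quadratic in n.\<close>
      have "4 * g * m \<le> 1 - 4 * g * (n + 2 - 3 * g)"
        using miss by (simp add: m_def n_def g_def algebra_simps)
      then have "n * (4 * g * m) \<le> n * (1 - 4 * g * (n + 2 - 3 * g))" using False by (intro mult_left_mono) auto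
      moreover have "0 \<le> 2 * g * h\<^sup>2 - n * (1 - 4 * g * (n + 2 - 3 * g))" (is "0 \<le> ?Y")
      proof -
        \<comment> \<open>Completion of the square in n; the linear coefficient factors since 12 *
          g^2 - 8 * g + 1 = (6 * g - 1) * (2 * g - 1).\<close>
        have "16 * g * ?Y = (8 * g * n - h * (6 * g - 1))\<^sup>2 + h\<^sup>2 * (4 * g * (1 - g) + (8 * g - 1))"
          unfolding gh(1) by (simp add: power2_eq_square algebra_simps)
        moreover have "0 \<le> (8 * g * n - h * (6 * g - 1))\<^sup>2 + h\<^sup>2 * (4 * g * (1 - g) + (8 * g - 1))"
          using gh by (intro add_nonneg_nonneg mult_nonneg_nonneg) auto
        ultimately have "0 \<le> 16 * g * ?Y" by simp
        moreover have "0 < 16 * g" using gh by simp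
        ultimately show ?thesis by (simp only: zero_le_mult_iff) linarith
      qed
      ultimately have "n * (4 * g * m) \<le> 2 * g * h\<^sup>2" by linarith
      then have "2 * g * (2 * (m * n)) \<le> 2 * g * h\<^sup>2" by (simp add: mult_ac)
      moreover have "0 < 2 * g" using gh by simp
      ultimately show ?thesis by (rule mult_left_le_imp_le)
    qed
    have x3: "1 / 3 \<le> x3" using ord sum by linarith
    show ?thesis
    proof (cases "x1 + x2 + x4 + 2 * x3 \<le> 2")
      case True
      have "0 \<le> (4 * x3 + 4 * m - 1) * (2 - 2 * x3 - (x1 + x2) - x4)"
        using True m0 x3 by (intro mult_nonneg_nonneg) auto
      then have "4 * (x3 * (x1 + x2 + x4) + m * (x4 - x3)) \<le> x1 + x2 + x4 + 2 * x3"
        using bound by (simp add: n_def h_def power2_eq_square algebra_simps)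
      then show ?thesis unfolding double_ok_def m_def by simp
    next
      case False
      have "0 \<le> (1 - x3 - m) * (x4 - (2 - 2 * x3 - (x1 + x2)))"
        using False m0 by (intro mult_nonneg_nonneg) auto
      then have "3 / 2 \<le> x1 + x2 + x4 + 2 * x3 - (x3 * (x1 + x2 + x4) + m * (x4 - x3))"
        using bound by (simp add: n_def h_def power2_eq_square algebra_simps)
      then show ?thesis unfolding double_ok_def m_def by simp
    qed
  qed
  have "admissible x1 x2 x3 x4 (x2 * x3 * x4 * (1 - x1) - e) (x1 * x3 * x4 * (1 - x2) - e)
    (x1 * x2 * x4 * (1 - x3) - e) (x1 * x2 * x3 * (1 - x4) - e) (x1 * x2 * x3 * x4 + e)"
    by (rule perturbed_independent_admissible[OF ord e0 _ e2 miss])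
      (use d1 d2 d3 d4 in \<open>simp_all add: e_def algebra_simps\<close>)
  then show ?thesis by blast
qed

text \<open>For x2 + x3 >= 1 the first singleton is the tight one: e is its product weight, again
  the largest possible value. The triples containing 1 then have weights such as x1 * (1 - x4) * (x2
  + x3 - 1), and their doubled rays reach 3/2 outright.\<close>

lemma admissible_high_middle:
  fixes x1 x2 x3 x4 :: real
  assumes ord: "0 \<le> x1" "x1 \<le> x2" "x2 \<le> x3" "x3 \<le> x4" "x4 \<le> 1"
    and mid: "1 \<le> x2 + x3"
  shows "\<exists>ra rb rc rd q. admissible x1 x2 x3 x4 ra rb rc rd q"
proof -
  have pos: "0 \<le> x2" "0 \<le> x3" "0 \<le> x4" "0 \<le> 1 - x1" "0 \<le> 1 - x2" "0 \<le> 1 - x3" "0 \<le> 1 - x4" using ord by auto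
  have half: "1 / 2 \<le> x3" "1 / 2 \<le> x4" using ord mid by auto
  define e where "e = x1 * (1 - x2) * (1 - x3) * (1 - x4)"
  have e0: "0 \<le> e" using pos ord by (auto simp: e_def)
  have "x1 * (1 - x4) * ((1 - x2) * (1 - x3)) \<le> x1 * (1 - x4) * (x2 * x3)"
    using pos ord mid by (intro mult_left_mono mult_nonneg_nonneg) (simp_all add: algebra_simps)
  then have e2: "e \<le> x1 * x2 * x3 * (1 - x4)" by (simp add: e_def mult_ac)
  have "4 * ((1 - x2) * (1 - x3)) \<le> (2 - x2 - x3)\<^sup>2"
    using zero_le_power2[of "x2 - x3"] by (simp add: power2_eq_square algebra_simps)
  also have "\<dots> \<le> 1" using ord mid by (intro power_le_one) auto
  finally have "(1 - x2) * (1 - x3) \<le> 1 / 4" by simp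
  moreover have "(1 - x1) * ((1 - x2) * (1 - x3)) \<le> 1 * ((1 - x2) * (1 - x3))"
    using ord pos by (intro mult_right_mono mult_nonneg_nonneg) auto
  ultimately have miss: "(1 - x1) * (1 - x2) * (1 - x3) \<le> 1 / 4" unfolding mult.assoc by linarith
  \<comment> \<open>The right side is affine in x1 with slope (1 - z) * (2 - t), and the left side
    is its value at x1 = 0.\<close>
  have reduce: "1 + (1 - z) * (t - 1) + z \<le> x1 + t + 2 * z - (z * (x1 + t) + x1 * (1 - z) * (t - 1))"
    if "z \<le> 1" "t \<le> 2" for z t
  proof -
    have "0 \<le> x1 * ((1 - z) * (2 - t))" using that ord by (intro mult_nonneg_nonneg) auto
    then show ?thesis by (simp add: algebra_simps)
  qed
  have d4: "double_ok x4 (x1 + x2 + x3) (x1 * (1 - x4) * (x2 + x3 - 1))"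
  proof -
    have "0 \<le> (1 - x4) * (x2 + x3 - 1)" using pos mid by (intro mult_nonneg_nonneg) auto
    then show ?thesis using reduce[of x4 "x2 + x3"] half ord unfolding double_ok_def by (simp add: add.assoc)
  qed
  have d3: "double_ok x3 (x1 + x2 + x4) (x1 * (1 - x3) * (x2 + x4 - 1))"
  proof -
    have "0 \<le> (1 - x3) * (x2 + x4 - 1)" using pos mid ord by (intro mult_nonneg_nonneg) auto
    then show ?thesis using reduce[of x3 "x2 + x4"] half ord unfolding double_ok_def by (simp add: add.assoc)
  qed
  have d2: "double_ok x2 (x1 + x3 + x4) (x1 * (1 - x2) * (x3 + x4 - 1))"
  proof -
    have "0 \<le> (1 - x2) * (x3 + x4 - 2 * (1 - x2))" using pos mid ord by (intro mult_nonneg_nonneg) auto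
    then have "1 / 2 \<le> (1 - x2) * (x3 + x4 - 1) + x2"
      using zero_le_power2[of "2 * x2 - 1"] by (simp add: power2_eq_square algebra_simps)
    then show ?thesis using reduce[of x2 "x3 + x4"] half ord unfolding double_ok_def by (simp add: add.assoc)
  qed
  have d1: "double_ok x1 (x2 + x3 + x4) (x2 * x3 * x4 * (1 - x1) - e)"
  proof -
    define c T where "c = x2 + x3" and "T = x2 * x3 * x4"
    have c: "1 \<le> c" "c \<le> 2" using mid ord by (auto simp: c_def)
    have x23: "4 * (x2 * x3) \<le> c\<^sup>2"
      using zero_le_power2[of "x2 - x3"] by (simp add: c_def power2_eq_square algebra_simps)
    then have T: "4 * T \<le> c\<^sup>2 * x4" using pos mult_right_mono[of "4 * (x2 * x3)" "c\<^sup>2" x4] by (simp add: T_def mult_ac)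
    have T0: "0 \<le> T" using pos by (simp add: T_def)
    have "c\<^sup>2 \<le> 2\<^sup>2" using c by (intro power_mono) auto
    then have "0 \<le> (x4 - 1 / 2) * (4 - c\<^sup>2)" using half by (intro mult_nonneg_nonneg) auto
    then have gap: "c + 1 / 2 - c\<^sup>2 / 8 \<le> c + x4 - T" using T by (simp add: field_simps)
    have E: "2 * x1 + (1 - x1) * (c + x4 - T) \<le> x2 + x3 + x4 + 2 * x1 - (x1 * (x2 + x3 + x4) + (T * (1 - x1) - e))"
      using e0 by (simp add: c_def algebra_simps)
    \<comment> \<open>The bound \<open>gap\<close> reaches 3/2 from c = 4 - 2 * sqrt 2 on, slightly
      below 6/5. For c >= 1 it still gives 11/8, and 2 * x1 + (1 - x1) * 11/8 reaches 3/2 at x1 =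
      1/5. In the remaining corner the quadratic test applies, with s - 2 * z split as (c - 2 * x1)
      + x4.\<close>
    consider "6 / 5 \<le> c" | "1 / 5 \<le> x1" | "c < 6 / 5" "x1 < 1 / 5" by linarith
    then show ?thesis
    proof cases
      case 1
      have "0 \<le> (c - 6 / 5) * (2 - c)" using 1 c by (intro mult_nonneg_nonneg) auto
      then have "3 / 2 \<le> c + x4 - T" using gap 1 by (simp add: power2_eq_square field_simps)
      then have "(1 - x1) * (3 / 2) \<le> (1 - x1) * (c + x4 - T)" using pos by (intro mult_left_mono) auto
      then show ?thesis using E ord unfolding double_ok_def T_def by simp
    next
      case 2
      have "0 \<le> (c - 1) * (2 - c)" using c by (intro mult_nonneg_nonneg) auto
      then have "11 / 8 \<le> c + x4 - T" using gap c by (simp add: power2_eq_square algebra_simps)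
      then have "(1 - x1) * (11 / 8) \<le> (1 - x1) * (c + x4 - T)" using pos by (intro mult_left_mono) auto
      then show ?thesis using E 2 unfolding double_ok_def T_def by simp
    next
      case 3
      have "T * (1 - x1) \<le> T * 1" using T0 ord by (intro mult_left_mono) auto
      then have r: "T * (1 - x1) - e \<le> T" using e0 by simp
      have "0 \<le> (c - 1) * (6 / 5 - c)" using 3 c by (intro mult_nonneg_nonneg) auto
      then have "c\<^sup>2 \<le> 2 * (c - 2 / 5)" using 3 by (simp add: power2_eq_square field_simps)
      then have "c\<^sup>2 * x4 \<le> 2 * (c - 2 / 5) * x4" using pos by (intro mult_right_mono) auto
      then have "2 * T \<le> (c - 2 / 5) * x4" using T by (simp only: mult.assoc)
      also have "\<dots> \<le> (c - 2 * x1) * x4" using 3 pos by (intro mult_right_mono) auto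
      finally show ?thesis
        using r by (intro double_ok_of_gap[of _ _ "c - 2 * x1" x4]) (auto simp: c_def T_def)
    qed
  qed
  have "admissible x1 x2 x3 x4 (x2 * x3 * x4 * (1 - x1) - e) (x1 * x3 * x4 * (1 - x2) - e)
    (x1 * x2 * x4 * (1 - x3) - e) (x1 * x2 * x3 * (1 - x4) - e) (x1 * x2 * x3 * x4 + e)"
    by (rule perturbed_independent_admissible[OF ord e0 e2 _ miss _ _ _ d1])
      (use d2 d3 d4 in \<open>simp_all add: e_def algebra_simps\<close>)
  then show ?thesis by blast
qed

text \<open>The unperturbed star would give the empty set the weight -t. The missing mass t goes to
  {2, 3} alone as long as the triple {2, 3, 4}, of weight x2 * (x3 - x1), can pay for it; otherwise
  {1, 2}, {1, 3} and {2, 3} receive t / 3 each.\<close>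

lemma admissible_star:
  fixes x1 x2 x3 x4 :: real
  assumes ord: "0 \<le> x1" "x1 \<le> x2" "x2 \<le> x3" "x3 \<le> x4" "x4 \<le> 1"
    and sum: "1 \<le> x1 + x2 + x3" and miss: "1 / 4 < (1 - x1) * (1 - x2) * (1 - x3)"
  shows "\<exists>ra rb rc rd q. admissible x1 x2 x3 x4 ra rb rc rd q"
proof -
  have pos: "0 \<le> x2" "0 \<le> x3" "0 \<le> x4" "0 \<le> 1 - x1" "0 \<le> 1 - x2" "0 \<le> 1 - x3" "0 \<le> 1 - x4" using ord by auto
  define s t where "s = x1 + x2 + x3 - 1" and "t = (1 - x4) * s"
  have s0: "0 \<le> s" using sum by (simp add: s_def)
  have t0: "0 \<le> t" using s0 pos by (simp add: t_def)
  have two: "1 / 4 < (1 - v) * (1 - w)" if "(1 - x1) * (1 - x2) * (1 - x3) = (1 - v) * (1 - w) * (1 - z)"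
    "0 \<le> z" "v \<le> 1" "w \<le> 1" for v w z
  proof -
    have "(1 - v) * (1 - w) * (1 - z) \<le> (1 - v) * (1 - w) * 1"
      using that by (intro mult_left_mono mult_nonneg_nonneg) auto
    then show ?thesis using that miss by simp
  qed
  have x13: "x1 + x3 \<le> 1"
  proof (rule ccontr)
    assume "\<not> x1 + x3 \<le> 1"
    have "4 * ((1 - x1) * (1 - x3)) \<le> (2 - x1 - x3)\<^sup>2"
      using zero_le_power2[of "x1 - x3"] by (simp add: power2_eq_square algebra_simps)
    also have "\<dots> \<le> 1" using ord \<open>\<not> x1 + x3 \<le> 1\<close> by (intro power_le_one) auto
    finally show False using two[of x1 x3 x2] ord pos by (simp add: mult_ac)
  qed
  \<comment> \<open>The factors 1 - x3 and 1 - x1 - x2 have sum 1 - s.\<close>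
  have prod: "(1 - x3) * (1 - x1 - x2) \<le> (1 - s)\<^sup>2 / 4"
    using zero_le_power2[of "x3 - x1 - x2"] by (simp add: s_def power2_eq_square algebra_simps)
  have p0: "0 \<le> (1 - x3) * (1 - x1 - x2)" using x13 ord pos by (intro mult_nonneg_nonneg) auto
  show ?thesis
  proof (cases "t \<le> x2 * (x3 - x1)")
    case True
    have s1: "s \<le> 1" using ord x13 by (simp add: s_def)
    then have "(1 - s)\<^sup>2 \<le> 1" using s0 by (intro power_le_one) auto
    then have "(1 - x3) * (1 - x1 - x2) \<le> 1 / 4" using prod by linarith
    moreover have "t \<le> (1 - x4) * x2" "t \<le> (1 - x4) * x3"
      unfolding t_def using pos x13 ord by (auto intro!: mult_left_mono simp: s_def)
    moreover have "t \<le> x4 * (1 - x1 - x2 - x3) + x3 * (x1 + x2)"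
      using p0 by (simp add: t_def s_def algebra_simps)
    moreover have "0 + 0 + t = (1 - x4) * (x1 + x2 + x3 - 1)" by (simp add: t_def s_def)
    ultimately have "admissible x1 x2 x3 x4 (x2 * (x3 - x1) - (t - 0)) (x1 * (x3 - x2) - (0 - 0)) 0 0 (x1 * x2 - 0)"
      using True t0 ord pos x13 by (intro star_admissible[OF ord]) auto
    then show ?thesis by blast
  next
    case False
    have x4: "1 / 3 \<le> x4" using ord sum by linarith
    \<comment> \<open>The numbers 1 - xi have sum 2 - s. By the inequality of the means s > 1/8
      would give a product at most (5/8)^3 = 125/512 < 1/4; the equality point 5/8 appears as the
      double root in w.\<close>
    have s8: "s \<le> 1 / 8"
    proof (rule ccontr)
      assume "\<not> s \<le> 1 / 8"
      define w where "w = 1 - x3"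
      have w: "0 \<le> w" "w \<le> 1" using pos by (auto simp: w_def)
      have "4 * ((1 - x1) * (1 - x2)) \<le> (2 - x1 - x2)\<^sup>2"
        using zero_le_power2[of "x1 - x2"] by (simp add: power2_eq_square algebra_simps)
      also have "\<dots> \<le> (15 / 8 - w)\<^sup>2"
        using \<open>\<not> s \<le> 1 / 8\<close> ord pos by (intro power_mono) (auto simp: s_def w_def)
      finally have "4 * ((1 - x1) * (1 - x2)) * w \<le> (15 / 8 - w)\<^sup>2 * w" using w by (intro mult_right_mono)
      moreover have "0 \<le> (w - 5 / 8)\<^sup>2 * (5 / 2 - w)" using w by (intro mult_nonneg_nonneg) auto
      ultimately have "4 * ((1 - x1) * (1 - x2) * (1 - x3)) \<le> 125 / 128"
        by (simp add: w_def power2_eq_square field_simps)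
      then show False using miss by simp
    qed
    have "t * 3 \<le> 2 * s"
      using mult_right_mono[of "1 - x4" "2 / 3" s] x4 s0 by (simp add: t_def)
    then have t24: "t \<le> 1 / 12" "t \<le> 2 / 3 * s" using s8 by auto
    \<comment> \<open>Ensures that the whole set, of weight x1 * x2 >= 1/36, can give up t / 3. If
      x1 < 1/6, then x3 lies between 5/12 and 5/8, and there x2 * (x3 - x1) >= (1 - x3) / 8 >= t,
      contrary to the present case.\<close>
    have x1: "1 / 6 \<le> x1"
    proof (rule ccontr)
      assume neg: "\<not> 1 / 6 \<le> x1"
      have x3l: "5 / 12 \<le> x3" using neg sum ord by linarith
      \<comment> \<open>(1 + x3)^2 * (1 - x3) <= 1 holds once x3^2 + x3 >= 1, and 5/8 is just above
        the root (sqrt 5 - 1) / 2.\<close>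
      have x3u: "x3 \<le> 5 / 8"
      proof (rule ccontr)
        assume big: "\<not> x3 \<le> 5 / 8"
        have "4 * ((1 - x1) * (1 - x2)) \<le> (2 - x1 - x2)\<^sup>2"
          using zero_le_power2[of "x1 - x2"] by (simp add: power2_eq_square algebra_simps)
        also have "\<dots> \<le> (1 + x3)\<^sup>2" using sum ord pos by (intro power_mono) auto
        finally have "4 * ((1 - x1) * (1 - x2)) * (1 - x3) \<le> (1 + x3)\<^sup>2 * (1 - x3)" using pos by (intro mult_right_mono)
        moreover have "(1 + x3)\<^sup>2 * (1 - x3) \<le> 1"
        proof -
          have "5 / 8 * (5 / 8) \<le> x3 * x3" using big by (intro mult_mono) auto
          then have "0 \<le> x3 * (x3 + x3 * x3 - 1)" using big pos by (intro mult_nonneg_nonneg) auto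
          then show ?thesis by (simp add: power2_eq_square algebra_simps)
        qed
        ultimately show False using miss by simp
      qed
      have "(5 / 6 - x3) * (x3 - 1 / 6) \<le> x2 * (x3 - x1)"
        using neg sum ord x3u x3l by (intro mult_mono) auto
      moreover have "t \<le> (1 - x3) * (1 / 8)"
        unfolding t_def using ord s8 s0 pos by (intro mult_mono) auto
      moreover have "0 \<le> (x3 - 5 / 12) * (5 / 8 - x3)" using x3l x3u by (intro mult_nonneg_nonneg) auto
      ultimately show False using False x3l by (simp add: field_simps)
    qed
    have "1 / 6 * (1 / 6) \<le> x1 * x2" using x1 ord by (intro mult_mono) auto
    moreover have "(1 - x3) * (1 - x1 - x2) + t / 3 \<le> 1 / 4"
    proof -
      have "s * s \<le> 1 * s" using s0 s8 by (intro mult_right_mono) auto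
      then show ?thesis using prod t24 s0 by (simp add: power2_eq_square algebra_simps)
    qed
    moreover have "t / 3 + t / 3 \<le> (1 - x4) * x1"
    proof -
      have "(1 - x4) * (2 / 3 * s) \<le> (1 - x4) * x1" using x1 s8 pos by (intro mult_left_mono) auto
      then show ?thesis by (simp add: t_def mult_ac)
    qed
    moreover have "(1 - x4) * x1 \<le> (1 - x4) * x2" "(1 - x4) * x2 \<le> (1 - x4) * x3"
      using ord pos by (auto intro: mult_left_mono)
    moreover have "t \<le> x4 * (1 - x1 - x2 - x3) + x3 * (x1 + x2)"
      using p0 by (simp add: t_def s_def algebra_simps)
    moreover have "t / 3 + t / 3 + t / 3 = (1 - x4) * (x1 + x2 + x3 - 1)" by (simp add: t_def s_def)
    moreover have "0 \<le> x1 * (x3 - x2)" "0 \<le> x2 * (x3 - x1)" using ord pos by auto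
    ultimately have "admissible x1 x2 x3 x4 (x2 * (x3 - x1) - (t / 3 - t / 3)) (x1 * (x3 - x2) - (t / 3 - t / 3)) 0 0 (x1 * x2 - t / 3)"
      using t0 t24 ord x13 by (intro star_admissible[OF ord]) linarith+
    then show ?thesis by blast
  qed
qed

lemma admissible_exists:
  fixes x1 x2 x3 x4 :: real
  assumes ord: "0 \<le> x1" "x1 \<le> x2" "x2 \<le> x3" "x3 \<le> x4" "x4 \<le> 1"
  shows "\<exists>ra rb rc rd q. admissible x1 x2 x3 x4 ra rb rc rd q"
proof -
  consider "x1 + x2 + x3 \<le> 1" | "1 \<le> x1 + x2 + x3" "1 / 4 < (1 - x1) * (1 - x2) * (1 - x3)"
    | "1 \<le> x1 + x2 + x3" "(1 - x1) * (1 - x2) * (1 - x3) \<le> 1 / 4" by linarith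
  then show ?thesis
  proof cases
    case 1
    have "0 \<le> (x1 + x2) * x3" "0 \<le> x4 * (1 - x1 - x2 - x3)" using 1 ord by auto
    then have "admissible x1 x2 x3 x4 (x2 * (x3 - x1) - (0 - 0)) (x1 * (x3 - x2) - (0 - 0)) 0 0 (x1 * x2 - 0)"
      using 1 ord by (intro star_admissible[OF ord]) (auto simp: mult.commute)
    then show ?thesis by blast
  next
    case 2
    then show ?thesis by (rule admissible_star[OF ord])
  next
    case 3
    then show ?thesis
      using admissible_low_middle[OF ord] admissible_high_middle[OF ord] by (cases "x2 + x3 \<le> 1") auto
  qed
qed

text \<open>The fifteen rays that restrict the higher moments. \<open>perm\<close> lists the
  relabelings that bring each of them to the position for which its domination lemma is
  stated.\<close>

lemma special_rays_dominated:
  fixes x :: "nat \<Rightarrow> real"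
  assumes D: "distinct [a, b, c, d]" and N: "N = {a, b, c, d}" and x: "\<forall>i\<in>N. x i \<in> {0..1}"
    and sorted: "x a \<le> x b" "x b \<le> x c" "x c \<le> x d"
  shows "\<exists>p\<in>pairwise_feasible_weights N x.
    (\<forall>A\<in>{{a, b, c}, {a, b, d}, {a, c, d}, {b, c, d}, N}. dominates N x p (hit A)) \<and>
    (\<forall>(i, j)\<in>{(a, b), (a, c), (a, d), (b, c), (b, d), (c, d)}. dominates N x p (parallel i j)) \<and>
    (\<forall>i\<in>N. dominates N x p (cap 2 ((\<lambda>_. 1)(i := 2))))"
proof -
  have "0 \<le> x a" "x d \<le> 1" using x N by auto
  from admissible_exists[OF this(1) sorted this(2)] obtain ra rb rc rd q
    where adm: "admissible (x a) (x b) (x c) (x d) ra rb rc rd q" by blast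
  note adm' = adm[unfolded admissible_def]
  have "\<exists>p\<in>pairwise_feasible_weights {a, b, c, d} x.
    p {b, c, d} = ra \<and> p {a, c, d} = rb \<and> p {a, b, d} = rc \<and> p {a, b, c} = rd \<and> p {a, b, c, d} = q"
    by (rule pairwise_weights_exist[OF D]) (use adm' in blast)+
  then obtain p where p: "p \<in> pairwise_feasible_weights N x"
    and v: "p {b, c, d} = ra" "p {a, c, d} = rb" "p {a, b, d} = rc" "p {a, b, c} = rd" "p N = q"
    unfolding N by blast
  have perm: "distinct [i, j, k, l] \<and> N = {i, j, k, l}"
    if "[i, j, k, l] \<in> {[a, b, c, d], [a, b, d, c], [a, c, d, b], [b, c, d, a], [a, c, b, d], [a, d, b, c],
      [b, c, a, d], [b, d, a, c], [c, d, a, b]}" for i j k l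
    using that D unfolding N by auto
  have sets: "{c, b, d} = {b, c, d}" "{d, b, c} = {b, c, d}" "{c, a, d} = {a, c, d}" "{d, a, c} = {a, c, d}" "{b, a, d} = {a, b, d}"
    "{d, a, b} = {a, b, d}" "{b, a, c} = {a, b, c}" "{c, a, b} = {a, b, c}" by auto
  note hit3 = dominates_hit3[OF conjunct1[OF perm] conjunct2[OF perm] x p]
  note par = dominates_parallel[OF conjunct1[OF perm] conjunct2[OF perm] x p]
  note dbl = dominates_double2[OF conjunct1[OF perm] conjunct2[OF perm] x p]
  have "dominates N x p (hit {a, b, c})" by (rule hit3[of a b c d]) (use adm' v in simp_all)
  moreover have "dominates N x p (hit {a, b, d})" by (rule hit3[of a b d c]) (use adm' v in simp_all)
  moreover have "dominates N x p (hit {a, c, d})" by (rule hit3[of a c d b]) (use adm' v in simp_all)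
  moreover have "dominates N x p (hit {b, c, d})" by (rule hit3[of b c d a]) (use adm' v in simp_all)
  moreover have "dominates N x p (hit N)"
    by (rule dominates_hit4[OF D N x p]) (use adm' v in simp)
  moreover have "dominates N x p (parallel a b)" by (rule par[of a b c d]) (use adm' v sets in simp_all)
  moreover have "dominates N x p (parallel a c)" by (rule par[of a c b d]) (use adm' v sets in simp_all)
  moreover have "dominates N x p (parallel a d)" by (rule par[of a d b c]) (use adm' v sets in simp_all)
  moreover have "dominates N x p (parallel b c)" by (rule par[of b c a d]) (use adm' v sets in simp_all)
  moreover have "dominates N x p (parallel b d)" by (rule par[of b d a c]) (use adm' v sets in simp_all)
  moreover have "dominates N x p (parallel c d)" by (rule par[of c d a b]) (use adm' v sets in simp_all)
  moreover have "dominates N x p (cap 2 ((\<lambda>_. 1)(d := 2)))" by (rule dbl[of a b c d]) (use adm' v in simp_all)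
  moreover have "dominates N x p (cap 2 ((\<lambda>_. 1)(c := 2)))" by (rule dbl[of a b d c]) (use adm' v in simp_all)
  moreover have "dominates N x p (cap 2 ((\<lambda>_. 1)(b := 2)))" by (rule dbl[of a c d b]) (use adm' v in simp_all)
  moreover have "dominates N x p (cap 2 ((\<lambda>_. 1)(a := 2)))" by (rule dbl[of b c d a]) (use adm' v in simp_all)
  ultimately show ?thesis using p unfolding N by (intro bexI[of _ p]) auto
qed

section \<open>Decomposition of polymatroids on four elements\<close>

text \<open>The cone of \<open>face_nonneg\<close> lies in a ten-dimensional space, so each
  simplicial cone of its triangulation is spanned by ten rays.\<close>

lemma nonneg_combination10:
  fixes L :: "'a::real_vector \<Rightarrow> real"
  assumes "0 \<le> L r0" "0 \<le> L r1" "0 \<le> L r2" "0 \<le> L r3" "0 \<le> L r4"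
    "0 \<le> L r5" "0 \<le> L r6" "0 \<le> L r7" "0 \<le> L r8" "0 \<le> L r9"
    and "linear L"
    and "0 \<le> c0" "0 \<le> c1" "0 \<le> c2" "0 \<le> c3" "0 \<le> c4"
    "0 \<le> c5" "0 \<le> c6" "0 \<le> c7" "0 \<le> c8" "0 \<le> c9"
    and "x = c0 *\<^sub>R r0 + c1 *\<^sub>R r1 + c2 *\<^sub>R r2 + c3 *\<^sub>R r3 + c4 *\<^sub>R r4
      + c5 *\<^sub>R r5 + c6 *\<^sub>R r6 + c7 *\<^sub>R r7 + c8 *\<^sub>R r8 + c9 *\<^sub>R r9"
  shows "0 \<le> L x"
  using assms by (simp add: linear_add linear_scale)

text \<open>
  Coordinates of a polymatroid on \<open>{1, 2, 3, 4}\<close> that vanishes on the empty set, takes the same value \<open>R\<close> on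
  all sets with at least three elements, and satisfies \<open>f {1, 2} = f {1} + f {2}\<close>. The case distinction
  is a triangulation of this cone by its 25 extreme rays: in each branch one subtracts as much as possible of
  one ray, and the cases say which submodularity inequality becomes tight first.
\<close>

lemma face_nonneg:
  fixes s1 s2 s3 s4 p13 p14 p23 p24 p34 R :: real
    and L :: "real \<times> real \<times> real \<times> real \<times> real \<times> real \<times> real
        \<times> real \<times> real \<times> real \<Rightarrow> real"
  assumes linear: "linear L"
    and f12_3: "s3 + R \<le> p13 + p23"
    and f12_4: "s4 + R \<le> p14 + p24"
    and f12_34: "p34 \<le> R"
    and f13: "p13 \<le> s1 + s3"
    and f13_2: "R \<le> s1 + p23"
    and f13_4: "s4 + R \<le> p14 + p34"
    and f13_24: "p24 \<le> R"
    and f14: "p14 \<le> s1 + s4"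
    and f14_2: "R \<le> s1 + p24"
    and f14_3: "s3 + R \<le> p13 + p34"
    and f14_23: "p23 \<le> R"
    and f23: "p23 \<le> s2 + s3"
    and f23_1: "R \<le> s2 + p13"
    and f23_4: "s4 + R \<le> p24 + p34"
    and f23_14: "p14 \<le> R"
    and f24: "p24 \<le> s2 + s4"
    and f24_1: "R \<le> s2 + p14"
    and f24_3: "s3 + R \<le> p23 + p34"
    and f24_13: "p13 \<le> R"
    and f34: "p34 \<le> s3 + s4"
    and f34_1: "s1 + R \<le> p13 + p14"
    and f34_2: "s2 + R \<le> p23 + p24"
    and f34_12: "s1 + s2 \<le> R"
    and hit13: "0 \<le> L (1, 0, 1, 0, 1, 1, 1, 0, 1, 1)"
    and hit23: "0 \<le> L (0, 1, 1, 0, 1, 0, 1, 1, 1, 1)"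
    and hit14: "0 \<le> L (1, 0, 0, 1, 1, 1, 0, 1, 1, 1)"
    and hit24: "0 \<le> L (0, 1, 0, 1, 0, 1, 1, 1, 1, 1)"
    and hit34: "0 \<le> L (0, 0, 1, 1, 1, 1, 1, 1, 1, 1)"
    and hit134: "0 \<le> L (1, 0, 1, 1, 1, 1, 1, 1, 1, 1)"
    and hit234: "0 \<le> L (0, 1, 1, 1, 1, 1, 1, 1, 1, 1)"
    and loop4: "0 \<le> L (1, 1, 1, 0, 2, 1, 2, 1, 1, 2)"
    and loop3: "0 \<le> L (1, 1, 0, 1, 1, 2, 1, 2, 1, 2)"
    and loop2: "0 \<le> L (1, 0, 1, 1, 2, 2, 1, 1, 2, 2)"
    and loop1: "0 \<le> L (0, 1, 1, 1, 1, 1, 2, 2, 2, 2)"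
    and two: "0 \<le> L (1, 1, 1, 1, 2, 2, 2, 2, 2, 2)"
    and three: "0 \<le> L (1, 1, 1, 1, 2, 2, 2, 2, 2, 3)"
    and par13: "0 \<le> L (1, 1, 1, 1, 1, 2, 2, 2, 2, 2)"
    and par14: "0 \<le> L (1, 1, 1, 1, 2, 1, 2, 2, 2, 2)"
    and par23: "0 \<le> L (1, 1, 1, 1, 2, 2, 1, 2, 2, 2)"
    and par24: "0 \<le> L (1, 1, 1, 1, 2, 2, 2, 1, 2, 2)"
    and par34: "0 \<le> L (1, 1, 1, 1, 2, 2, 2, 2, 1, 2)"
    and dtwo3: "0 \<le> L (1, 1, 2, 1, 2, 2, 2, 2, 2, 2)"
    and dtwo4: "0 \<le> L (1, 1, 1, 2, 2, 2, 2, 2, 2, 2)"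
    and dthree1: "0 \<le> L (2, 1, 1, 1, 3, 3, 2, 2, 2, 3)"
    and dthree2: "0 \<le> L (1, 2, 1, 1, 2, 2, 3, 3, 2, 3)"
    and dthree3: "0 \<le> L (1, 1, 2, 1, 3, 2, 3, 2, 3, 3)"
    and dthree4: "0 \<le> L (1, 1, 1, 2, 2, 3, 2, 3, 3, 3)"
    and ing12: "0 \<le> L (2, 2, 2, 2, 3, 3, 3, 3, 3, 4)"
  shows "0 \<le> L (s1, s2, s3, s4, p13, p14, p23, p24, p34, R)"
proof -
  \<comment> \<open>The first ray to be subtracted is that of \<open>hit13\<close>. The three cases
    say which of the slacks of \<open>f13_4\<close>, \<open>f13\<close> and \<open>f13_24\<close> is
    the least; this slack is the coefficient of the ray. Every further \<open>consider\<close>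
    compares candidate coefficients in the same way, and all leaves begin with \<open>hit13\<close>,
    \<open>hit23\<close>, \<open>hit14\<close>, \<open>hit24\<close>.\<close>
  consider "p13 + p14 + p34 \<le> s1 + s3 + s4 + R" "p14 + p24 + p34 \<le> s4 + 2 * R" | "s1 + s3 + s4 + R
      \<le> p13 + p14 + p34" "s1 + s3 + p24 \<le> p13 + R" | "s4 + 2 * R \<le> p14 + p24 + p34" "p13 + R \<le>
      s1 + s3 + p24" by linarith
  then show ?thesis
  proof cases
    case 1 note c1 = this
    \<comment> \<open>Now \<open>hit23\<close>: its coefficient is the smaller of the slacks of
      \<open>f23\<close> and \<open>f23_4\<close>.\<close>
    consider "s2 + s3 + s4 + R \<le> p23 + p24 + p34" | "p23 + p24 + p34 \<le> s2 + s3 + s4 + R" by linarith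
    then show ?thesis
    proof cases
      case 1 note c2 = this
      consider "p13 + p23 + p34 \<le> s3 + 2 * R" | "s3 + 2 * R \<le> p13 + p23 + p34" by linarith
      then show ?thesis
      proof cases
        case 1 note c3 = this
        consider "2 * R \<le> s2 + p13 + p14" | "s2 + p13 + p14 \<le> 2 * R" by linarith
        then show ?thesis
        proof cases
          case 1 note c4 = this
          show ?thesis
            \<comment> \<open>The ten expressions are the coordinates of the point in the basis of
              the ten rays. Each is nonnegative by one of the cited facts, either a submodularity
              inequality or a case assumption.\<close>
            by (rule nonneg_combination10[OF hit13 hit23 hit14 hit24 hit34 hit134 loop4 loop3 par34 dthree2
                linear,
                of "- s4 + p14 + p34 - R" "s2 + s3 - p23" "- s3 + p13 + p34 - R" "s2 + s4 - p24" "- s1 - s2 +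
                    R" "s1 + s3 + s4 - p13 - p14 - p34 + R" "s4 - p14 - p24 - p34 + 2 * R" "s3 - p13 - p23 -
                    p34 + 2 * R" "s2 + p13 + p14 - 2 * R" "- s2 - s3 - s4 + p23 + p24 + p34 - R"];
              (use c1(1) c1(2) c2 c3 c4 f13_4 f14_3 f23 f24 f34_12 in linarith | simp add: algebra_simps))
        next
          case 2 note c4 = this
          consider "p13 + p14 + p23 + p24 + p34 \<le> s3 + s4 + 3 * R" | "s3 + s4 + 3 * R \<le> p13 + p14 +
              p23 + p24 + p34" by linarith
          then show ?thesis
          proof cases
            case 1 note c5 = this
            show ?thesis
              by (rule nonneg_combination10[OF hit13 hit23 hit14 hit24 hit34 hit134 loop4 loop3 loop1 three
                  linear,
                  of "- s4 + p14 + p34 - R" "s2 + s3 - p23" "- s3 + p13 + p34 - R" "s2 + s4 - p24" "- s1 + p13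
                      + p14 - R" "s1 + s3 + s4 - p13 - p14 - p34 + R" "- s3 + p13 + p23 - R" "- s4 + p14 + p24
                      - R" "- s2 - s3 - s4 + p23 + p24 + p34 - R" "s3 + s4 - p13 - p14 - p23 - p24 - p34 + 3 *
                      R"];
                (use c1(1) c2 c5 f12_3 f12_4 f13_4 f14_3 f23 f24 f34_1 in linarith | simp add: algebra_simps))
          next
            case 2 note c5 = this
            show ?thesis
              by (rule nonneg_combination10[OF hit13 hit23 hit14 hit24 hit34 hit134 loop4 loop3 loop1 dthree2
                  linear,
                  of "- s4 + p14 + p34 - R" "s2 + s3 - p23" "- s3 + p13 + p34 - R" "s2 + s4 - p24" "- s1 + p13
                      + p14 - R" "s1 + s3 + s4 - p13 - p14 - p34 + R" "s4 - p14 - p24 - p34 + 2 * R" "s3 - p13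
                      - p23 - p34 + 2 * R" "- s2 - p13 - p14 + 2 * R" "- s3 - s4 + p13 + p14 + p23 + p24 + p34
                      - 3 * R"];
                (use c1(1) c1(2) c3 c4 c5 f13_4 f14_3 f23 f24 f34_1 in linarith | simp add: algebra_simps))
          qed
        qed
      next
        case 2 note c3 = this
        consider "s2 + s4 + p13 \<le> p24 + R" | "p24 + R \<le> s2 + s4 + p13" by linarith
        then show ?thesis
        proof cases
          case 1 note c4 = this
          consider "s2 + p13 + p14 \<le> 2 * R" | "2 * R \<le> s2 + p13 + p14" by linarith
          then show ?thesis
          proof cases
            case 1 note c5 = this
            show ?thesis
              by (rule nonneg_combination10[OF hit13 hit23 hit14 hit24 hit34 hit134 loop4 loop1 par14 dthree2
                  linear,
                  of "- s4 + p14 + p34 - R" "s2 + s3 - p23" "- p23 + R" "s2 + s4 - p24" "- s1 + p13 + p14 - R"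
                      "s1 + s3 + s4 - p13 - p14 - p34 + R" "s4 - p14 - p24 - p34 + 2 * R" "- s2 - p13 - p14 +
                      2 * R" "- s3 + p13 + p23 + p34 - 2 * R" "- s4 + p14 + p24 - R"];
                (use c1(1) c1(2) c3 c5 f12_4 f13_4 f14_23 f23 f24 f34_1 in linarith | simp add:
                    algebra_simps))
          next
            case 2 note c5 = this
            show ?thesis
              by (rule nonneg_combination10[OF hit13 hit23 hit14 hit24 hit34 hit134 loop4 par14 par34 dthree2
                  linear,
                  of "- s4 + p14 + p34 - R" "s2 + s3 - p23" "- p23 + R" "s2 + s4 - p24" "- s1 - s2 + R" "s1 +
                      s3 + s4 - p13 - p14 - p34 + R" "s4 - p14 - p24 - p34 + 2 * R" "- s3 + p13 + p23 + p34 -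
                      2 * R" "s2 + p13 + p14 - 2 * R" "- s2 - s4 - p13 + p24 + R"];
                (use c1(1) c1(2) c3 c4 c5 f13_4 f14_23 f23 f24 f34_12 in linarith | simp add: algebra_simps))
          qed
        next
          case 2 note c4 = this
          show ?thesis
            by (rule nonneg_combination10[OF hit13 hit23 hit14 hit24 hit34 hit134 loop4 par14 par34 dtwo4
                linear,
                of "- s4 + p14 + p34 - R" "s2 + s3 - p23" "- p23 + R" "- p13 + R" "- s1 - s2 + R" "s1 + s3 +
                    s4 - p13 - p14 - p34 + R" "s4 - p14 - p24 - p34 + 2 * R" "- s2 - s3 - s4 + p23 + p24 + p34
                    - R" "- s4 + p14 + p24 - R" "s2 + s4 + p13 - p24 - R"];
              (use c1(1) c1(2) c2 c4 f12_4 f13_4 f14_23 f23 f24_13 f34_12 in linarith | simp add: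
                  algebra_simps))
        qed
      qed
    next
      case 2 note c2 = this
      consider "s3 + 2 * R \<le> p13 + p23 + p34" | "p13 + p23 + p34 \<le> s3 + 2 * R" by linarith
      then show ?thesis
      proof cases
        case 1 note c3 = this
        show ?thesis
          by (rule nonneg_combination10[OF hit13 hit23 hit14 hit24 hit34 hit134 hit234 loop4 par34 dtwo4
              linear,
              of "- s4 + p14 + p34 - R" "- s4 + p24 + p34 - R" "- p23 + R" "- p13 + R" "- s1 - s2 + R" "s1 +
                  s3 + s4 - p13 - p14 - p34 + R" "s2 + s3 + s4 - p23 - p24 - p34 + R" "s4 - p14 - p24 - p34 +
                  2 * R" "- s4 + p14 + p24 - R" "- s3 + p13 + p23 + p34 - 2 * R"];
            (use c1(1) c1(2) c2 c3 f12_4 f13_4 f14_23 f23_4 f24_13 f34_12 in linarith | simp add: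
                algebra_simps))
      next
        case 2 note c3 = this
        consider "s1 + s2 + s3 + s4 + 2 * R \<le> p13 + p14 + p23 + p24 + p34" | "p13 + p14 + p23 + p24 + p34
            \<le> s1 + s2 + s3 + s4 + 2 * R" by linarith
        then show ?thesis
        proof cases
          case 1 note c4 = this
          consider "s3 + s4 + 3 * R \<le> p13 + p14 + p23 + p24 + p34" | "p13 + p14 + p23 + p24 + p34 \<le> s3
              + s4 + 3 * R" by linarith
          then show ?thesis
          proof cases
            case 1 note c5 = this
            show ?thesis
              by (rule nonneg_combination10[OF hit13 hit23 hit14 hit24 hit134 hit34 hit234 loop4 loop3 par34
                  linear,
                  of "- s4 + p14 + p34 - R" "- s4 + p24 + p34 - R" "- s3 + p13 + p34 - R" "- s3 + p23 + p34 -
                      R" "s1 + s3 + s4 - p13 - p14 - p34 + R" "- s1 - s2 + R" "s2 + s3 + s4 - p23 - p24 - p34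
                      + R" "s4 - p14 - p24 - p34 + 2 * R" "s3 - p13 - p23 - p34 + 2 * R" "- s3 - s4 + p13 +
                      p14 + p23 + p24 + p34 - 3 * R"];
                (use c1(1) c1(2) c2 c3 c5 f13_4 f14_3 f23_4 f24_3 f34_12 in linarith | simp add:
                    algebra_simps))
          next
            case 2 note c5 = this
            show ?thesis
              by (rule nonneg_combination10[OF hit13 hit23 hit14 hit24 hit134 hit34 hit234 loop4 loop3 three
                  linear,
                  of "- s4 + p14 + p34 - R" "- s4 + p24 + p34 - R" "- s3 + p13 + p34 - R" "- s3 + p23 + p34 -
                      R" "s1 + s3 + s4 - p13 - p14 - p34 + R" "- s1 - s2 - s3 - s4 + p13 + p14 + p23 + p24 +
                      p34 - 2 * R" "s2 + s3 + s4 - p23 - p24 - p34 + R" "- s3 + p13 + p23 - R" "- s4 + p14 +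
                      p24 - R" "s3 + s4 - p13 - p14 - p23 - p24 - p34 + 3 * R"];
                (use c1(1) c2 c4 c5 f12_3 f12_4 f13_4 f14_3 f23_4 f24_3 in linarith | simp add:
                    algebra_simps))
          qed
        next
          case 2 note c4 = this
          show ?thesis
            by (rule nonneg_combination10[OF hit13 hit23 hit14 hit24 hit134 hit234 loop4 loop3 three ing12
                linear,
                of "- s4 + p14 + p34 - R" "- s4 + p24 + p34 - R" "- s3 + p13 + p34 - R" "- s3 + p23 + p34 - R"
                    "- s2 + p23 + p24 - R" "- s1 + p13 + p14 - R" "- s3 + p13 + p23 - R" "- s4 + p14 + p24 -
                    R" "- s1 - s2 + R" "s1 + s2 + s3 + s4 - p13 - p14 - p23 - p24 - p34 + 2 * R"];
              (use c4 f12_3 f12_4 f13_4 f14_3 f23_4 f24_3 f34_1 f34_2 f34_12 in linarith | simp add: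
                  algebra_simps))
        qed
      qed
    qed
  next
    case 2 note c1 = this
    consider "p14 + p24 + p34 \<le> s4 + 2 * R" "p23 + p24 + p34 \<le> s2 + s3 + s4 + R" | "s4 + 2 * R \<le>
        p14 + p24 + p34" "p23 + R \<le> s2 + s3 + p14" | "s2 + s3 + s4 + R \<le> p23 + p24 + p34" "s2 + s3 +
        p14 \<le> p23 + R" by linarith
    then show ?thesis
    proof cases
      case 1 note c2 = this
      consider "s1 + s4 + p23 \<le> p14 + R" | "p14 + R \<le> s1 + s4 + p23" by linarith
      then show ?thesis
      proof cases
        case 1 note c3 = this
        consider "p13 + p23 + p34 \<le> s3 + 2 * R" | "s3 + 2 * R \<le> p13 + p23 + p34" by linarith
        then show ?thesis
        proof cases
          case 1 note c4 = this
          consider "2 * R \<le> s1 + p23 + p24" | "s1 + p23 + p24 \<le> 2 * R" by linarith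
          then show ?thesis
          proof cases
            case 1 note c5 = this
            show ?thesis
              by (rule nonneg_combination10[OF hit13 hit23 hit14 hit24 hit34 hit234 loop4 loop3 par34 dthree1
                  linear,
                  of "s1 + s3 - p13" "- s4 + p24 + p34 - R" "s1 + s4 - p14" "- s3 + p23 + p34 - R" "- s1 - s2
                      + R" "s2 + s3 + s4 - p23 - p24 - p34 + R" "s4 - p14 - p24 - p34 + 2 * R" "s3 - p13 - p23
                      - p34 + 2 * R" "s1 + p23 + p24 - 2 * R" "- s1 - s3 - s4 + p13 + p14 + p34 - R"];
                (use c1(1) c2(1) c2(2) c4 c5 f13 f14 f23_4 f24_3 f34_12 in linarith | simp add:
                    algebra_simps))
          next
            case 2 note c5 = this
            consider "p13 + p14 + p23 + p24 + p34 \<le> s3 + s4 + 3 * R" | "s3 + s4 + 3 * R \<le> p13 + p14 +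
                p23 + p24 + p34" by linarith
            then show ?thesis
            proof cases
              case 1 note c6 = this
              show ?thesis
                by (rule nonneg_combination10[OF hit13 hit23 hit14 hit24 hit34 hit234 loop4 loop3 loop2 three
                    linear,
                    of "s1 + s3 - p13" "- s4 + p24 + p34 - R" "s1 + s4 - p14" "- s3 + p23 + p34 - R" "- s2 +
                        p23 + p24 - R" "s2 + s3 + s4 - p23 - p24 - p34 + R" "- s3 + p13 + p23 - R" "- s4 + p14
                        + p24 - R" "- s1 - s3 - s4 + p13 + p14 + p34 - R" "s3 + s4 - p13 - p14 - p23 - p24 -
                        p34 + 3 * R"];
                  (use c1(1) c2(2) c6 f12_3 f12_4 f13 f14 f23_4 f24_3 f34_2 in linarith | simp add:
                      algebra_simps))
            next
              case 2 note c6 = this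
              show ?thesis
                by (rule nonneg_combination10[OF hit13 hit23 hit14 hit24 hit34 hit234 loop4 loop3 loop2
                    dthree1 linear,
                    of "s1 + s3 - p13" "- s4 + p24 + p34 - R" "s1 + s4 - p14" "- s3 + p23 + p34 - R" "- s2 +
                        p23 + p24 - R" "s2 + s3 + s4 - p23 - p24 - p34 + R" "s4 - p14 - p24 - p34 + 2 * R" "s3
                        - p13 - p23 - p34 + 2 * R" "- s1 - p23 - p24 + 2 * R" "- s3 - s4 + p13 + p14 + p23 +
                        p24 + p34 - 3 * R"];
                  (use c2(1) c2(2) c4 c5 c6 f13 f14 f23_4 f24_3 f34_2 in linarith | simp add: algebra_simps))
            qed
          qed
        next
          case 2 note c4 = this
          consider "2 * R \<le> s1 + p23 + p24" | "s1 + p23 + p24 \<le> 2 * R" by linarith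
          then show ?thesis
          proof cases
            case 1 note c5 = this
            show ?thesis
              by (rule nonneg_combination10[OF hit13 hit23 hit14 hit24 hit34 hit234 loop4 par24 par34 dthree1
                  linear,
                  of "s1 + s3 - p13" "- s4 + p24 + p34 - R" "s1 + s4 - p14" "- p13 + R" "- s1 - s2 + R" "s2 +
                      s3 + s4 - p23 - p24 - p34 + R" "s4 - p14 - p24 - p34 + 2 * R" "- s3 + p13 + p23 + p34 -
                      2 * R" "s1 + p23 + p24 - 2 * R" "- s1 - s4 + p14 - p23 + R"];
                (use c2(1) c2(2) c3 c4 c5 f13 f14 f23_4 f24_13 f34_12 in linarith | simp add: algebra_simps))
          next
            case 2 note c5 = this
            show ?thesis
              by (rule nonneg_combination10[OF hit13 hit23 hit14 hit24 hit34 hit234 loop4 loop2 par24 dthree1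
                  linear,
                  of "s1 + s3 - p13" "- s4 + p24 + p34 - R" "s1 + s4 - p14" "- p13 + R" "- s2 + p23 + p24 - R"
                      "s2 + s3 + s4 - p23 - p24 - p34 + R" "s4 - p14 - p24 - p34 + 2 * R" "- s1 - p23 - p24 +
                      2 * R" "- s3 + p13 + p23 + p34 - 2 * R" "- s4 + p14 + p24 - R"];
                (use c2(1) c2(2) c4 c5 f12_4 f13 f14 f23_4 f24_13 f34_2 in linarith | simp add:
                    algebra_simps))
          qed
        qed
      next
        case 2 note c3 = this
        show ?thesis
          by (rule nonneg_combination10[OF hit13 hit23 hit14 hit24 hit34 hit234 loop4 par24 par34 dtwo4
              linear,
              of "s1 + s3 - p13" "- s4 + p24 + p34 - R" "- p23 + R" "- p13 + R" "- s1 - s2 + R" "s2 + s3 + s4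
                  - p23 - p24 - p34 + R" "s4 - p14 - p24 - p34 + 2 * R" "- s1 - s3 - s4 + p13 + p14 + p34 - R"
                  "- s4 + p14 + p24 - R" "s1 + s4 - p14 + p23 - R"];
            (use c1(1) c2(1) c2(2) c3 f12_4 f13 f14_23 f23_4 f24_13 f34_12 in linarith | simp add:
                algebra_simps))
      qed
    next
      case 2 note c2 = this
      consider "p14 + R \<le> s1 + s4 + p23" | "s1 + s4 + p23 \<le> p14 + R" by linarith
      then show ?thesis
      proof cases
        case 1 note c3 = this
        show ?thesis
          by (rule nonneg_combination10[OF hit13 hit23 hit14 hit24 hit34 hit234 two par24 par34 dtwo4 linear,
              of "s1 + s3 - p13" "- p14 + R" "- p23 + R" "- p13 + R" "- s1 - s2 + R" "s2 + s3 + p14 - p23 - R"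
                  "- s4 + p14 + p24 + p34 - 2 * R" "- s1 - s3 + p13 - p24 + R" "- p34 + R" "s1 + s4 - p14 +
                  p23 - R"];
            (use c1(2) c2(1) c2(2) c3 f12_34 f13 f14_23 f23_14 f24_13 f34_12 in linarith | simp add:
                algebra_simps))
      next
        case 2 note c3 = this
        consider "s2 + s3 + s4 + R \<le> p23 + p24 + p34" "s2 + s4 + p13 \<le> p24 + R" | "p23 + p24 + p34
            \<le> s2 + s3 + s4 + R" "p13 + p23 + p34 \<le> s3 + 2 * R" | "p24 + R \<le> s2 + s4 + p13" "s3 + 2
            * R \<le> p13 + p23 + p34" by linarith
        then show ?thesis
        proof cases
          case 1 note c4 = this
          consider "p34 + R \<le> s1 + s2 + s3 + s4" | "s1 + s2 + s3 + s4 \<le> p34 + R" by linarith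
          then show ?thesis
          proof cases
            case 1 note c5 = this
            show ?thesis
              by (rule nonneg_combination10[OF hit13 hit23 hit14 hit24 hit34 loop3 two par23 par34 dthree1
                  linear,
                  of "s1 + s3 - p13" "- p14 + R" "s1 + s4 - p14" "s2 + s4 - p24" "- s1 - s2 + R" "- s2 - s4 -
                      p13 + p24 + R" "- s2 - s3 - s4 + p23 + p24 + p34 - R" "s2 + s3 + p14 - p23 - R" "s1 + s2
                      + s3 + s4 - p34 - R" "- s1 - s3 + p13 - p24 + R"];
                (use c1(2) c2(2) c4(1) c4(2) c5 f13 f14 f23_14 f24 f34_12 in linarith | simp add:
                    algebra_simps))
          next
            case 2 note c5 = this
            consider "p24 + p34 \<le> s2 + s4 + p13" | "s2 + s4 + p13 \<le> p24 + p34" by linarith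
            then show ?thesis
            proof cases
              case 1 note c6 = this
              show ?thesis
                by (rule nonneg_combination10[OF hit13 hit23 hit14 hit24 hit34 loop3 loop2 two par23 dthree1
                    linear,
                    of "s1 + s3 - p13" "- p14 + R" "s1 + s4 - p14" "s2 + s4 - p24" "s3 + s4 - p34" "- s2 - s4
                        - p13 + p24 + R" "- s1 - s2 - s3 - s4 + p34 + R" "- s2 - s3 - s4 + p23 + p24 + p34 -
                        R" "s2 + s3 + p14 - p23 - R" "s2 + s4 + p13 - p24 - p34"];
                  (use c2(2) c4(1) c4(2) c5 c6 f13 f14 f23_14 f24 f34 in linarith | simp add: algebra_simps))
            next
              case 2 note c6 = this
              show ?thesis
                by (rule nonneg_combination10[OF hit13 hit23 hit14 hit24 hit34 loop3 loop2 two par23 dthree4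
                    linear,
                    of "s1 + s3 - p13" "- p14 + R" "s1 + s4 - p14" "s2 + s4 - p24" "s3 + s4 - p34" "- p34 + R"
                        "- s1 - s3 + p13 - p24 + R" "- s3 + p13 + p23 - R" "s2 + s3 + p14 - p23 - R" "- s2 -
                        s4 - p13 + p24 + p34"];
                  (use c1(2) c2(2) c6 f12_3 f12_34 f13 f14 f23_14 f24 f34 in linarith | simp add:
                      algebra_simps))
            qed
          qed
        next
          case 2 note c4 = this
          consider "s1 + p23 + p24 \<le> 2 * R" | "2 * R \<le> s1 + p23 + p24" by linarith
          then show ?thesis
          proof cases
            case 1 note c5 = this
            show ?thesis
              by (rule nonneg_combination10[OF hit13 hit23 hit14 hit24 hit34 hit234 loop3 loop2 par23 dthree1
                  linear,
                  of "s1 + s3 - p13" "- p14 + R" "s1 + s4 - p14" "- s3 + p23 + p34 - R" "- s2 + p23 + p24 - R"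
                      "s2 + s3 + s4 - p23 - p24 - p34 + R" "s3 - p13 - p23 - p34 + 2 * R" "- s1 - p23 - p24 +
                      2 * R" "- s4 + p14 + p24 + p34 - 2 * R" "- s3 + p13 + p23 - R"];
                (use c2(1) c4(1) c4(2) c5 f12_3 f13 f14 f23_14 f24_3 f34_2 in linarith | simp add:
                    algebra_simps))
          next
            case 2 note c5 = this
            show ?thesis
              by (rule nonneg_combination10[OF hit13 hit23 hit14 hit24 hit34 hit234 loop3 par23 par34 dthree1
                  linear,
                  of "s1 + s3 - p13" "- p14 + R" "s1 + s4 - p14" "- s3 + p23 + p34 - R" "- s1 - s2 + R" "s2 +
                      s3 + s4 - p23 - p24 - p34 + R" "s3 - p13 - p23 - p34 + 2 * R" "- s4 + p14 + p24 + p34 -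
                      2 * R" "s1 + p23 + p24 - 2 * R" "- s1 - s3 + p13 - p24 + R"];
                (use c1(2) c2(1) c4(1) c4(2) c5 f13 f14 f23_14 f24_3 f34_12 in linarith | simp add:
                    algebra_simps))
          qed
        next
          case 3 note c4 = this
          consider "s1 + s2 + s3 + s4 \<le> p34 + R" "s2 + s3 + s4 + R \<le> p23 + p24 + p34" | "p34 + R \<le>
              s1 + s2 + s3 + s4" "2 * R \<le> s1 + p23 + p24" | "p23 + p24 + p34 \<le> s2 + s3 + s4 + R" "s1 +
              p23 + p24 \<le> 2 * R" by linarith
          then show ?thesis
          proof cases
            case 1 note c5 = this
            show ?thesis
              by (rule nonneg_combination10[OF hit13 hit23 hit14 hit24 hit34 loop2 two par23 par24 dthree1
                  linear,
                  of "s1 + s3 - p13" "- p14 + R" "s1 + s4 - p14" "- p13 + R" "s3 + s4 - p34" "- s1 - s2 - s3 -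
                      s4 + p34 + R" "- s2 - s3 - s4 + p23 + p24 + p34 - R" "s2 + s3 + p14 - p23 - R" "s2 + s4
                      + p13 - p24 - R" "- p34 + R"];
                (use c2(2) c4(1) c5(1) c5(2) f12_34 f13 f14 f23_14 f24_13 f34 in linarith | simp add:
                    algebra_simps))
          next
            case 2 note c5 = this
            consider "s4 + p13 + p23 \<le> s3 + p14 + p24" "p13 + p34 \<le> s1 + s3 + p24" | "s3 + p14 + p24
                \<le> s4 + p13 + p23" "p14 + p34 \<le> s1 + s4 + p23" | "s1 + s3 + p24 \<le> p13 + p34" "s1 +
                s4 + p23 \<le> p14 + p34" by linarith
            then show ?thesis
            proof cases
              case 1 note c6 = this
              show ?thesis
                by (rule nonneg_combination10[OF hit13 hit23 hit14 hit24 hit34 hit234 two par23 par34 dthree1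
                    linear,
                    of "s1 + s3 - p13" "- p14 + R" "s1 + s4 - p14" "- p13 + R" "- s1 - s2 + R" "s2 + s4 + p13
                        - p24 - R" "- s3 + p13 + p23 + p34 - 2 * R" "s3 - s4 - p13 + p14 - p23 + p24" "s1 + s3
                        - p13 + p24 - p34" "- s1 - s3 + p13 - p24 + R"];
                  (use c1(2) c4(1) c4(2) c6(1) c6(2) f13 f14 f23_14 f24_13 f34_12 in linarith | simp add:
                      algebra_simps))
            next
              case 2 note c6 = this
              show ?thesis
                by (rule nonneg_combination10[OF hit13 hit23 hit14 hit24 hit34 hit234 two par24 par34 dthree1
                    linear,
                    of "s1 + s3 - p13" "- p14 + R" "s1 + s4 - p14" "- p13 + R" "- s1 - s2 + R" "s2 + s3 + p14
                        - p23 - R" "- s4 + p14 + p24 + p34 - 2 * R" "- s3 + s4 + p13 - p14 + p23 - p24" "s1 +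
                        s4 - p14 + p23 - p34" "- s1 - s4 + p14 - p23 + R"];
                  (use c2(1) c2(2) c3 c6(1) c6(2) f13 f14 f23_14 f24_13 f34_12 in linarith | simp add:
                      algebra_simps))
            next
              case 3 note c6 = this
              show ?thesis
                by (rule nonneg_combination10[OF hit13 hit23 hit14 hit24 hit34 hit234 two par23 par24 dthree1
                    linear,
                    of "s1 + s3 - p13" "- p14 + R" "s1 + s4 - p14" "- p13 + R" "- s1 - s2 + R" "s1 + s2 + s3 +
                        s4 - p34 - R" "s1 + p23 + p24 - 2 * R" "- s1 - s4 + p14 - p23 + p34" "- s1 - s3 + p13
                        - p24 + p34" "- p34 + R"];
                  (use c5(1) c5(2) c6(1) c6(2) f12_34 f13 f14 f23_14 f24_13 f34_12 in linarith | simp add: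
                      algebra_simps))
            qed
          next
            case 3 note c5 = this
            show ?thesis
              by (rule nonneg_combination10[OF hit13 hit23 hit14 hit24 hit34 hit234 loop2 par23 par24 dthree1
                  linear,
                  of "s1 + s3 - p13" "- p14 + R" "s1 + s4 - p14" "- p13 + R" "- s2 + p23 + p24 - R" "s2 + s3 +
                      s4 - p23 - p24 - p34 + R" "- s1 - p23 - p24 + 2 * R" "- s4 + p14 + p24 + p34 - 2 * R" "-
                      s3 + p13 + p23 + p34 - 2 * R" "- p34 + R"];
                (use c2(1) c4(2) c5(1) c5(2) f12_34 f13 f14 f23_14 f24_13 f34_2 in linarith | simp add:
                    algebra_simps))
          qed
        qed
      qed
    next
      case 3 note c2 = this
      consider "p14 + R \<le> s1 + s4 + p23" | "s1 + s4 + p23 \<le> p14 + R" by linarith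
      then show ?thesis
      proof cases
        case 1 note c3 = this
        consider "p24 + R \<le> s2 + s4 + p13" | "s2 + s4 + p13 \<le> p24 + R" by linarith
        then show ?thesis
        proof cases
          case 1 note c4 = this
          consider "s1 + s2 + s3 + s4 \<le> p34 + R" | "p34 + R \<le> s1 + s2 + s3 + s4" by linarith
          then show ?thesis
          proof cases
            case 1 note c5 = this
            show ?thesis
              by (rule nonneg_combination10[OF hit13 hit23 hit14 hit24 hit34 loop4 two par14 par24 dthree3
                  linear,
                  of "s1 + s3 - p13" "s2 + s3 - p23" "- p23 + R" "- p13 + R" "s3 + s4 - p34" "- p34 + R" "- s4
                      + p14 + p24 - R" "s1 + s4 - p14 + p23 - R" "s2 + s4 + p13 - p24 - R" "- s1 - s2 - s3 -
                      s4 + p34 + R"];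
                (use c3 c4 c5 f12_4 f12_34 f13 f14_23 f23 f24_13 f34 in linarith | simp add: algebra_simps))
          next
            case 2 note c5 = this
            consider "s2 + s3 + p14 \<le> p23 + p34" "s1 + s3 + p24 \<le> p13 + p34" | "p23 + p34 \<le> s2 +
                s3 + p14" "s1 + p23 + p24 \<le> s2 + p13 + p14" | "p13 + p34 \<le> s1 + s3 + p24" "s2 + p13 +
                p14 \<le> s1 + p23 + p24" by linarith
            then show ?thesis
            proof cases
              case 1 note c6 = this
              show ?thesis
                by (rule nonneg_combination10[OF hit13 hit23 hit14 hit24 hit34 loop4 two par14 par24 dtwo4
                    linear,
                    of "s1 + s3 - p13" "s2 + s3 - p23" "- p23 + R" "- p13 + R" "- s1 - s2 + R" "- p34 + R" "-
                        s4 + p14 + p24 - R" "- s2 - s3 - p14 + p23 + p34" "- s1 - s3 + p13 - p24 + p34" "s1 +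
                        s2 + s3 + s4 - p34 - R"];
                  (use c5 c6(1) c6(2) f12_4 f12_34 f13 f14_23 f23 f24_13 f34_12 in linarith | simp add:
                      algebra_simps))
            next
              case 2 note c6 = this
              show ?thesis
                by (rule nonneg_combination10[OF hit13 hit23 hit14 hit24 hit34 loop4 two par24 par34 dtwo4
                    linear,
                    of "s1 + s3 - p13" "s2 + s3 - p23" "- p23 + R" "- p13 + R" "- s1 - s2 + R" "- s2 - s3 -
                        p14 + p23 + R" "- s2 - s3 - s4 + p23 + p24 + p34 - R" "- s1 + s2 + p13 + p14 - p23 -
                        p24" "s2 + s3 + p14 - p23 - p34" "s1 + s4 - p14 + p23 - R"];
                  (use c2(1) c2(2) c3 c6(1) c6(2) f13 f14_23 f23 f24_13 f34_12 in linarith | simp add: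
                      algebra_simps))
            next
              case 3 note c6 = this
              show ?thesis
                by (rule nonneg_combination10[OF hit13 hit23 hit14 hit24 hit34 loop4 two par14 par34 dtwo4
                    linear,
                    of "s1 + s3 - p13" "s2 + s3 - p23" "- p23 + R" "- p13 + R" "- s1 - s2 + R" "- s1 - s3 +
                        p13 - p24 + R" "- s1 - s3 - s4 + p13 + p14 + p34 - R" "s1 - s2 - p13 - p14 + p23 +
                        p24" "s1 + s3 - p13 + p24 - p34" "s2 + s4 + p13 - p24 - R"];
                  (use c1(1) c1(2) c4 c6(1) c6(2) f13 f14_23 f23 f24_13 f34_12 in linarith | simp add:
                      algebra_simps))
            qed
          qed
        next
          case 2 note c4 = this
          consider "s1 + s2 + s3 + s4 \<le> p34 + R" | "p34 + R \<le> s1 + s2 + s3 + s4" by linarith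
          then show ?thesis
          proof cases
            case 1 note c5 = this
            consider "p13 + p34 \<le> s1 + s3 + p24" | "s1 + s3 + p24 \<le> p13 + p34" by linarith
            then show ?thesis
            proof cases
              case 1 note c6 = this
              show ?thesis
                by (rule nonneg_combination10[OF hit13 hit23 hit14 hit24 hit34 loop4 loop1 two par14 dthree2
                    linear,
                    of "s1 + s3 - p13" "s2 + s3 - p23" "- p23 + R" "s2 + s4 - p24" "s3 + s4 - p34" "- s1 - s3
                        + p13 - p24 + R" "- s1 - s2 - s3 - s4 + p34 + R" "- s1 - s3 - s4 + p13 + p14 + p34 -
                        R" "s1 + s4 - p14 + p23 - R" "s1 + s3 - p13 + p24 - p34"];
                  (use c1(1) c1(2) c3 c5 c6 f13 f14_23 f23 f24 f34 in linarith | simp add: algebra_simps))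
            next
              case 2 note c6 = this
              show ?thesis
                by (rule nonneg_combination10[OF hit13 hit23 hit14 hit24 hit34 loop4 loop1 two par14 dthree3
                    linear,
                    of "s1 + s3 - p13" "s2 + s3 - p23" "- p23 + R" "s2 + s4 - p24" "s3 + s4 - p34" "- p34 + R"
                        "- s2 - s4 - p13 + p24 + R" "- s4 + p14 + p24 - R" "s1 + s4 - p14 + p23 - R" "- s1 -
                        s3 + p13 - p24 + p34"];
                  (use c3 c4 c6 f12_4 f12_34 f13 f14_23 f23 f24 f34 in linarith | simp add: algebra_simps))
            qed
          next
            case 2 note c5 = this
            show ?thesis
              by (rule nonneg_combination10[OF hit13 hit23 hit14 hit24 hit34 loop4 two par14 par34 dthree2
                  linear,
                  of "s1 + s3 - p13" "s2 + s3 - p23" "- p23 + R" "s2 + s4 - p24" "- s1 - s2 + R" "- s1 - s3 +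
                      p13 - p24 + R" "- s1 - s3 - s4 + p13 + p14 + p34 - R" "s1 + s4 - p14 + p23 - R" "s1 + s2
                      + s3 + s4 - p34 - R" "- s2 - s4 - p13 + p24 + R"];
                (use c1(1) c1(2) c3 c4 c5 f13 f14_23 f23 f24 f34_12 in linarith | simp add: algebra_simps))
          qed
        qed
      next
        case 2 note c3 = this
        consider "s2 + s4 + p13 \<le> p24 + R" | "p24 + R \<le> s2 + s4 + p13" by linarith
        then show ?thesis
        proof cases
          case 1 note c4 = this
          consider "s1 + s2 + s3 + s4 \<le> p34 + R" | "p34 + R \<le> s1 + s2 + s3 + s4" by linarith
          then show ?thesis
          proof cases
            case 1 note c5 = this
            consider "p13 + p23 + p34 \<le> s3 + 2 * R" "s2 + p13 + p14 \<le> 2 * R" "s1 + p23 + p24 \<le> 2 *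
                R" | "s3 + 2 * R \<le> p13 + p23 + p34" "s2 + s3 + p14 \<le> p23 + p34" "s1 + s3 + p24 \<le>
                p13 + p34" | "2 * R \<le> s2 + p13 + p14" "p23 + p34 \<le> s2 + s3 + p14" "s1 + p23 + p24
                \<le> s2 + p13 + p14" | "2 * R \<le> s1 + p23 + p24" "p13 + p34 \<le> s1 + s3 + p24" "s2 + p13
                + p14 \<le> s1 + p23 + p24" by linarith
            then show ?thesis
            proof cases
              case 1 note c6 = this
              consider "p13 + p14 + p23 + p24 + p34 \<le> s3 + s4 + 3 * R" | "s3 + s4 + 3 * R \<le> p13 + p14
                  + p23 + p24 + p34" by linarith
              then show ?thesis
              proof cases
                case 1 note c7 = this
                show ?thesis
                  by (rule nonneg_combination10[OF hit13 hit23 hit14 hit24 hit34 loop4 loop3 loop2 loop1 three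
                      linear,
                      of "s1 + s3 - p13" "s2 + s3 - p23" "s1 + s4 - p14" "s2 + s4 - p24" "s3 + s4 - p34" "- s3
                          + p13 + p23 - R" "- s4 + p14 + p24 - R" "- s1 - s3 - s4 + p13 + p14 + p34 - R" "- s2
                          - s3 - s4 + p23 + p24 + p34 - R" "s3 + s4 - p13 - p14 - p23 - p24 - p34 + 3 * R"];
                    (use c1(1) c2(1) c7 f12_3 f12_4 f13 f14 f23 f24 f34 in linarith | simp add:
                        algebra_simps))
              next
                case 2 note c7 = this
                show ?thesis
                  by (rule nonneg_combination10[OF hit13 hit23 hit14 hit24 hit34 loop4 loop3 loop2 loop1
                      dthree4 linear,
                      of "s1 + s3 - p13" "s2 + s3 - p23" "s1 + s4 - p14" "s2 + s4 - p24" "s3 + s4 - p34" "- s3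
                          + p13 + p23 - R" "s3 - p13 - p23 - p34 + 2 * R" "- s1 - p23 - p24 + 2 * R" "- s2 -
                          p13 - p14 + 2 * R" "- s3 - s4 + p13 + p14 + p23 + p24 + p34 - 3 * R"];
                    (use c6(1) c6(2) c6(3) c7 f12_3 f13 f14 f23 f24 f34 in linarith | simp add:
                        algebra_simps))
              qed
            next
              case 2 note c6 = this
              consider "s3 + p14 + p24 + R \<le> s4 + p13 + p23 + p34" | "s4 + p13 + p23 + p34 \<le> s3 + p14
                  + p24 + R" by linarith
              then show ?thesis
              proof cases
                case 1 note c7 = this
                show ?thesis
                  by (rule nonneg_combination10[OF hit13 hit23 hit14 hit24 hit34 loop4 loop2 loop1 two dthree3
                      linear,
                      of "s1 + s3 - p13" "s2 + s3 - p23" "s1 + s4 - p14" "s2 + s4 - p24" "s3 + s4 - p34" "-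
                          p34 + R" "- s1 - s4 + p14 - p23 + R" "- s2 - s4 - p13 + p24 + R" "- s4 + p14 + p24 -
                          R" "- s3 + s4 + p13 - p14 + p23 - p24 + p34 - R"];
                    (use c3 c4 c7 f12_4 f12_34 f13 f14 f23 f24 f34 in linarith | simp add: algebra_simps))
              next
                case 2 note c7 = this
                show ?thesis
                  by (rule nonneg_combination10[OF hit13 hit23 hit14 hit24 hit34 loop4 loop2 loop1 two dthree4
                      linear,
                      of "s1 + s3 - p13" "s2 + s3 - p23" "s1 + s4 - p14" "s2 + s4 - p24" "s3 + s4 - p34" "-
                          p34 + R" "- s1 - s3 + p13 - p24 + p34" "- s2 - s3 - p14 + p23 + p34" "- s3 + p13 +
                          p23 + p34 - 2 * R" "s3 - s4 - p13 + p14 - p23 + p24 - p34 + R"];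
                    (use c6(1) c6(2) c6(3) c7 f12_34 f13 f14 f23 f24 f34 in linarith | simp add:
                        algebra_simps))
              qed
            next
              case 3 note c6 = this
              consider "2 * s2 + s3 + s4 + p13 + p14 \<le> p23 + p24 + p34 + R" | "p23 + p24 + p34 + R \<le> 2
                  * s2 + s3 + s4 + p13 + p14" by linarith
              then show ?thesis
              proof cases
                case 1 note c7 = this
                show ?thesis
                  by (rule nonneg_combination10[OF hit13 hit23 hit14 hit24 hit34 loop4 loop3 loop2 two dthree4
                      linear,
                      of "s1 + s3 - p13" "s2 + s3 - p23" "s1 + s4 - p14" "s2 + s4 - p24" "s3 + s4 - p34" "- s2
                          - s3 - p14 + p23 + R" "s2 + s3 + p14 - p23 - p34" "- s1 + s2 + p13 + p14 - p23 -
                          p24" "s2 + p13 + p14 - 2 * R" "- 2 * s2 - s3 - s4 - p13 - p14 + p23 + p24 + p34 +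
                          R"];
                    (use c2(2) c6(1) c6(2) c6(3) c7 f13 f14 f23 f24 f34 in linarith | simp add:
                        algebra_simps))
              next
                case 2 note c7 = this
                show ?thesis
                  by (rule nonneg_combination10[OF hit13 hit23 hit14 hit24 hit34 loop4 loop3 loop2 two dthree1
                      linear,
                      of "s1 + s3 - p13" "s2 + s3 - p23" "s1 + s4 - p14" "s2 + s4 - p24" "s3 + s4 - p34" "- s2
                          - s3 - p14 + p23 + R" "- s2 - s4 - p13 + p24 + R" "- s1 - s2 - s3 - s4 + p34 + R" "-
                          s2 - s3 - s4 + p23 + p24 + p34 - R" "2 * s2 + s3 + s4 + p13 + p14 - p23 - p24 - p34
                          - R"];
                    (use c2(1) c2(2) c4 c5 c7 f13 f14 f23 f24 f34 in linarith | simp add: algebra_simps))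
              qed
            next
              case 4 note c6 = this
              consider "2 * s1 + s3 + s4 + p23 + p24 \<le> p13 + p14 + p34 + R" | "p13 + p14 + p34 + R \<le> 2
                  * s1 + s3 + s4 + p23 + p24" by linarith
              then show ?thesis
              proof cases
                case 1 note c7 = this
                show ?thesis
                  by (rule nonneg_combination10[OF hit13 hit23 hit14 hit24 hit34 loop4 loop3 loop1 two dthree4
                      linear,
                      of "s1 + s3 - p13" "s2 + s3 - p23" "s1 + s4 - p14" "s2 + s4 - p24" "s3 + s4 - p34" "- s1
                          - s3 + p13 - p24 + R" "s1 + s3 - p13 + p24 - p34" "s1 - s2 - p13 - p14 + p23 + p24"
                          "s1 + p23 + p24 - 2 * R" "- 2 * s1 - s3 - s4 + p13 + p14 - p23 - p24 + p34 + R"];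
                    (use c1(2) c6(1) c6(2) c6(3) c7 f13 f14 f23 f24 f34 in linarith | simp add:
                        algebra_simps))
              next
                case 2 note c7 = this
                show ?thesis
                  by (rule nonneg_combination10[OF hit13 hit23 hit14 hit24 hit34 loop4 loop3 loop1 two dthree2
                      linear,
                      of "s1 + s3 - p13" "s2 + s3 - p23" "s1 + s4 - p14" "s2 + s4 - p24" "s3 + s4 - p34" "- s1
                          - s3 + p13 - p24 + R" "- s1 - s4 + p14 - p23 + R" "- s1 - s2 - s3 - s4 + p34 + R" "-
                          s1 - s3 - s4 + p13 + p14 + p34 - R" "2 * s1 + s3 + s4 - p13 - p14 + p23 + p24 - p34
                          - R"];
                    (use c1(1) c1(2) c3 c5 c7 f13 f14 f23 f24 f34 in linarith | simp add: algebra_simps))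
              qed
            qed
          next
            case 2 note c5 = this
            consider "s1 + p23 + p24 \<le> s2 + p13 + p14" | "s2 + p13 + p14 \<le> s1 + p23 + p24" by linarith
            then show ?thesis
            proof cases
              case 1 note c6 = this
              show ?thesis
                by (rule nonneg_combination10[OF hit13 hit23 hit14 hit24 hit34 loop4 loop3 two par34 dthree1
                    linear,
                    of "s1 + s3 - p13" "s2 + s3 - p23" "s1 + s4 - p14" "s2 + s4 - p24" "- s1 - s2 + R" "- s2 -
                        s3 - p14 + p23 + R" "- s2 - s4 - p13 + p24 + R" "- s2 - s3 - s4 + p23 + p24 + p34 - R"
                        "s1 + s2 + s3 + s4 - p34 - R" "- s1 + s2 + p13 + p14 - p23 - p24"];
                  (use c2(1) c2(2) c4 c5 c6 f13 f14 f23 f24 f34_12 in linarith | simp add: algebra_simps))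
            next
              case 2 note c6 = this
              show ?thesis
                by (rule nonneg_combination10[OF hit13 hit23 hit14 hit24 hit34 loop4 loop3 two par34 dthree2
                    linear,
                    of "s1 + s3 - p13" "s2 + s3 - p23" "s1 + s4 - p14" "s2 + s4 - p24" "- s1 - s2 + R" "- s1 -
                        s3 + p13 - p24 + R" "- s1 - s4 + p14 - p23 + R" "- s1 - s3 - s4 + p13 + p14 + p34 - R"
                        "s1 + s2 + s3 + s4 - p34 - R" "s1 - s2 - p13 - p14 + p23 + p24"];
                  (use c1(1) c1(2) c3 c5 c6 f13 f14 f23 f24 f34_12 in linarith | simp add: algebra_simps))
            qed
          qed
        next
          case 2 note c4 = this
          consider "s1 + s2 + s3 + s4 \<le> p34 + R" | "p34 + R \<le> s1 + s2 + s3 + s4" by linarith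
          then show ?thesis
          proof cases
            case 1 note c5 = this
            consider "p23 + p34 \<le> s2 + s3 + p14" | "s2 + s3 + p14 \<le> p23 + p34" by linarith
            then show ?thesis
            proof cases
              case 1 note c6 = this
              show ?thesis
                by (rule nonneg_combination10[OF hit13 hit23 hit14 hit24 hit34 loop4 loop2 two par24 dthree1
                    linear,
                    of "s1 + s3 - p13" "s2 + s3 - p23" "s1 + s4 - p14" "- p13 + R" "s3 + s4 - p34" "- s2 - s3
                        - p14 + p23 + R" "- s1 - s2 - s3 - s4 + p34 + R" "- s2 - s3 - s4 + p23 + p24 + p34 -
                        R" "s2 + s4 + p13 - p24 - R" "s2 + s3 + p14 - p23 - p34"];
                  (use c2(1) c2(2) c4 c5 c6 f13 f14 f23 f24_13 f34 in linarith | simp add: algebra_simps))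
            next
              case 2 note c6 = this
              show ?thesis
                by (rule nonneg_combination10[OF hit13 hit23 hit14 hit24 hit34 loop4 loop2 two par24 dthree3
                    linear,
                    of "s1 + s3 - p13" "s2 + s3 - p23" "s1 + s4 - p14" "- p13 + R" "s3 + s4 - p34" "- p34 + R"
                        "- s1 - s4 + p14 - p23 + R" "- s4 + p14 + p24 - R" "s2 + s4 + p13 - p24 - R" "- s2 -
                        s3 - p14 + p23 + p34"];
                  (use c3 c4 c6 f12_4 f12_34 f13 f14 f23 f24_13 f34 in linarith | simp add: algebra_simps))
            qed
          next
            case 2 note c5 = this
            show ?thesis
              by (rule nonneg_combination10[OF hit13 hit23 hit14 hit24 hit34 loop4 two par24 par34 dthree1
                  linear,
                  of "s1 + s3 - p13" "s2 + s3 - p23" "s1 + s4 - p14" "- p13 + R" "- s1 - s2 + R" "- s2 - s3 -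
                      p14 + p23 + R" "- s2 - s3 - s4 + p23 + p24 + p34 - R" "s2 + s4 + p13 - p24 - R" "s1 + s2
                      + s3 + s4 - p34 - R" "- s1 - s4 + p14 - p23 + R"];
                (use c2(1) c2(2) c3 c4 c5 f13 f14 f23 f24_13 f34_12 in linarith | simp add: algebra_simps))
          qed
        qed
      qed
    qed
  next
    case 3 note c1 = this
    consider "p23 + R \<le> s2 + s3 + p14" | "s2 + s3 + p14 \<le> p23 + R" by linarith
    then show ?thesis
    proof cases
      case 1 note c2 = this
      consider "s3 + 2 * R \<le> p13 + p23 + p34" "p14 + R \<le> s1 + s4 + p23" | "p13 + p23 + p34 \<le> s3 +
          2 * R" "p13 + p14 + p34 \<le> s1 + s3 + s4 + R" | "s1 + s4 + p23 \<le> p14 + R" "s1 + s3 + s4 + R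
          \<le> p13 + p14 + p34" by linarith
      then show ?thesis
      proof cases
        case 1 note c3 = this
        consider "s2 + s4 + p13 \<le> p24 + R" | "p24 + R \<le> s2 + s4 + p13" by linarith
        then show ?thesis
        proof cases
          case 1 note c4 = this
          show ?thesis
            by (rule nonneg_combination10[OF hit13 hit23 hit14 hit24 hit34 hit134 two par13 par34 dtwo3
                linear,
                of "- p24 + R" "- p14 + R" "- p23 + R" "s2 + s4 - p24" "- s1 - s2 + R" "s1 + s4 - p14 + p23 -
                    R" "- s3 + p13 + p23 + p34 - 2 * R" "- s2 - s4 - p13 + p24 + R" "- p34 + R" "s2 + s3 + p14
                    - p23 - R"];
              (use c2 c3(1) c3(2) c4 f12_34 f13_24 f14_23 f23_14 f24 f34_12 in linarith | simp add:
                  algebra_simps))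
        next
          case 2 note c4 = this
          consider "s3 + p14 + p24 \<le> s4 + p13 + p23" | "s4 + p13 + p23 \<le> s3 + p14 + p24" by linarith
          then show ?thesis
          proof cases
            case 1 note c5 = this
            show ?thesis
              by (rule nonneg_combination10[OF hit13 hit23 hit14 hit24 hit34 hit134 hit234 two par34 dtwo4
                  linear,
                  of "- p24 + R" "- p14 + R" "- p23 + R" "- p13 + R" "- s1 - s2 + R" "s1 + s3 - p13 + p24 - R"
                      "s2 + s3 + p14 - p23 - R" "- s4 + p14 + p24 + p34 - 2 * R" "- p34 + R" "- s3 + s4 + p13
                      - p14 + p23 - p24"];
                (use c1(1) c1(2) c2 c5 f12_34 f13_24 f14_23 f23_14 f24_13 f34_12 in linarith | simp add:
                    algebra_simps))
          next
            case 2 note c5 = this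
            show ?thesis
              by (rule nonneg_combination10[OF hit13 hit23 hit14 hit24 hit34 hit134 hit234 two par34 dtwo3
                  linear,
                  of "- p24 + R" "- p14 + R" "- p23 + R" "- p13 + R" "- s1 - s2 + R" "s1 + s4 - p14 + p23 - R"
                      "s2 + s4 + p13 - p24 - R" "- s3 + p13 + p23 + p34 - 2 * R" "- p34 + R" "s3 - s4 - p13 +
                      p14 - p23 + p24"];
                (use c3(1) c3(2) c4 c5 f12_34 f13_24 f14_23 f23_14 f24_13 f34_12 in linarith | simp add:
                    algebra_simps))
          qed
        qed
      next
        case 2 note c3 = this
        consider "s2 + s3 + s4 + R \<le> p23 + p24 + p34" | "p23 + p24 + p34 \<le> s2 + s3 + s4 + R" by
            linarith
        then show ?thesis
        proof cases
          case 1 note c4 = this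
          show ?thesis
            by (rule nonneg_combination10[OF hit13 hit23 hit14 hit24 hit34 hit134 loop3 par13 par34 dtwo3
                linear,
                of "- p24 + R" "- p14 + R" "- s3 + p13 + p34 - R" "s2 + s4 - p24" "- s1 - s2 + R" "s1 + s3 +
                    s4 - p13 - p14 - p34 + R" "s3 - p13 - p23 - p34 + 2 * R" "- s2 - s3 - s4 + p23 + p24 + p34
                    - R" "- s3 + p13 + p23 - R" "s2 + s3 + p14 - p23 - R"];
              (use c2 c3(1) c3(2) c4 f12_3 f13_24 f14_3 f23_14 f24 f34_12 in linarith | simp add:
                  algebra_simps))
        next
          case 2 note c4 = this
          show ?thesis
            by (rule nonneg_combination10[OF hit13 hit23 hit14 hit24 hit34 hit134 hit234 loop3 par34 dtwo3
                linear,
                of "- p24 + R" "- p14 + R" "- s3 + p13 + p34 - R" "- s3 + p23 + p34 - R" "- s1 - s2 + R" "s1 +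
                    s3 + s4 - p13 - p14 - p34 + R" "s2 + s3 + s4 - p23 - p24 - p34 + R" "s3 - p13 - p23 - p34
                    + 2 * R" "- s3 + p13 + p23 - R" "- s4 + p14 + p24 + p34 - 2 * R"];
              (use c1(1) c3(1) c3(2) c4 f12_3 f13_24 f14_3 f23_14 f24_3 f34_12 in linarith | simp add:
                  algebra_simps))
        qed
      next
        case 3 note c3 = this
        consider "s2 + s3 + s4 + R \<le> p23 + p24 + p34" "s2 + s4 + p13 \<le> p24 + R" | "p23 + p24 + p34
            \<le> s2 + s3 + s4 + R" "p13 + p23 + p34 \<le> s3 + 2 * R" | "p24 + R \<le> s2 + s4 + p13" "s3 + 2
            * R \<le> p13 + p23 + p34" by linarith
        then show ?thesis
        proof cases
          case 1 note c4 = this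
          consider "p34 + R \<le> s1 + s2 + s3 + s4" | "s1 + s2 + s3 + s4 \<le> p34 + R" by linarith
          then show ?thesis
          proof cases
            case 1 note c5 = this
            consider "s1 + s4 + p23 \<le> p14 + p34" "s2 + s4 + p13 \<le> p24 + p34" | "p14 + p34 \<le> s1 +
                s4 + p23" "s2 + p13 + p14 \<le> s1 + p23 + p24" | "p24 + p34 \<le> s2 + s4 + p13" "s1 + p23 +
                p24 \<le> s2 + p13 + p14" by linarith
            then show ?thesis
            proof cases
              case 1 note c6 = this
              show ?thesis
                by (rule nonneg_combination10[OF hit13 hit23 hit14 hit24 hit34 loop3 two par13 par23 dtwo3
                    linear,
                    of "- p24 + R" "- p14 + R" "s1 + s4 - p14" "s2 + s4 - p24" "- s1 - s2 + R" "- p34 + R" "-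
                        s3 + p13 + p23 - R" "- s2 - s4 - p13 + p24 + p34" "- s1 - s4 + p14 - p23 + p34" "s1 +
                        s2 + s3 + s4 - p34 - R"];
                  (use c5 c6(1) c6(2) f12_3 f12_34 f13_24 f14 f23_14 f24 f34_12 in linarith | simp add:
                      algebra_simps))
            next
              case 2 note c6 = this
              show ?thesis
                by (rule nonneg_combination10[OF hit13 hit23 hit14 hit24 hit34 loop3 two par13 par34 dtwo3
                    linear,
                    of "- p24 + R" "- p14 + R" "s1 + s4 - p14" "s2 + s4 - p24" "- s1 - s2 + R" "- s1 - s4 +
                        p14 - p23 + R" "- s1 - s3 - s4 + p13 + p14 + p34 - R" "s1 - s2 - p13 - p14 + p23 +
                        p24" "s1 + s4 - p14 + p23 - p34" "s2 + s3 + p14 - p23 - R"];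
                  (use c2 c3(1) c3(2) c6(1) c6(2) f13_24 f14 f23_14 f24 f34_12 in linarith | simp add:
                      algebra_simps))
            next
              case 3 note c6 = this
              show ?thesis
                by (rule nonneg_combination10[OF hit13 hit23 hit14 hit24 hit34 loop3 two par23 par34 dtwo3
                    linear,
                    of "- p24 + R" "- p14 + R" "s1 + s4 - p14" "s2 + s4 - p24" "- s1 - s2 + R" "- s2 - s4 -
                        p13 + p24 + R" "- s2 - s3 - s4 + p23 + p24 + p34 - R" "- s1 + s2 + p13 + p14 - p23 -
                        p24" "s2 + s4 + p13 - p24 - p34" "s1 + s3 - p13 + p24 - R"];
                  (use c1(2) c4(1) c4(2) c6(1) c6(2) f13_24 f14 f23_14 f24 f34_12 in linarith | simp add:
                      algebra_simps))
            qed
          next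
            case 2 note c5 = this
            show ?thesis
              by (rule nonneg_combination10[OF hit13 hit23 hit14 hit24 hit34 loop3 two par13 par23 dthree4
                  linear,
                  of "- p24 + R" "- p14 + R" "s1 + s4 - p14" "s2 + s4 - p24" "s3 + s4 - p34" "- p34 + R" "- s3
                      + p13 + p23 - R" "s1 + s3 - p13 + p24 - R" "s2 + s3 + p14 - p23 - R" "- s1 - s2 - s3 -
                      s4 + p34 + R"];
                (use c1(2) c2 c5 f12_3 f12_34 f13_24 f14 f23_14 f24 f34 in linarith | simp add:
                    algebra_simps))
          qed
        next
          case 2 note c4 = this
          show ?thesis
            by (rule nonneg_combination10[OF hit13 hit23 hit14 hit24 hit34 hit234 loop3 par23 par34 dtwo3
                linear,
                of "- p24 + R" "- p14 + R" "s1 + s4 - p14" "- s3 + p23 + p34 - R" "- s1 - s2 + R" "s2 + s3 +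
                    s4 - p23 - p24 - p34 + R" "s3 - p13 - p23 - p34 + 2 * R" "- s1 - s3 - s4 + p13 + p14 + p34
                    - R" "- s3 + p13 + p23 - R" "s1 + s3 - p13 + p24 - R"];
              (use c1(2) c3(2) c4(1) c4(2) f12_3 f13_24 f14 f23_14 f24_3 f34_12 in linarith | simp add:
                  algebra_simps))
        next
          case 3 note c4 = this
          show ?thesis
            by (rule nonneg_combination10[OF hit13 hit23 hit14 hit24 hit34 hit234 two par23 par34 dtwo3
                linear,
                of "- p24 + R" "- p14 + R" "s1 + s4 - p14" "- p13 + R" "- s1 - s2 + R" "s2 + s4 + p13 - p24 -
                    R" "- s3 + p13 + p23 + p34 - 2 * R" "- s1 - s4 + p14 - p23 + R" "- p34 + R" "s1 + s3 - p13
                    + p24 - R"];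
              (use c1(2) c3(1) c4(1) c4(2) f12_34 f13_24 f14 f23_14 f24_13 f34_12 in linarith | simp add:
                  algebra_simps))
        qed
      qed
    next
      case 2 note c2 = this
      consider "s3 + 2 * R \<le> p13 + p23 + p34" "p14 + R \<le> s1 + s4 + p23" | "p13 + p23 + p34 \<le> s3 +
          2 * R" "p13 + p14 + p34 \<le> s1 + s3 + s4 + R" | "s1 + s4 + p23 \<le> p14 + R" "s1 + s3 + s4 + R
          \<le> p13 + p14 + p34" by linarith
      then show ?thesis
      proof cases
        case 1 note c3 = this
        consider "s2 + s4 + p13 \<le> p24 + R" | "p24 + R \<le> s2 + s4 + p13" by linarith
        then show ?thesis
        proof cases
          case 1 note c4 = this
          consider "s1 + s3 + s4 + R \<le> p13 + p14 + p34" "s1 + s2 + s3 + s4 \<le> p34 + R" | "p13 + p14 +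
              p34 \<le> s1 + s3 + s4 + R" "s2 + p13 + p14 \<le> 2 * R" | "p34 + R \<le> s1 + s2 + s3 + s4" "2
              * R \<le> s2 + p13 + p14" by linarith
          then show ?thesis
          proof cases
            case 1 note c5 = this
            show ?thesis
              by (rule nonneg_combination10[OF hit13 hit23 hit14 hit24 hit34 loop1 two par13 par14 dthree2
                  linear,
                  of "- p24 + R" "s2 + s3 - p23" "- p23 + R" "s2 + s4 - p24" "s3 + s4 - p34" "- s1 - s2 - s3 -
                      s4 + p34 + R" "- s1 - s3 - s4 + p13 + p14 + p34 - R" "s1 + s3 - p13 + p24 - R" "s1 + s4
                      - p14 + p23 - R" "- p34 + R"];
                (use c1(2) c3(2) c5(1) c5(2) f12_34 f13_24 f14_23 f23 f24 f34 in linarith | simp add: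
                    algebra_simps))
          next
            case 2 note c5 = this
            show ?thesis
              by (rule nonneg_combination10[OF hit13 hit23 hit14 hit24 hit34 hit134 loop1 par13 par14 dthree2
                  linear,
                  of "- p24 + R" "s2 + s3 - p23" "- p23 + R" "s2 + s4 - p24" "- s1 + p13 + p14 - R" "s1 + s3 +
                      s4 - p13 - p14 - p34 + R" "- s2 - p13 - p14 + 2 * R" "- s4 + p14 + p24 + p34 - 2 * R" "-
                      s3 + p13 + p23 + p34 - 2 * R" "- p34 + R"];
                (use c1(1) c3(1) c5(1) c5(2) f12_34 f13_24 f14_23 f23 f24 f34_1 in linarith | simp add:
                    algebra_simps))
          next
            case 3 note c5 = this
            consider "p24 + p34 \<le> s2 + s4 + p13" "s3 + p14 + p24 \<le> s4 + p13 + p23" | "s2 + s4 + p13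
                \<le> p24 + p34" "s2 + s3 + p14 \<le> p23 + p34" | "s4 + p13 + p23 \<le> s3 + p14 + p24" "p23
                + p34 \<le> s2 + s3 + p14" by linarith
            then show ?thesis
            proof cases
              case 1 note c6 = this
              show ?thesis
                by (rule nonneg_combination10[OF hit13 hit23 hit14 hit24 hit34 hit134 two par14 par34 dthree2
                    linear,
                    of "- p24 + R" "s2 + s3 - p23" "- p23 + R" "s2 + s4 - p24" "- s1 - s2 + R" "s1 + s3 - p13
                        + p24 - R" "- s4 + p14 + p24 + p34 - 2 * R" "- s3 + s4 + p13 - p14 + p23 - p24" "s2 +
                        s4 + p13 - p24 - p34" "- s2 - s4 - p13 + p24 + R"];
                  (use c1(1) c1(2) c4 c6(1) c6(2) f13_24 f14_23 f23 f24 f34_12 in linarith | simp add: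
                      algebra_simps))
            next
              case 2 note c6 = this
              show ?thesis
                by (rule nonneg_combination10[OF hit13 hit23 hit14 hit24 hit34 hit134 two par13 par14 dthree2
                    linear,
                    of "- p24 + R" "s2 + s3 - p23" "- p23 + R" "s2 + s4 - p24" "- s1 - s2 + R" "s1 + s2 + s3 +
                        s4 - p34 - R" "s2 + p13 + p14 - 2 * R" "- s2 - s4 - p13 + p24 + p34" "- s2 - s3 - p14
                        + p23 + p34" "- p34 + R"];
                  (use c5(1) c5(2) c6(1) c6(2) f12_34 f13_24 f14_23 f23 f24 f34_12 in linarith | simp add:
                      algebra_simps))
            next
              case 3 note c6 = this
              show ?thesis
                by (rule nonneg_combination10[OF hit13 hit23 hit14 hit24 hit34 hit134 two par13 par34 dthree2
                    linear,
                    of "- p24 + R" "s2 + s3 - p23" "- p23 + R" "s2 + s4 - p24" "- s1 - s2 + R" "s1 + s4 - p14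
                        + p23 - R" "- s3 + p13 + p23 + p34 - 2 * R" "s3 - s4 - p13 + p14 - p23 + p24" "s2 + s3
                        + p14 - p23 - p34" "- s2 - s3 - p14 + p23 + R"];
                  (use c2 c3(1) c3(2) c6(1) c6(2) f13_24 f14_23 f23 f24 f34_12 in linarith | simp add:
                      algebra_simps))
            qed
          qed
        next
          case 2 note c4 = this
          show ?thesis
            by (rule nonneg_combination10[OF hit13 hit23 hit14 hit24 hit34 hit134 two par14 par34 dtwo4
                linear,
                of "- p24 + R" "s2 + s3 - p23" "- p23 + R" "- p13 + R" "- s1 - s2 + R" "s1 + s3 - p13 + p24 -
                    R" "- s4 + p14 + p24 + p34 - 2 * R" "- s2 - s3 - p14 + p23 + R" "- p34 + R" "s2 + s4 + p13
                    - p24 - R"];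
              (use c1(1) c1(2) c2 c4 f12_34 f13_24 f14_23 f23 f24_13 f34_12 in linarith | simp add:
                  algebra_simps))
        qed
      next
        case 2 note c3 = this
        consider "2 * R \<le> s2 + p13 + p14" | "s2 + p13 + p14 \<le> 2 * R" by linarith
        then show ?thesis
        proof cases
          case 1 note c4 = this
          show ?thesis
            by (rule nonneg_combination10[OF hit13 hit23 hit14 hit24 hit34 hit134 loop3 par13 par34 dthree2
                linear,
                of "- p24 + R" "s2 + s3 - p23" "- s3 + p13 + p34 - R" "s2 + s4 - p24" "- s1 - s2 + R" "s1 + s3
                    + s4 - p13 - p14 - p34 + R" "s3 - p13 - p23 - p34 + 2 * R" "- s4 + p14 + p24 + p34 - 2 *
                    R" "s2 + p13 + p14 - 2 * R" "- s2 - s3 - p14 + p23 + R"];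
              (use c1(1) c2 c3(1) c3(2) c4 f13_24 f14_3 f23 f24 f34_12 in linarith | simp add: algebra_simps))
        next
          case 2 note c4 = this
          show ?thesis
            by (rule nonneg_combination10[OF hit13 hit23 hit14 hit24 hit34 hit134 loop3 loop1 par13 dthree2
                linear,
                of "- p24 + R" "s2 + s3 - p23" "- s3 + p13 + p34 - R" "s2 + s4 - p24" "- s1 + p13 + p14 - R"
                    "s1 + s3 + s4 - p13 - p14 - p34 + R" "s3 - p13 - p23 - p34 + 2 * R" "- s2 - p13 - p14 + 2
                    * R" "- s4 + p14 + p24 + p34 - 2 * R" "- s3 + p13 + p23 - R"];
              (use c1(1) c3(1) c3(2) c4 f12_3 f13_24 f14_3 f23 f24 f34_1 in linarith | simp add:
                  algebra_simps))
        qed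
      next
        case 3 note c3 = this
        consider "s1 + s2 + s3 + s4 \<le> p34 + R" | "p34 + R \<le> s1 + s2 + s3 + s4" by linarith
        then show ?thesis
        proof cases
          case 1 note c4 = this
          consider "s1 + s4 + p23 \<le> p14 + p34" | "p14 + p34 \<le> s1 + s4 + p23" by linarith
          then show ?thesis
          proof cases
            case 1 note c5 = this
            show ?thesis
              by (rule nonneg_combination10[OF hit13 hit23 hit14 hit24 hit34 loop3 loop1 two par13 dthree4
                  linear,
                  of "- p24 + R" "s2 + s3 - p23" "s1 + s4 - p14" "s2 + s4 - p24" "s3 + s4 - p34" "- p34 + R"
                      "- s2 - s3 - p14 + p23 + R" "- s3 + p13 + p23 - R" "s1 + s3 - p13 + p24 - R" "- s1 - s4
                      + p14 - p23 + p34"];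
                (use c1(2) c2 c5 f12_3 f12_34 f13_24 f14 f23 f24 f34 in linarith | simp add: algebra_simps))
          next
            case 2 note c5 = this
            show ?thesis
              by (rule nonneg_combination10[OF hit13 hit23 hit14 hit24 hit34 loop3 loop1 two par13 dthree2
                  linear,
                  of "- p24 + R" "s2 + s3 - p23" "s1 + s4 - p14" "s2 + s4 - p24" "s3 + s4 - p34" "- s1 - s4 +
                      p14 - p23 + R" "- s1 - s2 - s3 - s4 + p34 + R" "- s1 - s3 - s4 + p13 + p14 + p34 - R"
                      "s1 + s3 - p13 + p24 - R" "s1 + s4 - p14 + p23 - p34"];
                (use c1(2) c3(1) c3(2) c4 c5 f13_24 f14 f23 f24 f34 in linarith | simp add: algebra_simps))
          qed
        next
          case 2 note c4 = this
          show ?thesis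
            by (rule nonneg_combination10[OF hit13 hit23 hit14 hit24 hit34 loop3 two par13 par34 dthree2
                linear,
                of "- p24 + R" "s2 + s3 - p23" "s1 + s4 - p14" "s2 + s4 - p24" "- s1 - s2 + R" "- s1 - s4 +
                    p14 - p23 + R" "- s1 - s3 - s4 + p13 + p14 + p34 - R" "s1 + s3 - p13 + p24 - R" "s1 + s2 +
                    s3 + s4 - p34 - R" "- s2 - s3 - p14 + p23 + R"];
              (use c1(2) c2 c3(1) c3(2) c4 f13_24 f14 f23 f24 f34_12 in linarith | simp add: algebra_simps))
        qed
      qed
    qed
  qed
qed

text \<open>
  The extreme rays of the cone of polymatroids on a four-element set \<open>N\<close>.
\<close>

inductive_set rays :: "nat set \<Rightarrow> (nat set \<Rightarrow> real) set" for N :: "nat set" where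
  hit: "A \<subseteq> N \<Longrightarrow> A \<noteq> {} \<Longrightarrow> hit A \<in> rays N"
| two: "cap 2 (\<lambda>_. 1) \<in> rays N"
| three: "cap 3 (\<lambda>_. 1) \<in> rays N"
| loop: "i \<in> N \<Longrightarrow> cap 2 ((\<lambda>_. 1)(i := 0)) \<in> rays N"
| double_two: "i \<in> N \<Longrightarrow> cap 2 ((\<lambda>_. 1)(i := 2)) \<in> rays N"
| double_three: "i \<in> N \<Longrightarrow> cap 3 ((\<lambda>_. 1)(i := 2)) \<in> rays N"
| parallel: "i \<in> N \<Longrightarrow> j \<in> N \<Longrightarrow> i \<noteq> j \<Longrightarrow> parallel i j \<in> rays N"
| ingleton: "i \<in> N \<Longrightarrow> j \<in> N \<Longrightarrow> i \<noteq> j \<Longrightarrow> ingleton i j \<in> rays N"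

section \<open>Reduction of arbitrary polymatroids to the face with a modular least pair\<close>

lemma submodular_insert:
  assumes "submodular N f" "insert i (insert j K) \<subseteq> N" "i \<notin> K" "j \<notin> K" "i \<noteq> j"
  shows "f K + f (insert i (insert j K)) \<le> f (insert i K) + f (insert j K)"
proof -
  have "insert i K \<inter> insert j K = K" "insert i K \<union> insert j K = insert i (insert j K)"
    using assms by auto
  then show ?thesis using assms unfolding submodular_def by (metis insert_subset)
qed

text \<open>
  Subtracting \<open>f N - f (N - {i})\<close> times \<open>hit {i}\<close> for each \<open>i\<close> makes \<open>f\<close> constant on sets with at least
  three elements, and subtracting a multiple of \<open>hit N\<close> then makes the least pair modular.
\<close>

lemma functional_nonneg_least_pair:
  fixes l f :: "nat set \<Rightarrow> real"
  assumes D: "distinct [a, b, c, d]" and N: "N = {a, b, c, d}"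
    and nonneg: "0 \<le> f {}" and mono: "mono_on (Pow N) f" and sub: "submodular N f"
    and one: "0 \<le> ev N l (\<lambda>_. 1)" and rays: "\<And>r. r \<in> rays N \<Longrightarrow> 0 \<le> ev N l r"
    and least: "\<And>i j. i \<in> N \<Longrightarrow> j \<in> N \<Longrightarrow> i \<noteq> j \<Longrightarrow> f {a} + f {b} - f {a, b} \<le> f {i} + f {j} - f {i, j}"
  shows "0 \<le> ev N l f"
proof -
  note neq = distinct4_neq[OF D]
  \<comment> \<open>\<open>L\<close> evaluates the functional at the normalized polymatroid with the
    given coordinates; the modular pair {a, b} contributes s1 + s2 and all triples share the value
    R.\<close>
  define L where "L = (\<lambda>(s1, s2, s3, s4, p13, p14, p23, p24, p34, R). l {a} * s1 + l {b} * s2 + l {c} * s3 + l {d} * s4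
    + l {a, b} * (s1 + s2) + l {a, c} * p13 + l {a, d} * p14 + l {b, c} * p23 + l {b, d} * p24 + l {c, d} * p34
    + (l {a, b, c} + l {a, b, d} + l {a, c, d} + l {b, c, d} + l N) * R)"
  have linear: "linear L" by (rule linearI) (auto simp: L_def algebra_simps)
  have hits: "0 \<le> L (1, 0, 1, 0, 1, 1, 1, 0, 1, 1)" "0 \<le> L (0, 1, 1, 0, 1, 0, 1, 1, 1, 1)"
    "0 \<le> L (1, 0, 0, 1, 1, 1, 0, 1, 1, 1)" "0 \<le> L (0, 1, 0, 1, 0, 1, 1, 1, 1, 1)"
    "0 \<le> L (0, 0, 1, 1, 1, 1, 1, 1, 1, 1)" "0 \<le> L (1, 0, 1, 1, 1, 1, 1, 1, 1, 1)" "0 \<le> L (0, 1, 1, 1, 1, 1, 1, 1, 1, 1)"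
    using rays[OF rays.hit, of "{a, c}"] rays[OF rays.hit, of "{b, c}"] rays[OF rays.hit, of "{a, d}"]
      rays[OF rays.hit, of "{b, d}"] rays[OF rays.hit, of "{c, d}"] rays[OF rays.hit, of "{a, c, d}"]
      rays[OF rays.hit, of "{b, c, d}"]
    by (simp_all add: ev4[OF D] neq hit_def L_def N algebra_simps)
  have caps: "0 \<le> L (1, 1, 1, 0, 2, 1, 2, 1, 1, 2)" "0 \<le> L (1, 1, 0, 1, 1, 2, 1, 2, 1, 2)"
    "0 \<le> L (1, 0, 1, 1, 2, 2, 1, 1, 2, 2)" "0 \<le> L (0, 1, 1, 1, 1, 1, 2, 2, 2, 2)"
    "0 \<le> L (1, 1, 1, 1, 2, 2, 2, 2, 2, 2)" "0 \<le> L (1, 1, 1, 1, 2, 2, 2, 2, 2, 3)"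
    using rays[OF rays.loop, of d] rays[OF rays.loop, of c] rays[OF rays.loop, of b] rays[OF rays.loop, of a]
      rays[OF rays.two] rays[OF rays.three]
    by (simp_all add: ev4[OF D] neq cap_def L_def N algebra_simps)
  have pars: "0 \<le> L (1, 1, 1, 1, 1, 2, 2, 2, 2, 2)" "0 \<le> L (1, 1, 1, 1, 2, 1, 2, 2, 2, 2)"
    "0 \<le> L (1, 1, 1, 1, 2, 2, 1, 2, 2, 2)" "0 \<le> L (1, 1, 1, 1, 2, 2, 2, 1, 2, 2)" "0 \<le> L (1, 1, 1, 1, 2, 2, 2, 2, 1, 2)"
    using rays[OF rays.parallel, of a c] rays[OF rays.parallel, of a d] rays[OF rays.parallel, of b c]
      rays[OF rays.parallel, of b d] rays[OF rays.parallel, of c d]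
    by (simp_all add: ev4[OF D] neq parallel_def hit_def L_def N algebra_simps)
  have doubles: "0 \<le> L (1, 1, 2, 1, 2, 2, 2, 2, 2, 2)" "0 \<le> L (1, 1, 1, 2, 2, 2, 2, 2, 2, 2)"
    "0 \<le> L (2, 1, 1, 1, 3, 3, 2, 2, 2, 3)" "0 \<le> L (1, 2, 1, 1, 2, 2, 3, 3, 2, 3)"
    "0 \<le> L (1, 1, 2, 1, 3, 2, 3, 2, 3, 3)" "0 \<le> L (1, 1, 1, 2, 2, 3, 2, 3, 3, 3)"
    using rays[OF rays.double_two, of c] rays[OF rays.double_two, of d] rays[OF rays.double_three, of a]
      rays[OF rays.double_three, of b] rays[OF rays.double_three, of c] rays[OF rays.double_three, of d]
    by (simp_all add: ev4[OF D] neq cap_def L_def N algebra_simps)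
  have ing: "0 \<le> L (2, 2, 2, 2, 3, 3, 3, 3, 3, 4)"
    using rays[OF rays.ingleton, of a b]
    by (simp add: ev4[OF D] neq ingleton_def doubleton_eq_iff L_def N algebra_simps)
  \<comment> \<open>The last increments at N, nonnegative by monotonicity, and the submodular
    deficit of the pair {a, b} over the empty set.\<close>
  define ca cb cc cd m where "ca = f N - f {b, c, d}" and "cb = f N - f {a, c, d}" and "cc = f N - f {a, b, d}"
    and "cd = f N - f {a, b, c}" and "m = f {a} + f {b} - f {a, b} - f {}"
  have c: "0 \<le> ca" "0 \<le> cb" "0 \<le> cc" "0 \<le> cd"
    unfolding ca_def cb_def cc_def cd_def N using mono by (auto simp: N mono_on_def)
  note S = submodular_insert[OF sub, unfolded N]
  have m: "0 \<le> m" using S[of a b "{}"] neq by (simp add: m_def)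
  define s1 s2 s3 s4 where "s1 = f {a} - f {} - ca - m" and "s2 = f {b} - f {} - cb - m"
    and "s3 = f {c} - f {} - cc - m" and "s4 = f {d} - f {} - cd - m"
  define p13 p14 p23 p24 p34 R where "p13 = f {a, c} - f {} - ca - cc - m" and "p14 = f {a, d} - f {} - ca - cd - m"
    and "p23 = f {b, c} - f {} - cb - cc - m" and "p24 = f {b, d} - f {} - cb - cd - m"
    and "p34 = f {c, d} - f {} - cc - cd - m" and "R = f N - f {} - ca - cb - cc - cd - m"
  note defs = s1_def s2_def s3_def s4_def p13_def p14_def p23_def p24_def p34_def R_def ca_def cb_def cc_def cd_def m_def
  \<comment> \<open>Subtracting m times \<open>hit N\<close> lowers the deficit of every pair over
    the empty set by m and leaves the deficits over nonempty sets unchanged. So the minimality of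
    {a, b} enters only here.\<close>
  have I0: "p13 \<le> s1 + s3" "p14 \<le> s1 + s4" "p23 \<le> s2 + s3" "p24 \<le> s2 + s4" "p34 \<le> s3 + s4"
    unfolding defs using least[of a c] least[of a d] least[of b c] least[of b d] least[of c d] neq by (simp_all add: N)
  have S0: "f {c} + f {a, b, c} \<le> f {a, c} + f {b, c}"
    using S[of a b "{c}"] neq by (simp add: N insert_commute)
  have S1: "f {d} + f {a, b, d} \<le> f {a, d} + f {b, d}"
    using S[of a b "{d}"] neq by (simp add: N insert_commute)
  have S2: "f {c, d} + f N \<le> f {a, c, d} + f {b, c, d}"
    using S[of a b "{c, d}"] neq by (simp add: N insert_commute)
  have S3: "f {b} + f {a, b, c} \<le> f {a, b} + f {b, c}"
    using S[of a c "{b}"] neq by (simp add: N insert_commute)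
  have S4: "f {d} + f {a, c, d} \<le> f {a, d} + f {c, d}"
    using S[of a c "{d}"] neq by (simp add: N insert_commute)
  have S5: "f {b, d} + f N \<le> f {a, b, d} + f {b, c, d}"
    using S[of a c "{b, d}"] neq by (simp add: N insert_commute)
  have S6: "f {b} + f {a, b, d} \<le> f {a, b} + f {b, d}"
    using S[of a d "{b}"] neq by (simp add: N insert_commute)
  have S7: "f {c} + f {a, c, d} \<le> f {a, c} + f {c, d}"
    using S[of a d "{c}"] neq by (simp add: N insert_commute)
  have S8: "f {b, c} + f N \<le> f {a, b, c} + f {b, c, d}"
    using S[of a d "{b, c}"] neq by (simp add: N insert_commute)
  have S9: "f {a} + f {a, b, c} \<le> f {a, b} + f {a, c}"
    using S[of b c "{a}"] neq by (simp add: N insert_commute)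
  have S10: "f {d} + f {b, c, d} \<le> f {b, d} + f {c, d}"
    using S[of b c "{d}"] neq by (simp add: N insert_commute)
  have S11: "f {a, d} + f N \<le> f {a, b, d} + f {a, c, d}"
    using S[of b c "{a, d}"] neq by (simp add: N insert_commute)
  have S12: "f {a} + f {a, b, d} \<le> f {a, b} + f {a, d}"
    using S[of b d "{a}"] neq by (simp add: N insert_commute)
  have S13: "f {c} + f {b, c, d} \<le> f {b, c} + f {c, d}"
    using S[of b d "{c}"] neq by (simp add: N insert_commute)
  have S14: "f {a, c} + f N \<le> f {a, b, c} + f {a, c, d}"
    using S[of b d "{a, c}"] neq by (simp add: N insert_commute)
  have S15: "f {a} + f {a, c, d} \<le> f {a, c} + f {a, d}"
    using S[of c d "{a}"] neq by (simp add: N insert_commute)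
  have S16: "f {b} + f {b, c, d} \<le> f {b, c} + f {b, d}"
    using S[of c d "{b}"] neq by (simp add: N insert_commute)
  have S17: "f {a, b} + f N \<le> f {a, b, c} + f {a, b, d}"
    using S[of c d "{a, b}"] neq by (simp add: N insert_commute)
  have I1_0: "s3 + R \<le> p13 + p23" using S0 unfolding defs by linarith
  have I1_1: "s4 + R \<le> p14 + p24" using S1 unfolding defs by linarith
  have I1_2: "R \<le> s1 + p23" using S3 unfolding defs by linarith
  have I1_3: "s4 + R \<le> p14 + p34" using S4 unfolding defs by linarith
  have I1_4: "R \<le> s1 + p24" using S6 unfolding defs by linarith
  have I1_5: "s3 + R \<le> p13 + p34" using S7 unfolding defs by linarith
  have I1_6: "R \<le> s2 + p13" using S9 unfolding defs by linarith
  have I1_7: "s4 + R \<le> p24 + p34" using S10 unfolding defs by linarith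
  have I1_8: "R \<le> s2 + p14" using S12 unfolding defs by linarith
  have I1_9: "s3 + R \<le> p23 + p34" using S13 unfolding defs by linarith
  have I1_10: "s1 + R \<le> p13 + p14" using S15 unfolding defs by linarith
  have I1_11: "s2 + R \<le> p23 + p24" using S16 unfolding defs by linarith
  have I2_0: "p34 \<le> R" using S2 unfolding defs by linarith
  have I2_1: "p24 \<le> R" using S5 unfolding defs by linarith
  have I2_2: "p23 \<le> R" using S8 unfolding defs by linarith
  have I2_3: "p14 \<le> R" using S11 unfolding defs by linarith
  have I2_4: "p13 \<le> R" using S14 unfolding defs by linarith
  have I2_5: "s1 + s2 \<le> R" using S17 unfolding defs by linarith
  note I1 = I1_0 I1_1 I1_2 I1_3 I1_4 I1_5 I1_6 I1_7 I1_8 I1_9 I1_10 I1_11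
  note I2 = I2_0 I2_1 I2_2 I2_3 I2_4 I2_5
  have rest: "0 \<le> L (s1, s2, s3, s4, p13, p14, p23, p24, p34, R)"
    by (rule face_nonneg[OF linear]) (fact I0 I1 I2 hits caps pars doubles ing)+
  \<comment> \<open>Undoes the normalization: f is a combination of the constant, the four singleton
    hits, \<open>hit N\<close> and the normalized polymatroid.\<close>
  have "ev N l f = f {} * ev N l (\<lambda>_. 1) + ca * ev N l (hit {a}) + cb * ev N l (hit {b}) + cc * ev N l (hit {c})
    + cd * ev N l (hit {d}) + m * ev N l (hit N) + L (s1, s2, s3, s4, p13, p14, p23, p24, p34, R)"
    unfolding L_def by (simp add: ev4[OF D] neq hit_def N) (simp add: defs N algebra_simps)
  moreover have "0 \<le> ev N l (hit {a})" "0 \<le> ev N l (hit {b})" "0 \<le> ev N l (hit {c})" "0 \<le> ev N l (hit {d})" "0 \<le> ev N l (hit N)"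
    using rays[OF rays.hit] by (simp_all add: N)
  ultimately show ?thesis using nonneg one c m rest by simp
qed

lemma obtain_pair_labels:
  assumes "i \<in> N" "j \<in> N" "i \<noteq> j" "card N = 4"
  obtains k l where "distinct [i, j, k, l]" "N = {i, j, k, l}"
proof -
  have "finite N" using assms(4) card.infinite by fastforce
  then have "card (N - {i, j}) = 2" using assms by (simp add: card_Diff_subset)
  then obtain k l where "N - {i, j} = {k, l}" "k \<noteq> l" by (auto simp: card_2_iff)
  then have "distinct [i, j, k, l]" "N = {i, j, k, l}" using assms by auto
  then show ?thesis by (rule that)
qed

lemma functional_nonneg:
  fixes l f :: "nat set \<Rightarrow> real"
  assumes card: "card N = 4" and f: "nonneg_on N f" "mono_on (Pow N) f" "submodular N f"
    and one: "0 \<le> ev N l (\<lambda>_. 1)" and rays: "\<And>r. r \<in> rays N \<Longrightarrow> 0 \<le> ev N l r"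
  shows "0 \<le> ev N l f"
proof -
  let ?P = "{(i, j). i \<in> N \<and> j \<in> N \<and> i \<noteq> j}"
  let ?g = "\<lambda>(i, j). f {i} + f {j} - f {i, j}"
  have "finite N" using card card.infinite by fastforce
  then have fin: "finite ?P" by (rule_tac finite_subset[of _ "N \<times> N"]) auto
  obtain i where "i \<in> N" using card by fastforce
  moreover have "N \<noteq> {i}" using card by auto
  ultimately obtain j where "(i, j) \<in> ?P" by blast
  then have ne: "?P \<noteq> {}" by blast
  have "Min (?g ` ?P) \<in> ?g ` ?P" using fin ne by (intro Min_in) auto
  then obtain q where q: "q \<in> ?P" "Min (?g ` ?P) = ?g q" by (rule imageE) (metis that)
  obtain a b where qab: "q = (a, b)" by (cases q)
  have least: "f {a} + f {b} - f {a, b} \<le> f {i} + f {j} - f {i, j}" if "i \<in> N" "j \<in> N" "i \<noteq> j" for i j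
    using Min_le[of "?g ` ?P" "?g (i, j)"] fin q that unfolding qab by fastforce
  have ab: "a \<in> N" "b \<in> N" "a \<noteq> b" using q(1) unfolding qab by auto
  from obtain_pair_labels[OF ab card] obtain c d where "distinct [a, b, c, d]" "N = {a, b, c, d}" .
  then show ?thesis
    using f(1) by (intro functional_nonneg_least_pair[OF _ _ _ f(2,3) one rays least]) (simp_all add: nonneg_on_def)
qed

section \<open>Assembly of the bound, and its tightness\<close>

lemma sorted_labels:
  fixes x :: "nat \<Rightarrow> real"
  assumes "card N = 4"
  obtains a b c d where "distinct [a, b, c, d]" "N = {a, b, c, d}" "x a \<le> x b" "x b \<le> x c" "x c \<le> x d"
proof -
  have "finite N" using assms card.infinite by fastforce
  then obtain ys where ys: "set ys = N" "distinct ys" using finite_distinct_list by blast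
  define zs where "zs = sort_key x ys"
  have zs: "set zs = N" "distinct zs" "sorted (map x zs)" using ys by (simp_all add: zs_def)
  moreover have "length zs = 4" using zs assms distinct_card[of zs] by simp
  ultimately obtain a b c d where "zs = [a, b, c, d]"
    by (auto simp: length_Suc_conv numeral_eq_Suc)
  then show ?thesis using zs that[of a b c d] by auto
qed

lemma obtain_label:
  assumes "i \<in> N" "card N = 4"
  obtains j k l where "distinct [j, k, l, i]" "N = {j, k, l, i}"
proof -
  have "N \<noteq> {i}" using assms by auto
  then obtain j where j: "j \<in> N" "j \<noteq> i" using assms(1) by blast
  obtain k l where "distinct [j, i, k, l]" "N = {j, i, k, l}"
    using obtain_pair_labels[OF j(1) assms(1) j(2) assms(2)] .
  then have "distinct [j, k, l, i]" "N = {j, k, l, i}" by auto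
  then show ?thesis by (rule that)
qed

text \<open>The weights come from the fifteen special rays. The other twenty-six are dominated by
  every pairwise independent choice, after labels that put the ray into standard position.\<close>

lemma all_rays_dominated:
  fixes x :: "nat \<Rightarrow> real"
  assumes card: "card N = 4" and x: "\<forall>i\<in>N. x i \<in> {0..1}"
  shows "\<exists>p\<in>pairwise_feasible_weights N x. \<forall>r\<in>rays N. dominates N x p r"
proof -
  obtain a b c d where D: "distinct [a, b, c, d]" and N: "N = {a, b, c, d}"
    and sorted: "x a \<le> x b" "x b \<le> x c" "x c \<le> x d"
    using sorted_labels[OF card] .
  from special_rays_dominated[OF D N x sorted] obtain p
    where p: "p \<in> pairwise_feasible_weights N x"
      and hits: "\<forall>A\<in>{{a, b, c}, {a, b, d}, {a, c, d}, {b, c, d}, N}. dominates N x p (hit A)"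
      and parallels: "\<forall>(i, j)\<in>{(a, b), (a, c), (a, d), (b, c), (b, d), (c, d)}. dominates N x p (parallel i j)"
      and doubles: "\<forall>i\<in>N. dominates N x p (cap 2 ((\<lambda>_. 1)(i := 2)))" by blast
  have one: "dominates N x p (hit {i})" "dominates N x p (cap 2 ((\<lambda>_. 1)(i := 0)))"
    "dominates N x p (cap 3 ((\<lambda>_. 1)(i := 2)))" if i: "i \<in> N" for i
  proof -
    obtain j k l where E: "distinct [j, k, l, i]" and M: "N = {j, k, l, i}" using obtain_label[OF i card] .
    have E': "distinct [i, j, k, l]" and M': "N = {i, j, k, l}" using E M by auto
    show "dominates N x p (hit {i})"
      unfolding dominates_def using dominates_hit1[OF E'] x p by (simp add: M')
    show "dominates N x p (cap 2 ((\<lambda>_. 1)(i := 0)))" "dominates N x p (cap 3 ((\<lambda>_. 1)(i := 2)))"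
      unfolding dominates_def using dominates_loop[OF E] dominates_double3[OF E] x p by (simp_all add: M)
  qed
  have two: "dominates N x p (hit {i, j})" "dominates N x p (ingleton i j)"
    if ij: "i \<in> N" "j \<in> N" "i \<noteq> j" for i j
  proof -
    obtain k l where E: "distinct [i, j, k, l]" and M: "N = {i, j, k, l}" using obtain_pair_labels[OF ij card] .
    show "dominates N x p (hit {i, j})" "dominates N x p (ingleton i j)"
      unfolding dominates_def using dominates_hit2[OF E] dominates_ingleton[OF E] x p by (simp_all add: M)
  qed
  have uniform: "dominates N x p (cap 2 (\<lambda>_. 1))" "dominates N x p (cap 3 (\<lambda>_. 1))"
    unfolding dominates_def using dominates_uniform2[OF D] dominates_uniform3[OF D] x p by (simp_all add: N)
  have mem: "a \<in> N" "b \<in> N" "c \<in> N" "d \<in> N" by (simp_all add: N)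
  have swap: "parallel i j = parallel j i" for i j by (simp add: parallel_def insert_commute fun_eq_iff)
  have "dominates N x p (parallel a b)" "dominates N x p (parallel a c)" "dominates N x p (parallel a d)"
    "dominates N x p (parallel b c)" "dominates N x p (parallel b d)" "dominates N x p (parallel c d)"
    using parallels by simp_all
  then have parallels': "\<forall>i\<in>{a, b, c, d}. \<forall>j\<in>{a, b, c, d}. i \<noteq> j \<longrightarrow> dominates N x p (parallel i j)"
    by (simp add: swap[of b a] swap[of c a] swap[of d a] swap[of c b] swap[of d b] swap[of d c])
  have "dominates N x p r" if "r \<in> rays N" for r
    using that
  proof cases
    case (hit A)
    have "A \<in> {{a}, {b}, {c}, {d}} \<or> A \<in> {{a, b}, {a, c}, {a, d}, {b, c}, {b, d}, {c, d}} \<or>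
      A \<in> {{a, b, c}, {a, b, d}, {a, c, d}, {b, c, d}, N}"
      using hit(2,3) unfolding N Pow_iff[symmetric] by (simp add: Pow_insert) argo
    then show ?thesis
    proof (elim disjE)
      assume "A \<in> {{a}, {b}, {c}, {d}}"
      then show ?thesis using one(1) mem unfolding hit(1) by blast
    next
      assume "A \<in> {{a, b}, {a, c}, {a, d}, {b, c}, {b, d}, {c, d}}"
      then show ?thesis using two(1) mem D unfolding hit(1) by auto
    qed (use hits hit(1) in blast)
  next
    case (parallel i j)
    then show ?thesis using parallels' by (simp only: flip: N) blast
  qed (use one two uniform doubles in auto)
  then show ?thesis using p by blast
qed

lemma ev_hit_pair:
  assumes D: "distinct [a, b, c, d]" and p: "p \<in> pairwise_feasible_weights {a, b, c, d} x"
  shows "ev {a, b, c, d} p (hit {a, b}) = x a + x b - x a * x b"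
proof -
  note neq = distinct4_neq[OF D]
  show ?thesis
    using pairwise_feasible4(1)[OF D p] feasible4(18,19)[OF D subsetD[OF pairwise_feasible_subset p]]
    by (simp add: ev4[OF D] hit_def neq)
qed

lemma correlation_gap_le:
  assumes card: "card N = 4" and f: "nonneg_on N f" "mono_on (Pow N) f" "submodular N f"
    and x: "\<forall>i\<in>N. x i \<in> {0..1}"
  shows "3 / 4 * concave_closure N f x \<le> pairwise_indep_extension N f x"
proof -
  have fin: "finite N" using card card.infinite by fastforce
  obtain p where p: "p \<in> pairwise_feasible_weights N x" and dom: "\<forall>r\<in>rays N. dominates N x p r"
    using all_rays_dominated[OF card x] by blast
  obtain u where u: "u \<in> feasible_weights N x" and closure: "concave_closure N f x = ev N u f"
    using concave_closure_attained[OF fin x, of f] unfolding ev_def by blast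
  have extension: "ev N p f \<le> pairwise_indep_extension N f x"
    using pairwise_indep_extension_attained[OF fin x, of f] p unfolding ev_def by force
  \<comment> \<open>u is optimal for f, so nonnegativity of this functional at f compares E_p f with
    3/4 of the concave closure.\<close>
  define l where "l S = p S - 3 / 4 * u S" for S
  have l: "ev N l g = ev N p g - 3 / 4 * ev N u g" for g
    by (simp add: ev_def l_def algebra_simps sum_subtractf sum_distrib_left)
  have "ev N p (\<lambda>_. 1) = 1" "ev N u (\<lambda>_. 1) = 1"
    using u p by (simp_all add: ev_def feasible_weights_def pairwise_feasible_weights_def)
  then have one: "0 \<le> ev N l (\<lambda>_. 1)" by (simp add: l)
  have "0 \<le> ev N l f"
    by (rule functional_nonneg[OF card f one]) (use dom u in \<open>simp add: l dominates_def\<close>)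
  then show ?thesis using extension by (simp add: l closure)
qed

lemma hit_polymatroid:
  "nonneg_on N (hit A)" "mono_on (Pow N) (hit A)" "submodular N (hit A)"
  by (auto simp: nonneg_on_def submodular_def hit_def mono_on_def)

lemma correlation_gap_attained:
  defines "x \<equiv> (\<lambda>i::nat. if i \<le> 2 then 1 / 2 else 0 :: real)"
  shows "concave_closure N4 (hit {1, 2}) x = 1" "pairwise_indep_extension N4 (hit {1, 2}) x = 3 / 4"
proof -
  have D: "distinct [1, 2, 3, 4 :: nat]" by simp
  have x: "\<forall>i\<in>N4. x i \<in> {0..1}" by (simp add: x_def)
  obtain u where u: "u \<in> feasible_weights N4 x" and closure: "concave_closure N4 (hit {1, 2}) x = ev N4 u (hit {1, 2})"
    and max: "\<forall>v\<in>feasible_weights N4 x. ev N4 v (hit {1, 2}) \<le> ev N4 u (hit {1, 2})"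
    using concave_closure_attained[OF _ x, of "hit {1, 2}"] unfolding ev_def by auto
  \<comment> \<open>Exactly one of the elements 1 and 2 occurs, so {1, 2} is always met; pairwise
    independence instead makes both occur together with probability 1/4 and meets it with
    probability 3/4.\<close>
  define v where "v S = (if S = {1} \<or> S = {2} then 1 / 2 else 0 :: real)" for S :: "nat set"
  have v: "v \<in> feasible_weights N4 x"
    unfolding feasible_weights_def mem_Collect_eq
    by (simp add: sum_superset sum_Pow4[OF D] del: One_nat_def) (simp add: v_def x_def doubleton_eq_iff)
  have "ev N4 v (hit {1, 2}) = 1" by (simp add: ev4[OF D] v_def hit_def doubleton_eq_iff del: One_nat_def)
  moreover obtain q where q: "q \<in> pairwise_feasible_weights N4 x" using independent_weights_feasible[OF _ x] by blast
  moreover have "ev N4 u (hit {1, 2}) \<le> 1"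
    by (rule ev_hit_le_1[OF D x q u])
  ultimately show "concave_closure N4 (hit {1, 2}) x = 1" using closure max v by force
  obtain p where p: "p \<in> pairwise_feasible_weights N4 x"
    and "pairwise_indep_extension N4 (hit {1, 2}) x = ev N4 p (hit {1, 2})"
    using pairwise_indep_extension_attained[OF _ x, of "hit {1, 2}"] unfolding ev_def by auto
  then show "pairwise_indep_extension N4 (hit {1, 2}) x = 3 / 4"
    using ev_hit_pair[OF D p] by (simp add: x_def)
qed

theorem theorem1:
  shows "(\<forall>f x. nonneg_on N4 f \<and> mono_on (Pow N4) f \<and> submodular N4 f \<and>
              (\<forall>i\<in>N4. x i \<in> {0..1}) \<and> pairwise_indep_extension N4 f x > 0 \<longrightarrow>
            concave_closure N4 f x / pairwise_indep_extension N4 f x \<le> 4 / 3) \<and>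
         (\<exists>f x. nonneg_on N4 f \<and> mono_on (Pow N4) f \<and> submodular N4 f \<and>
              (\<forall>i\<in>N4. x i \<in> {0..1}) \<and> pairwise_indep_extension N4 f x > 0 \<and>
            concave_closure N4 f x / pairwise_indep_extension N4 f x = 4 / 3)"
proof (intro conjI allI impI)
  fix f x
  assume "nonneg_on N4 f \<and> mono_on (Pow N4) f \<and> submodular N4 f \<and>
    (\<forall>i\<in>N4. x i \<in> {0..1}) \<and> pairwise_indep_extension N4 f x > 0"
  then show "concave_closure N4 f x / pairwise_indep_extension N4 f x \<le> 4 / 3"
    using correlation_gap_le[of N4 f x] by (simp add: field_simps)
next
  show "\<exists>f x. nonneg_on N4 f \<and> mono_on (Pow N4) f \<and> submodular N4 f \<and>
      (\<forall>i\<in>N4. x i \<in> {0..1}) \<and> pairwise_indep_extension N4 f x > 0 \<and>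
      concave_closure N4 f x / pairwise_indep_extension N4 f x = 4 / 3"
    by (intro exI[of _ "hit {1, 2}"] exI[of _ "\<lambda>i. if i \<le> 2 then 1 / 2 else 0"])
      (simp add: hit_polymatroid correlation_gap_attained del: One_nat_def)
qed

end
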